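(* Let $S \subseteq \mathbb{R}^d$ be a measurable set of finite measure. Let $\Lambda \subseteq \mathbb{R}^d$ be an almost repetitive set (in particular, separated and relatively dense). Then the following assertions hold: (i) If $E(\Lambda)$ is a frame for $L^2(S)$ and $D^-(\Lambda) = |S|$, then $E(\Lambda)$ is a Riesz basis for $L^2(S)$. (ii) If $E(\Lambda)$ is a Riesz sequence in $L^2(S)$ and $D^+(\Lambda) = |S|$, then $E(\Lambda)$ is a Riesz basis for $L^2(S)$.
   Context: $|U|$ denotes the Lebesgue measure of $U \subseteq \mathbb{R}^d$, $B_r(x)$ the open Euclidean ball of radius $r$ and center $x$. For $\lambda \in \mathbb{R}^d$ let $e_\lambda(t) = e^{2\pi i \lambda \cdot t}$, $t \in S$, regarded as an element of $L^2(S)$, and $E(\Lambda) = \{e_\lambda : \lambda \in \Lambda\}$. A set $\Lambda \subseteq \mathbb{R}^d$ is separated if $\inf\{|\lambda-\lambda'| : \lambda,\lambda' \in \Lambda,\ \lambda \neq \lambda'\} > 0$, and relatively dense if there is $r>0$ with $\mathbb{R}^d = \bigcup_{\lambda\in\Lambda} B_r(\lambda)$. A sequence $\{\Lambda_n\}_{n\in\mathbb{N}}$ of subsets of $\mathbb{R}^d$ converges weakly to $\Gamma \subseteq \mathbb{R}^d$ if: (1) for every $\gamma \in \Gamma$ there exist $\lambda_n \in \Lambda_n$ with $\lambda_n \to \gamma$; and (2) whenever $(n_k)_k$ is a subsequence of $\mathbb{N}$ and $\lambda_{n_k} \in \Lambda_{n_k}$ satisfy $\lambda_{n_k} \to \gamma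 \in \mathbb{R}^d$, then $\gamma \in \Gamma$. $W(\Lambda)$ is the set of all weak limits of sequences of translates $\{\Lambda - x_n\}_{n\in\mathbb{N}}$, $x_n \in \mathbb{R}^d$. Almost repetitivity: a separated and relatively dense set $\Lambda \subseteq \mathbb{R}^d$ is almost repetitive if and only if $W(\Gamma) = W(\Lambda)$ for all $\Gamma \in W(\Lambda)$; this characterization may be taken as the definition. $E(\Lambda)$ is a frame for $L^2(S)$ if there are $0<A\le B<\infty$ with $A\|f\|^2 \le \sum_{\lambda\in\Lambda} |\langle f, e_\lambda\rangle|^2 \le B\|f\|^2$ for all $f \in L^2(S)$. It is a Riesz sequence in $L^2(S)$ if there are $0<A\le B<\infty$ with $A\|c\|_{\ell^2(\Lambda)}^2 \le \|\sum_{\lambda\in\Lambda} c_\lambda e_\lambda\|^2 \le B\|c\|_{\ell^2(\Lambda)}^2$ for all $c \in \ell^2(\Lambda)$. It is a Riesz basis for $L^2(S)$ if it is a complete Riesz sequence (equivalently, simultaneously a frame and a Riesz sequence). The lower and upper Beurling densities are $$D^-(\Lambda) = \liminf_{r\to\infty}\inf_{x\in\mathbb{R}^d} \frac{\#(\Lambda\cap B_r(x))}{|B_r(0)|}, \qquad D^+(\Lambda) = \limsup_{r\to\infty}\sup_{x\in\mathbb{R}^d} \frac{\#(\Lambda\cap B_r(x))}{|B_r(0)|}.$$ *)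

theory Defs
  imports "HOL-Analysis.Analysis"
begin

text \<open>The infimum is taken in the extended reals, so that it is \<open>\<infinity>\<close> (rather than
  unspecified) for sets with fewer than two points.\<close>

definition separated :: "'a::euclidean_space set \<Rightarrow> bool" where
  "separated \<Lambda> \<longleftrightarrow>
     (INF (x, y) \<in> {(x, y). x \<in> \<Lambda> \<and> y \<in> \<Lambda> \<and> x \<noteq> y}. ereal (norm (x - y))) > 0"

lemma separated_iff_uniform_discrete: "separated \<Lambda> \<longleftrightarrow> uniform_discrete \<Lambda>"
proof
  let ?P = "{(x, y). x \<in> \<Lambda> \<and> y \<in> \<Lambda> \<and> x \<noteq> y}"
  assume "separated \<Lambda>"
  then obtain e where e: "0 < ereal e"
    "ereal e < (INF (x, y) \<in> ?P. ereal (norm (x - y)))"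
    unfolding separated_def zero_ereal_def using ereal_dense2 by blast
  have "x = y" if "x \<in> \<Lambda>" "y \<in> \<Lambda>" "dist x y < e" for x y
  proof (rule ccontr)
    assume "x \<noteq> y"
    then have "(x, y) \<in> ?P" using that by simp
    then have "(INF (x, y) \<in> ?P. ereal (norm (x - y))) \<le> ereal (norm (x - y))"
      by (rule INF_lower2) simp
    with e(2) have "ereal e < ereal (norm (x - y))" by (rule less_le_trans)
    with that(3) show False by (simp add: dist_norm)
  qed
  with e(1) show "uniform_discrete \<Lambda>" by (auto simp: uniform_discrete_def)
next
  let ?P = "{(x, y). x \<in> \<Lambda> \<and> y \<in> \<Lambda> \<and> x \<noteq> y}"
  assume "uniform_discrete \<Lambda>"
  then obtain e where e: "e > 0" "\<And>x y. x \<in> \<Lambda> \<Longrightarrow> y \<in> \<Lambda> \<Longrightarrow> dist x y < e \<Longrightarrow> x = y"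
    unfolding uniform_discrete_def by blast
  have "ereal e \<le> (INF (x, y) \<in> ?P. ereal (norm (x - y)))"
  proof (rule INF_greatest)
    fix p assume "p \<in> ?P"
    then obtain x y where "p = (x, y)" "x \<in> \<Lambda>" "y \<in> \<Lambda>" "x \<noteq> y" by blast
    with e(2)[of x y] show "ereal e \<le> (case p of (x, y) \<Rightarrow> ereal (norm (x - y)))"
      by (auto simp: dist_norm not_less[symmetric])
  qed
  moreover have "0 < ereal e" using e(1) by simp
  ultimately show "separated \<Lambda>"
    unfolding separated_def by (rule less_le_trans[rotated])
qed

definition relatively_dense :: "'a::euclidean_space set \<Rightarrow> bool" where
  "relatively_dense \<Lambda> \<longleftrightarrow> (\<exists>r>0. UNIV = (\<Union>l\<in>\<Lambda>. ball l r))"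

definition weakly_converges_to :: "(nat \<Rightarrow> 'a::euclidean_space set) \<Rightarrow> 'a set \<Rightarrow> bool" where
  "weakly_converges_to \<Lambda> \<Gamma> \<longleftrightarrow>
     (\<forall>\<gamma>\<in>\<Gamma>. \<exists>l. (\<forall>n. l n \<in> \<Lambda> n) \<and> l \<longlonglongrightarrow> \<gamma>) \<and>
     (\<forall>s l \<gamma>. strict_mono (s :: nat \<Rightarrow> nat) \<and> (\<forall>k. l k \<in> \<Lambda> (s k)) \<and> l \<longlonglongrightarrow> \<gamma> \<longrightarrow> \<gamma> \<in> \<Gamma>)"

definition weak_limits :: "'a::euclidean_space set \<Rightarrow> 'a set set" where
  "weak_limits \<Lambda> = {\<Gamma>. \<exists>x. weakly_converges_to (\<lambda>n. (\<lambda>l. l - x n) ` \<Lambda>) \<Gamma>}"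

definition almost_repetitive :: "'a::euclidean_space set \<Rightarrow> bool" where
  "almost_repetitive \<Lambda> \<longleftrightarrow>
     separated \<Lambda> \<and> relatively_dense \<Lambda> \<and>
     (\<forall>\<Gamma>\<in>weak_limits \<Lambda>. weak_limits \<Gamma> = weak_limits \<Lambda>)"

text \<open>Counting is done with the counting measure instead of \<^const>\<open>card\<close>, which would
  assign 0 to infinite sets.\<close>

definition lower_Beurling_density :: "'a::euclidean_space set \<Rightarrow> ennreal" where
  "lower_Beurling_density \<Lambda> =
     Liminf at_top (\<lambda>r::real. INF x. emeasure (count_space UNIV) (\<Lambda> \<inter> ball x r) /
                                   emeasure lebesgue (ball (0::'a) r))"

definition upper_Beurling_density :: "'a::euclidean_space set \<Rightarrow> ennreal" where
  "upper_Beurling_density \<Lambda> =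
     Limsup at_top (\<lambda>r::real. SUP x. emeasure (count_space UNIV) (\<Lambda> \<inter> ball x r) /
                                   emeasure lebesgue (ball (0::'a) r))"

text \<open>Elements of \<open>L\<^sup>2(S)\<close> are handled through representatives: total functions of which
  only the values on \<open>S\<close>, up to null sets, matter. Accordingly \<open>L2_nrm\<close> is a seminorm.\<close>

definition L2 :: "'a::euclidean_space set \<Rightarrow> ('a \<Rightarrow> complex) set" where
  "L2 S = {f. f \<in> borel_measurable (lebesgue_on S) \<and>
              integrable (lebesgue_on S) (\<lambda>t. (cmod (f t))\<^sup>2)}"

definition L2_inner :: "'a::euclidean_space set \<Rightarrow> ('a \<Rightarrow> complex) \<Rightarrow> ('a \<Rightarrow> complex) \<Rightarrow> complex" where
  "L2_inner S f g = (LINT t|lebesgue_on S. f t * cnj (g t))"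

definition L2_nrm :: "'a::euclidean_space set \<Rightarrow> ('a \<Rightarrow> complex) \<Rightarrow> real" where
  "L2_nrm S f = sqrt (LINT t|lebesgue_on S. (cmod (f t))\<^sup>2)"

definition expo :: "'a::euclidean_space \<Rightarrow> 'a \<Rightarrow> complex" where
  "expo l t = exp (2 * complex_of_real pi * \<i> * complex_of_real (l \<bullet> t))"

definition exp_frame :: "'a::euclidean_space set \<Rightarrow> 'a set \<Rightarrow> bool" where
  "exp_frame S \<Lambda> \<longleftrightarrow>
     (\<exists>A B. 0 < A \<and> A \<le> B \<and>
       (\<forall>f\<in>L2 S.
          (\<lambda>l. (cmod (L2_inner S f (expo l)))\<^sup>2) summable_on \<Lambda> \<and>
          A * (L2_nrm S f)\<^sup>2 \<le> (\<Sum>\<^sub>\<infinity>l\<in>\<Lambda>. (cmod (L2_inner S f (expo l)))\<^sup>2) \<and>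
          (\<Sum>\<^sub>\<infinity>l\<in>\<Lambda>. (cmod (L2_inner S f (expo l)))\<^sup>2) \<le> B * (L2_nrm S f)\<^sup>2))"

text \<open>\<open>g\<close> represents the sum of \<open>c\<^sub>l e\<^sub>l\<close> over \<open>l \<in> \<Lambda>\<close>, as an unconditionally convergent
  series in \<open>L\<^sup>2(S)\<close>; it is unique up to null sets.\<close>

definition has_L2_exp_sum ::
    "'a::euclidean_space set \<Rightarrow> 'a set \<Rightarrow> ('a \<Rightarrow> complex) \<Rightarrow> ('a \<Rightarrow> complex) \<Rightarrow> bool" where
  "has_L2_exp_sum S \<Lambda> c g \<longleftrightarrow> g \<in> L2 S \<and>
     ((\<lambda>F. L2_nrm S (\<lambda>t. (\<Sum>l\<in>F. c l * expo l t) - g t)) \<longlongrightarrow> 0) (finite_subsets_at_top \<Lambda>)"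

text \<open>A sequence \<open>c \<in> \<ell>\<^sup>2(\<Lambda>)\<close> is a total function whose values outside \<open>\<Lambda>\<close> are irrelevant.\<close>

definition exp_Riesz_sequence :: "'a::euclidean_space set \<Rightarrow> 'a set \<Rightarrow> bool" where
  "exp_Riesz_sequence S \<Lambda> \<longleftrightarrow>
     (\<exists>A B. 0 < A \<and> A \<le> B \<and>
       (\<forall>c. (\<lambda>l. (cmod (c l))\<^sup>2) summable_on \<Lambda> \<longrightarrow>
          (\<exists>g. has_L2_exp_sum S \<Lambda> c g \<and>
             A * (\<Sum>\<^sub>\<infinity>l\<in>\<Lambda>. (cmod (c l))\<^sup>2) \<le> (L2_nrm S g)\<^sup>2 \<and>
             (L2_nrm S g)\<^sup>2 \<le> B * (\<Sum>\<^sub>\<infinity>l\<in>\<Lambda>. (cmod (c l))\<^sup>2))))"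

definition exp_complete :: "'a::euclidean_space set \<Rightarrow> 'a set \<Rightarrow> bool" where
  "exp_complete S \<Lambda> \<longleftrightarrow>
     (\<forall>f\<in>L2 S. \<forall>\<epsilon>>0. \<exists>F c. finite F \<and> F \<subseteq> \<Lambda> \<and>
        L2_nrm S (\<lambda>t. f t - (\<Sum>l\<in>F. c l * expo l t)) < \<epsilon>)"

definition exp_Riesz_basis :: "'a::euclidean_space set \<Rightarrow> 'a set \<Rightarrow> bool" where
  "exp_Riesz_basis S \<Lambda> \<longleftrightarrow> exp_complete S \<Lambda> \<and> exp_Riesz_sequence S \<Lambda>"

end

theory Submission
  imports Defs "HOL-Probability.Probability" "HOL-Complex_Analysis.Great_Picard"
begin

text \<open>
  Frames. For a frame \<open>E(\<Lambda>)\<close> with canonical dual \<open>(h\<^sub>l)\<close> the numbers \<open>\<langle>e\<^sub>l, h\<^sub>l\<rangle>\<close> lie in \<open>[0, 1]\<close>, and a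
  trace computation on a large ball shows that their sum there is at least about \<open>\<bar>S\<bar>\<close> times the
  volume. If the frequencies with \<open>\<langle>e\<^sub>l, h\<^sub>l\<rangle> \<le> 1 - \<epsilon>\<close> were relatively dense, the lower density would
  exceed \<open>\<bar>S\<bar>\<close>; so arbitrarily large balls contain only frequencies which admit an almost
  biorthogonal function. By almost repetitivity every finite part of \<open>\<Lambda>\<close> reappears, up to a small
  perturbation and a translation, in such a ball, and there the exponentials satisfy a lower Riesz
  inequality with a constant depending on the frame bound only.

  Riesz sequences. Dually, the set of \<open>y\<close> for which \<open>e\<^sub>y f\<close> is far from the span of \<open>E(\<Lambda>)\<close> cannot be
  relatively dense, since otherwise the upper density would be less than \<open>\<bar>S\<bar>\<close>. At a translate \<open>x\<close>
  outside of this set for which \<open>\<Lambda> - x\<close> is close to \<open>\<Lambda>\<close> on a large ball, the lower Riesz bound turns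
  into the lower frame inequality for \<open>f\<close>.

  Both trace computations are made in finite dimensional spaces of exponential sums, with a basis that
  is orthonormal for the form at hand; the contribution of remote frequencies is controlled by
  Plancherel's theorem and the separation of \<open>\<Lambda>\<close>.
\<close>


section \<open>Characters and the Gaussian\<close>

text \<open>The canonical dual and the projections never appear as objects. For a frame, <e_l, h_l>
  is the supremum over f of |<f, e_l>|^2 divided by the sum of all |<f, e_m>|^2; so
  \<open>Bad\<close> is defined by an inequality between coefficients of arbitrary f, and a
  frequency outside of it comes with an explicit f. Likewise the distance of e_y f from the span is
  tested against finite sums. The obstacle in the frame count is that S may be unbounded, so that no
  lattice makes exponentials orthogonal on a set containing S. A lattice is chosen whose
  exponentials are orthogonal on a large cube, and the energy on D = cube - S is added to the frame
  energy, which makes the form coercive on lattice sums. The lattice has |cube| points per unit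
  volume, at most |D| of them can be charged to D, and the remaining |cube| - |D|, nearly |S|, must
  be paid for by \<Lambda>. All lower bounds obtained depend on the frame or Riesz bound alone and
  not on the finite set tested; this is what makes finite configurations and their approximate
  copies sufficient.\<close>

lemma expo_eq_cis: "expo l t = cis (2 * pi * (l \<bullet> t))"
  by (simp add: expo_def cis_conv_exp algebra_simps)

lemma norm_expo [simp]: "cmod (expo l t) = 1"
  by (simp add: expo_eq_cis)

lemma expo_0 [simp]: "expo 0 t = 1" "expo l 0 = 1"
  by (simp_all add: expo_def)

lemma expo_commute: "expo l t = expo t l"
  by (simp add: expo_def inner_commute)

lemma expo_add_left: "expo (l + m) t = expo l t * expo m t"
  by (simp add: expo_eq_cis cis_mult inner_add_left algebra_simps)

lemma expo_add_right: "expo l (s + t) = expo l s * expo l t"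
  using expo_add_left[of s t l] by (simp add: expo_commute)

lemma expo_minus_left: "expo (- l) t = cnj (expo l t)"
  by (simp add: expo_eq_cis cis_cnj)

lemma expo_diff_left: "expo (l - m) t = expo l t * cnj (expo m t)"
  using expo_add_left[of l "- m" t] by (simp add: expo_minus_left)

lemma expo_mult_cnj [simp]: "expo l t * cnj (expo l t) = 1" "cnj (expo l t) * expo l t = 1"
  using complex_norm_square[of "expo l t"] by (simp_all add: mult.commute)

lemma borel_measurable_expo [measurable]:
  assumes [measurable]: "f \<in> borel_measurable M" "g \<in> borel_measurable M"
  shows "(\<lambda>x. expo (f x) (g x)) \<in> borel_measurable M"
  unfolding expo_def by measurable

lemma tendsto_expo_left:
  assumes "(f \<longlongrightarrow> l) F"
  shows "((\<lambda>n. expo (f n) t) \<longlongrightarrow> expo l t) F"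
  unfolding expo_def by (intro tendsto_intros assms)

lemma expo_eq_prod: "expo u y = (\<Prod>b\<in>Basis. cis (2 * pi * (u \<bullet> b) * (y \<bullet> b)))"
proof -
  have "cis (\<Sum>b\<in>A. h b) = (\<Prod>b\<in>A. cis (h b))" if "finite A" for A and h :: "'a \<Rightarrow> real"
    using that by (induction A) (simp_all add: cis_mult[symmetric])
  then have "cis (2 * pi * (u \<bullet> y)) = (\<Prod>b\<in>Basis. cis (2 * pi * (u \<bullet> b) * (y \<bullet> b)))"
    by (simp add: euclidean_inner[of u y] sum_distrib_left mult.assoc)
  then show ?thesis by (simp add: expo_eq_cis)
qed

text \<open>The measure \<open>lborel\<close> is the image of a product of real lines under the
  coordinates, so Fubini applies to functions that split over them. This reduces the Gaussian and
  the cube to dimension one.\<close>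

lemma
  fixes h :: "'a::euclidean_space \<Rightarrow> real \<Rightarrow> 'b::{real_normed_field,banach,second_countable_topology}"
  assumes h: "\<And>b. b \<in> Basis \<Longrightarrow> integrable lborel (h b)"
  shows lborel_integrable_prod_Basis: "integrable lborel (\<lambda>y::'a. \<Prod>b\<in>Basis. h b (y \<bullet> b))"
    and lborel_integral_prod_Basis:
      "(LINT y|lborel. (\<Prod>b\<in>Basis. h b (y \<bullet> b))) = (\<Prod>b\<in>Basis. LINT x|lborel. h b x)"
proof -
  interpret product_sigma_finite "\<lambda>_::'a. lborel :: real measure" ..
  let ?P = "Pi\<^sub>M (Basis::'a set) (\<lambda>_. lborel :: real measure)"
  let ?e = "\<lambda>f::'a \<Rightarrow> real. \<Sum>b\<in>Basis. f b *\<^sub>R b"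
  have eq: "lborel = distr ?P borel ?e"
    unfolding lborel_eq_real by (rule lborel_def)
  have e [measurable]: "?e \<in> measurable ?P borel"
    by measurable
  have hm [measurable]: "h b \<in> borel_measurable borel" if "b \<in> Basis" for b
    using h[OF that] by (simp add: integrable_iff_bounded)
  have m: "(\<lambda>y::'a. \<Prod>b\<in>Basis. h b (y \<bullet> b)) \<in> borel_measurable borel"
    by measurable
  have coord: "(\<Prod>b\<in>Basis. h b (?e f \<bullet> b)) = (\<Prod>b\<in>Basis. h b (f b))" for f
    by (intro prod.cong) (auto simp: inner_sum_left_Basis)
  show "integrable lborel (\<lambda>y::'a. \<Prod>b\<in>Basis. h b (y \<bullet> b))"
    unfolding eq by (subst integrable_distr_eq[OF e m], unfold coord, rule product_integrable_prod)
      (auto intro: h)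
  show "(LINT y|lborel. (\<Prod>b\<in>Basis. h b (y \<bullet> b))) = (\<Prod>b\<in>Basis. LINT x|lborel. h b x)"
    unfolding eq by (subst integral_distr[OF e m], unfold coord, rule product_integral_prod)
      (auto intro: h)
qed

lemma exp_norm_square_eq_prod:
  "exp (- c * (norm (y::'a::euclidean_space))\<^sup>2) = (\<Prod>b\<in>Basis. exp (- c * (y \<bullet> b)\<^sup>2))"
proof -
  have "(norm y)\<^sup>2 = (\<Sum>b\<in>Basis. (y \<bullet> b)\<^sup>2)"
    by (subst power2_norm_eq_inner, subst euclidean_inner) (simp add: power2_eq_square)
  then show ?thesis by (simp add: sum_distrib_left exp_sum)
qed

definition gauss :: "'a::euclidean_space \<Rightarrow> real" where
  "gauss y = exp (- (1/2) * (norm y)\<^sup>2)"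

text \<open>The transform of \<open>gauss\<close>, which is at the same time a product of centred
  normal densities with standard deviation \<open>1 / (2 * pi)\<close>. Being a probability density,
  it is an approximate identity once rescaled.\<close>

definition gauss_ft :: "'a::euclidean_space \<Rightarrow> real" where
  "gauss_ft u = sqrt (2 * pi) ^ DIM('a) * exp (- (2 * pi\<^sup>2) * (norm u)\<^sup>2)"

lemma gauss_pos: "gauss y > 0"
  by (simp add: gauss_def)

lemma gauss_ft_pos: "gauss_ft u > 0"
  by (simp add: gauss_ft_def)

lemma borel_measurable_gauss [measurable]: "gauss \<in> borel_measurable borel"
  "gauss_ft \<in> borel_measurable borel"
  unfolding gauss_def[abs_def] gauss_ft_def[abs_def] by measurable

lemma
  shows integrable_gauss: "integrable lborel (gauss :: 'a::euclidean_space \<Rightarrow> real)"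
    and gauss_fourier: "(LINT y|lborel. complex_of_real (gauss y) * expo u (y::'a)) = of_real (gauss_ft u)"
proof -
  have dens: "exp (- (1/2) * x\<^sup>2) = sqrt (2 * pi) * std_normal_density x" for x :: real
    by (simp add: std_normal_density_def)
  have int1: "integrable lborel (\<lambda>x::real. exp (- (1/2) * x\<^sup>2))"
    unfolding dens by (intro integrable_mult_right integrable_normal_density) simp
  have "integrable lborel (\<lambda>y::'a. \<Prod>b\<in>Basis. exp (- (1/2) * (y \<bullet> b)\<^sup>2))"
    by (rule lborel_integrable_prod_Basis) (rule int1)
  then show "integrable lborel (gauss :: 'a \<Rightarrow> real)"
    unfolding gauss_def[abs_def] exp_norm_square_eq_prod .
  let ?h = "\<lambda>b x. complex_of_real (exp (- (1/2) * x\<^sup>2)) * cis (2 * pi * (u \<bullet> b) * x)"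
  have inth: "integrable lborel (?h b)" for b
  proof (rule Bochner_Integration.integrable_bound[OF int1])
    show "?h b \<in> borel_measurable lborel"
      unfolding cis_conv_exp by measurable
  qed (simp add: norm_mult)
  have val: "(LINT x|lborel. ?h b x) = of_real (sqrt (2 * pi) * exp (- (2 * pi\<^sup>2) * (u \<bullet> b)\<^sup>2))" for b
  proof -
    have "(LINT x|lborel. ?h b x) =
      (LINT x|lborel. complex_of_real (sqrt (2 * pi)) * (std_normal_density x *\<^sub>R iexp (2 * pi * (u \<bullet> b) * x)))"
      by (rule Bochner_Integration.integral_cong) (simp_all only: dens cis_conv_exp scaleR_conv_of_real of_real_mult, simp)
    also have "\<dots> = of_real (sqrt (2 * pi)) * (LINT x|lborel. std_normal_density x *\<^sub>R iexp (2 * pi * (u \<bullet> b) * x))"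
      by (rule Bochner_Integration.integral_mult_right_zero)
    \<comment> \<open>The coordinate integral is the characteristic function of the standard normal
      distribution, whose closed form is known.\<close>
    also have "(LINT x|lborel. std_normal_density x *\<^sub>R iexp (2 * pi * (u \<bullet> b) * x))
      = char std_normal_distribution (2 * pi * (u \<bullet> b))"
      unfolding char_def by (subst integral_density) (auto simp: std_normal_density_def)
    also have "\<dots> = of_real (exp (- (2 * pi\<^sup>2) * (u \<bullet> b)\<^sup>2))"
      unfolding char_std_normal_distribution by (simp add: power_mult_distrib power2_eq_square algebra_simps)
    finally show ?thesis by simp
  qed
  have "(LINT y|lborel. complex_of_real (gauss y) * expo u (y::'a)) = (LINT y|lborel. (\<Prod>b\<in>Basis. ?h b (y \<bullet> b)))"
    unfolding gauss_def exp_norm_square_eq_prod expo_eq_prod prod.distrib of_real_prod ..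
  also have "\<dots> = (\<Prod>b\<in>Basis. LINT x|lborel. ?h b x)"
    by (rule lborel_integral_prod_Basis) (rule inth)
  also have "\<dots> = of_real (\<Prod>b\<in>Basis. sqrt (2 * pi) * exp (- (2 * pi\<^sup>2) * (u \<bullet> b)\<^sup>2))"
    unfolding val by simp
  also have "(\<Prod>b\<in>Basis. sqrt (2 * pi) * exp (- (2 * pi\<^sup>2) * (u \<bullet> b)\<^sup>2)) = gauss_ft u"
    unfolding gauss_ft_def exp_norm_square_eq_prod by (simp add: prod.distrib)
  finally show "(LINT y|lborel. complex_of_real (gauss y) * expo u (y::'a)) = of_real (gauss_ft u)" .
qed

lemma
  shows integrable_gauss_ft: "integrable lborel (gauss_ft :: 'a::euclidean_space \<Rightarrow> real)"
    and integral_gauss_ft: "(LINT u|lborel. gauss_ft (u::'a)) = 1"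
proof -
  have eq: "gauss_ft u = (\<Prod>b\<in>Basis. normal_density 0 (1 / (2 * pi)) (u \<bullet> b))" for u :: 'a
  proof -
    have "normal_density 0 (1 / (2 * pi)) x = sqrt (2 * pi) * exp (- (2 * pi\<^sup>2) * x\<^sup>2)" for x
      by (simp add: normal_density_def power2_eq_square real_sqrt_divide field_simps real_sqrt_mult)
    then show ?thesis
      unfolding gauss_ft_def exp_norm_square_eq_prod by (simp add: prod.distrib)
  qed
  show "integrable lborel (gauss_ft :: 'a \<Rightarrow> real)"
    unfolding eq[abs_def] by (rule lborel_integrable_prod_Basis) (simp add: integrable_normal_density)
  show "(LINT u|lborel. gauss_ft (u::'a)) = 1"
    unfolding eq by (subst lborel_integral_prod_Basis) (simp_all add: integral_normal_density integrable_normal_density)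
qed


section \<open>Continuity of translation in the mean\<close>

lemma
  fixes f :: "'a::euclidean_space \<Rightarrow> 'b::{banach,second_countable_topology}"
  shows lborel_integrable_translation: "integrable lborel f \<Longrightarrow> integrable lborel (\<lambda>t. f (t + x))"
    and lborel_integral_translation:
      "f \<in> borel_measurable borel \<Longrightarrow> (LINT t|lborel. f (t + x)) = (LINT t|lborel. f t)"
proof -
  have m: "(+) x \<in> measurable lborel borel" by simp
  have *: "(\<lambda>t. f (t + x)) = (\<lambda>t. f (x + t))" by (simp add: add.commute)
  show "integrable lborel (\<lambda>t. f (t + x))" if "integrable lborel f"
    unfolding * using integrable_distr[OF m, of f] that by (simp add: lborel_distr_plus)
  show "(LINT t|lborel. f (t + x)) = (LINT t|lborel. f t)" if "f \<in> borel_measurable borel"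
    unfolding * using integral_distr[OF m, of f] that by (simp add: lborel_distr_plus)
qed

text \<open>Stated with sequences, so that dominated convergence applies directly.\<close>

definition mean_continuous :: "('a::euclidean_space \<Rightarrow> 'b::{banach,second_countable_topology}) \<Rightarrow> bool" where
  "mean_continuous f \<longleftrightarrow>
     (\<forall>x. x \<longlonglongrightarrow> 0 \<longrightarrow> (\<lambda>n. LINT t|lborel. norm (f (t + x n) - f t)) \<longlonglongrightarrow> 0)"

lemma integral_norm_triangle:
  fixes f g h :: "'a \<Rightarrow> 'b::{banach,second_countable_topology}"
  assumes "integrable M f" "integrable M g" "integrable M h"
  shows "(LINT t|M. norm (f t - h t)) \<le> (LINT t|M. norm (f t - g t)) + (LINT t|M. norm (g t - h t))"
proof -
  have "(LINT t|M. norm (f t - h t)) \<le> (LINT t|M. norm (f t - g t) + norm (g t - h t))"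
    using assms norm_triangle_ineq[of "f t - g t" "g t - h t" for t]
    by (intro integral_mono integrable_norm Bochner_Integration.integrable_add
        Bochner_Integration.integrable_diff) auto
  also have "\<dots> = (LINT t|M. norm (f t - g t)) + (LINT t|M. norm (g t - h t))"
    using assms by (intro Bochner_Integration.integral_add) auto
  finally show ?thesis .
qed

text \<open>A three term estimate: translation preserves the integral norm, so the errors of
  replacing \<open>f\<close> by \<open>g\<close> before and after the shift are equal.\<close>

lemma mean_continuous_approx:
  fixes f :: "'a::euclidean_space \<Rightarrow> 'b::{banach,second_countable_topology}"
  assumes f: "integrable lborel f"
    and approx: "\<And>e. e > 0 \<Longrightarrow>
      \<exists>g. integrable lborel g \<and> mean_continuous g \<and> (LINT t|lborel. norm (f t - g t)) < e"
  shows "mean_continuous f"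
  unfolding mean_continuous_def
proof (intro allI impI LIMSEQ_I)
  fix x :: "nat \<Rightarrow> 'a" and e :: real
  assume x: "x \<longlonglongrightarrow> 0" and "e > 0"
  then obtain g where g: "integrable lborel g" "mean_continuous g"
    and fg: "(LINT t|lborel. norm (f t - g t)) < e / 4"
    using approx[of "e / 4"] by auto
  have "(\<lambda>n. LINT t|lborel. norm (g (t + x n) - g t)) \<longlonglongrightarrow> 0"
    using g(2) x by (auto simp: mean_continuous_def)
  then have "eventually (\<lambda>n. (LINT t|lborel. norm (g (t + x n) - g t)) < e / 4) sequentially"
    using \<open>e > 0\<close> by (intro order_tendstoD) auto
  then obtain N where N: "\<And>n. n \<ge> N \<Longrightarrow> (LINT t|lborel. norm (g (t + x n) - g t)) < e / 4"
    by (auto simp: eventually_sequentially)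
  have "norm ((LINT t|lborel. norm (f (t + x n) - f t)) - 0) < e" if "n \<ge> N" for n
  proof -
    note tr = lborel_integrable_translation[OF f, of "x n"] lborel_integrable_translation[OF g(1), of "x n"]
    have meas: "f \<in> borel_measurable borel" "g \<in> borel_measurable borel" using f g(1) by auto
    have "(LINT t|lborel. norm (f (t + x n) - f t))
      \<le> (LINT t|lborel. norm (f (t + x n) - g (t + x n))) + (LINT t|lborel. norm (g (t + x n) - f t))"
      by (rule integral_norm_triangle[OF tr f])
    also have "(LINT t|lborel. norm (g (t + x n) - f t))
      \<le> (LINT t|lborel. norm (g (t + x n) - g t)) + (LINT t|lborel. norm (g t - f t))"
      by (rule integral_norm_triangle[OF tr(2) g(1) f])
    also have "(LINT t|lborel. norm (f (t + x n) - g (t + x n))) = (LINT t|lborel. norm (f t - g t))"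
      using meas by (intro lborel_integral_translation[where f = "\<lambda>t. norm (f t - g t)"]) measurable
    also have "(LINT t|lborel. norm (g t - f t)) = (LINT t|lborel. norm (f t - g t))"
      by (simp add: norm_minus_commute)
    finally show ?thesis using fg N[OF that] \<open>e > 0\<close>
      by (simp add: integral_nonneg_AE)
  qed
  then show "\<exists>N. \<forall>n\<ge>N. norm ((LINT t|lborel. norm (f (t + x n) - f t)) - 0) < e" by blast
qed

text \<open>A point of an open set stays in it under small shifts, so by dominated convergence the
  part of \<open>U\<close> that is shifted out of \<open>U\<close> has small measure.\<close>

lemma mean_continuous_indicator_open:
  fixes U :: "'a::euclidean_space set"
  assumes U: "open U" "emeasure lborel U < \<infinity>"
  shows "mean_continuous (\<lambda>t. indicator U t :: real)"
  unfolding mean_continuous_def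
proof (intro allI impI)
  fix x :: "nat \<Rightarrow> 'a"
  assume x: "x \<longlonglongrightarrow> 0"
  have [measurable]: "U \<in> sets borel" using U by auto
  have iU: "integrable lborel (\<lambda>t. indicator U t :: real)" using U by (simp add: integrable_indicator_iff)
  let ?h = "\<lambda>n t. indicator U t * (1 - indicator U (t + x n)) :: real"
  have ih: "integrable lborel (?h n)" for n
    by (rule Bochner_Integration.integrable_bound[OF iU]) (auto simp: indicator_def)
  have "(\<lambda>n. LINT t|lborel. ?h n t) \<longlonglongrightarrow> (LINT t|lborel. (0::real) + 0 * indicator U (t::'a))"
  proof (rule integral_dominated_convergence[where w = "\<lambda>t. indicator U t"])
    show "AE t in lborel. (\<lambda>n. ?h n t) \<longlonglongrightarrow> 0 + 0 * indicator U t"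
    proof (rule AE_I2)
      fix t :: 'a
      show "(\<lambda>n. ?h n t) \<longlonglongrightarrow> 0 + 0 * indicator U t"
      proof (cases "t \<in> U")
        case True
        have "(\<lambda>n. t + x n) \<longlonglongrightarrow> t + 0" by (intro tendsto_intros x)
        then have "eventually (\<lambda>n. t + x n \<in> U) sequentially"
          using True U(1) by (simp add: topological_tendstoD)
        then have "eventually (\<lambda>n. ?h n t = 0) sequentially"
          by eventually_elim simp
        then show ?thesis by (simp add: tendsto_eventually)
      qed simp
    qed
  qed (use iU in \<open>auto simp: indicator_def\<close>)
  then have lim: "(\<lambda>n. 2 * (LINT t|lborel. ?h n t)) \<longlonglongrightarrow> 0"
    by (intro tendsto_mult_right_zero) simp
  have "(LINT t|lborel. norm (indicator U (t + x n) - indicator U t :: real)) = 2 * (LINT t|lborel. ?h n t)" for n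
  proof -
    have tr: "integrable lborel (\<lambda>t. indicator U (t + x n) :: real)"
      using lborel_integrable_translation[OF iU] .
    \<comment> \<open>Pointwise the modulus equals the signed difference plus twice the loss; the
      signed difference integrates to zero because translation preserves the measure.\<close>
    have "(LINT t|lborel. norm (indicator U (t + x n) - indicator U t :: real))
      = (LINT t|lborel. (indicator U (t + x n) - indicator U t) + 2 * ?h n t)"
      by (rule Bochner_Integration.integral_cong) (auto simp: indicator_def)
    also have "\<dots> = ((LINT t|lborel. indicator U (t + x n)) - (LINT t|lborel. indicator U t))
       + 2 * (LINT t|lborel. ?h n t)"
      using tr iU ih by simp
    also have "(LINT t|lborel. indicator U (t + x n) :: real) = (LINT t|lborel. indicator U t)"
      by (rule lborel_integral_translation) auto
    finally show ?thesis by simp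
  qed
  then show "(\<lambda>n. LINT t|lborel. norm (indicator U (t + x n) - indicator U t :: real)) \<longlonglongrightarrow> 0"
    using lim by simp
qed

lemma mean_continuous_scaleR_const:
  assumes "mean_continuous (f :: 'a::euclidean_space \<Rightarrow> real)" "integrable lborel f"
  shows "mean_continuous (\<lambda>t. f t *\<^sub>R (c :: 'b::{banach,second_countable_topology}))"
  unfolding mean_continuous_def
proof (intro allI impI)
  fix x :: "nat \<Rightarrow> 'a"
  assume "x \<longlonglongrightarrow> 0"
  then have "(\<lambda>n. (LINT t|lborel. norm (f (t + x n) - f t)) * norm c) \<longlonglongrightarrow> 0"
    using assms(1) by (intro tendsto_mult_left_zero) (auto simp: mean_continuous_def)
  then show "(\<lambda>n. LINT t|lborel. norm (f (t + x n) *\<^sub>R c - f t *\<^sub>R c)) \<longlonglongrightarrow> 0"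
    by (simp add: scaleR_diff_left[symmetric])
qed

lemma mean_continuous_add:
  assumes "integrable lborel f" "integrable lborel g" "mean_continuous f" "mean_continuous g"
  shows "mean_continuous (\<lambda>t. f t + g t)"
  unfolding mean_continuous_def
proof (intro allI impI)
  fix x :: "nat \<Rightarrow> 'a"
  assume x: "x \<longlonglongrightarrow> 0"
  have "(\<lambda>n. (LINT t|lborel. norm (f (t + x n) - f t)) + (LINT t|lborel. norm (g (t + x n) - g t))) \<longlonglongrightarrow> 0 + 0"
    using assms x by (intro tendsto_add) (auto simp: mean_continuous_def)
  then have lim: "(\<lambda>n. (LINT t|lborel. norm (f (t + x n) - f t)) + (LINT t|lborel. norm (g (t + x n) - g t))) \<longlonglongrightarrow> 0"
    by simp
  show "(\<lambda>n. LINT t|lborel. norm (f (t + x n) + g (t + x n) - (f t + g t))) \<longlonglongrightarrow> 0"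
  proof (rule Lim_null_comparison[OF _ lim])
    have "(LINT t|lborel. norm (f (t + x n) + g (t + x n) - (f t + g t)))
       \<le> (LINT t|lborel. norm (f (t + x n) - f t)) + (LINT t|lborel. norm (g (t + x n) - g t))" for n
    proof -
      note i = lborel_integrable_translation[OF assms(1), of "x n"] lborel_integrable_translation[OF assms(2), of "x n"]
      have "(LINT t|lborel. norm (f (t + x n) + g (t + x n) - (f t + g t)))
        \<le> (LINT t|lborel. norm (f (t + x n) - f t) + norm (g (t + x n) - g t))"
        by (rule integral_mono) (use assms i in \<open>auto simp: norm_diff_triangle_ineq\<close>)
      also have "\<dots> = (LINT t|lborel. norm (f (t + x n) - f t)) + (LINT t|lborel. norm (g (t + x n) - g t))"
        by (rule Bochner_Integration.integral_add) (use assms i in auto)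
      finally show ?thesis .
    qed
    then show "eventually (\<lambda>n. norm (LINT t|lborel. norm (f (t + x n) + g (t + x n) - (f t + g t)))
       \<le> (LINT t|lborel. norm (f (t + x n) - f t)) + (LINT t|lborel. norm (g (t + x n) - g t))) sequentially"
      by (simp add: integral_nonneg_AE)
  qed
qed

text \<open>A set of finite measure differs from a suitable open superset by arbitrarily little, and
  the open case passes to limits in the mean.\<close>

lemma mean_continuous_indicator:
  fixes A :: "'a::euclidean_space set"
  assumes A: "A \<in> sets lborel" "emeasure lborel A < \<infinity>"
  shows "mean_continuous (\<lambda>t. indicator A t :: real)"
proof (rule mean_continuous_approx)
  show "integrable lborel (\<lambda>t. indicator A t :: real)" using A by (simp add: integrable_indicator_iff)
  fix e :: real
  assume "e > 0"
  have "A \<in> sets lebesgue" using A by simp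
  then obtain U where U: "open U" "A \<subseteq> U" "emeasure lebesgue (U - A) < ennreal e"
    using sets_lebesgue_outer_open[OF _ \<open>e > 0\<close>] by metis
  have [measurable]: "U \<in> sets borel" "A \<in> sets borel" using U A by auto
  have d: "emeasure lborel (U - A) < ennreal e"
    using U(3) by (simp add: emeasure_completion)
  have "emeasure lborel U \<le> emeasure lborel A + emeasure lborel (U - A)"
    using emeasure_subadditive[of A lborel "U - A"] U(2) A by (simp add: Un_absorb1)
  also have "\<dots> < \<infinity>"
    using A(2) d by (simp add: less_top[symmetric]) (metis ennreal_less_top order.strict_trans less_irrefl)
  finally have fin: "emeasure lborel U < \<infinity>" .
  have "(LINT t|lborel. norm (indicator A t - indicator U t :: real)) = (LINT t|lborel. indicator (U - A) t)"
    using U(2) by (intro Bochner_Integration.integral_cong) (auto simp: indicator_def)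
  also have "\<dots> = measure lborel (U - A)" by simp
  also have "\<dots> < e"
    using d \<open>e > 0\<close> by (simp add: measure_def enn2real_less_iff less_top order.strict_trans)
  finally show "\<exists>g. integrable lborel g \<and> mean_continuous g \<and>
      (LINT t|lborel. norm (indicator A t - g t :: real)) < e"
    using mean_continuous_indicator_open[OF U(1) fin] fin
    by (intro exI[of _ "\<lambda>t. indicator U t"]) (simp add: integrable_indicator_iff)
qed

lemma integrable_imp_mean_continuous:
  fixes f :: "'a::euclidean_space \<Rightarrow> 'b::{banach,second_countable_topology}"
  assumes "integrable lborel f"
  shows "mean_continuous f"
  using assms
proof (induction rule: integrable_induct)
  case (base A c)
  then show ?case
    by (intro mean_continuous_scaleR_const mean_continuous_indicator) (simp_all add: integrable_indicator_iff)
next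
  case (add f g)
  then show ?case by (intro mean_continuous_add)
next
  case (lim f s)
  show ?case
  proof (rule mean_continuous_approx[OF \<open>integrable lborel f\<close>])
    fix e :: real
    assume "e > 0"
    have "(\<lambda>n. LINT t|lborel. norm (f t - s n t)) \<longlonglongrightarrow> (LINT t|lborel. norm (f t - f t))"
    proof (rule integral_dominated_convergence[where w = "\<lambda>t. 3 * norm (f t)"])
      show "AE t in lborel. (\<lambda>n. norm (f t - s n t)) \<longlonglongrightarrow> norm (f t - f t)"
        using lim(2) by (intro AE_I2 tendsto_intros) simp
      show "AE t in lborel. norm (norm (f t - s n t)) \<le> 3 * norm (f t)" for n
      proof (rule AE_I2)
        fix t :: 'a
        show "norm (norm (f t - s n t)) \<le> 3 * norm (f t)"
          using lim(3)[of t n] norm_triangle_ineq4[of "f t" "s n t"] by simp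
      qed
    qed (use lim in auto)
    then have "eventually (\<lambda>n. (LINT t|lborel. norm (f t - s n t)) < e) sequentially"
      using \<open>e > 0\<close> by (intro order_tendstoD) auto
    then show "\<exists>g. integrable lborel g \<and> mean_continuous g \<and> (LINT t|lborel. norm (f t - g t)) < e"
      using lim(1,5) by (force simp: eventually_sequentially)
  qed
qed


section \<open>Plancherel's theorem for bounded integrable functions\<close>

lemma lborel_integral_scale:
  fixes f :: "'a::euclidean_space \<Rightarrow> 'b::{banach,second_countable_topology}"
  assumes c: "c > 0" and f: "f \<in> borel_measurable borel"
  shows "(LINT x|lborel. f x) = c ^ DIM('a) *\<^sub>R (LINT x|lborel. f (c *\<^sub>R x))"
proof -
  have m: "(\<lambda>x::'a. 0 + c *\<^sub>R x) \<in> measurable lborel borel" by simp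
  have eq: "(lborel :: 'a measure) = density (distr lborel borel (\<lambda>x. 0 + c *\<^sub>R x)) (\<lambda>_. ennreal (c ^ DIM('a)))"
    using lborel_affine[of c "0::'a"] c by (simp add: ennreal_power)
  have "(LINT x|lborel. f x) = (LINT x|distr lborel borel (\<lambda>x. 0 + c *\<^sub>R x). c ^ DIM('a) *\<^sub>R f x)"
    by (subst eq, subst integral_density) (use c f in auto)
  also have "\<dots> = (LINT x|lborel. c ^ DIM('a) *\<^sub>R f (0 + c *\<^sub>R x))"
    by (rule integral_distr[OF m]) (use f in measurable)
  finally show ?thesis by simp
qed

lemma borel_measurable_cnj [measurable (raw)]:
  assumes "f \<in> borel_measurable M"
  shows "(\<lambda>x. cnj (f x)) \<in> borel_measurable M"
  using assms by (rule borel_measurable_continuous_on[rotated]) (intro continuous_intros)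

lemma lborel_integrable_scale:
  fixes f :: "'a::euclidean_space \<Rightarrow> real"
  assumes c: "c > 0" and f: "integrable lborel f"
  shows "integrable lborel (\<lambda>x. f (c *\<^sub>R x))"
proof -
  have [measurable]: "f \<in> borel_measurable borel" using f by auto
  have "integrable (density (distr lborel borel (\<lambda>x::'a. 0 + c *\<^sub>R x)) (\<lambda>_. ennreal (c ^ DIM('a)))) f"
    using f lborel_affine[of c "0::'a"] c by (simp add: ennreal_power)
  then have "integrable (distr lborel borel (\<lambda>x::'a. 0 + c *\<^sub>R x)) (\<lambda>x::'a. c ^ DIM('a) *\<^sub>R f x)"
    using c by (subst (asm) integrable_density) auto
  then have "integrable lborel (\<lambda>x::'a. c ^ DIM('a) *\<^sub>R f (0 + c *\<^sub>R x))"
    by (rule integrable_distr[rotated]) simp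
  then show ?thesis using c by simp
qed

text \<open>Its Fourier integral against \<open>expo y\<close> is the squared modulus of the
  transform of \<open>f\<close> at \<open>y\<close>. Its value at 0 is the squared norm of
  \<open>f\<close>, so Plancherel's theorem is Fourier inversion at this one point.\<close>

definition autocorr :: "('a::euclidean_space \<Rightarrow> complex) \<Rightarrow> 'a \<Rightarrow> complex" where
  "autocorr f u = (LINT t|lborel. f t * cnj (f (t + u)))"

lemma cmod_autocorr_le:
  assumes "integrable lborel f" and "\<And>t. cmod (f t) \<le> C"
  shows "cmod (autocorr f u) \<le> C * (LINT t|lborel. cmod (f t))"
proof -
  have C: "C \<ge> 0" using assms(2)[of 0] norm_ge_zero order_trans by blast
  have "cmod (autocorr f u) \<le> (LINT t|lborel. C * cmod (f t))"
    unfolding autocorr_def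
  proof (rule order_trans[OF integral_norm_bound])
    show "(LINT t|lborel. cmod (f t * cnj (f (t + u)))) \<le> (LINT t|lborel. C * cmod (f t))"
    proof (rule integral_mono')
      show "integrable lborel (\<lambda>t. C * cmod (f t))" using assms(1) by auto
      show "cmod (f t * cnj (f (t + u))) \<le> C * cmod (f t)" for t
        using mult_right_mono[OF assms(2)[of "t + u"], of "cmod (f t)"] by (simp add: norm_mult mult.commute)
      show "0 \<le> C * cmod (f t)" for t using C by simp
    qed
  qed
  then show ?thesis by simp
qed

text \<open>Boundedness of \<open>f\<close> turns the difference of two autocorrelations into
  \<open>C\<close> times the integral norm of a translation difference, which is controlled by
  continuity in the mean.\<close>

lemma autocorr_tendsto:
  assumes f: "integrable lborel f" and b: "\<And>t. cmod (f t) \<le> C" and x: "x \<longlonglongrightarrow> 0"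
  shows "(\<lambda>n. autocorr f (x n)) \<longlonglongrightarrow> autocorr f 0"
proof -
  have C: "C \<ge> 0" using b[of 0] norm_ge_zero order_trans by blast
  have [measurable]: "f \<in> borel_measurable borel" using f by auto
  have "mean_continuous f" using f by (rule integrable_imp_mean_continuous)
  then have "(\<lambda>n. C * (LINT t|lborel. cmod (f (t + x n) - f t))) \<longlonglongrightarrow> 0"
    using x unfolding mean_continuous_def by (intro tendsto_mult_right_zero) auto
  then have "(\<lambda>n. autocorr f (x n) - autocorr f 0) \<longlonglongrightarrow> 0"
  proof (rule Lim_null_comparison[rotated])
    have "norm (autocorr f (x n) - autocorr f 0) \<le> C * (LINT t|lborel. cmod (f (t + x n) - f t))" for n
    proof -
      have i: "integrable lborel (\<lambda>t. f t * cnj (f (t + y)))" for y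
      proof (rule Bochner_Integration.integrable_bound)
        show "integrable lborel (\<lambda>t. C * cmod (f t))" using f by auto
        show "AE t in lborel. cmod (f t * cnj (f (t + y))) \<le> norm (C * cmod (f t))"
          using mult_right_mono[OF b, of "cmod (f t)" for t] C by (intro AE_I2) (simp add: norm_mult mult.commute)
      qed measurable
      have d: "integrable lborel (\<lambda>t. cmod (f (t + x n) - f t))"
        using lborel_integrable_translation[OF f, of "x n"] f by auto
      have "autocorr f (x n) - autocorr f 0 = (LINT t|lborel. f t * cnj (f (t + x n)) - f t * cnj (f (t + 0)))"
        unfolding autocorr_def by (rule Bochner_Integration.integral_diff[symmetric]) (rule i)+
      also have "norm \<dots> \<le> (LINT t|lborel. norm (f t * cnj (f (t + x n)) - f t * cnj (f (t + 0))))"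
        by (rule integral_norm_bound)
      also have "\<dots> \<le> (LINT t|lborel. C * cmod (f (t + x n) - f t))"
      proof (rule integral_mono')
        show "integrable lborel (\<lambda>t. C * cmod (f (t + x n) - f t))" using d by auto
        show "0 \<le> C * cmod (f (t + x n) - f t)" for t using C by simp
        show "norm (f t * cnj (f (t + x n)) - f t * cnj (f (t + 0))) \<le> C * cmod (f (t + x n) - f t)" for t
        proof -
          have "f t * cnj (f (t + x n)) - f t * cnj (f (t + 0)) = f t * cnj (f (t + x n) - f t)"
            by (simp add: algebra_simps)
          then show ?thesis using mult_right_mono[OF b[of t]] by (simp add: norm_mult del: complex_cnj_diff)
        qed
      qed
      finally show ?thesis by simp
    qed
    then show "eventually (\<lambda>n. norm (autocorr f (x n) - autocorr f 0) \<le>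
      C * (LINT t|lborel. cmod (f (t + x n) - f t))) sequentially" by simp
  qed
  then show ?thesis by (simp add: LIM_zero_iff)
qed

context
  fixes f :: "'a::euclidean_space \<Rightarrow> complex"
  assumes f: "integrable lborel f"
begin

private lemma fm [measurable]: "f \<in> borel_measurable borel" using f by auto

lemma integrable_autocorr_pair:
  "integrable (lborel \<Otimes>\<^sub>M lborel) (\<lambda>(t, u). f t * cnj (f (t + u)))"
proof (rule lborel_pair.Fubini_integrable)
  have tr: "integrable lborel (\<lambda>u. f (t + u))" for t
    using lborel_integrable_translation[OF f, of t] by (simp add: add.commute)
  show "AE t in lborel. integrable lborel (\<lambda>u. case (t, u) of (t, u) \<Rightarrow> f t * cnj (f (t + u)))"
    using tr by (intro AE_I2) simp
  have "(LINT u|lborel. norm (case (t, u) of (t, u) \<Rightarrow> f t * cnj (f (t + u)))) = cmod (f t) * (LINT u|lborel. cmod (f u))" for t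
  proof -
    have "(LINT u|lborel. norm (case (t, u) of (t, u) \<Rightarrow> f t * cnj (f (t + u)))) = cmod (f t) * (LINT u|lborel. cmod (f (u + t)))"
      by (simp add: norm_mult add.commute)
    also have "(LINT u|lborel. cmod (f (u + t))) = (LINT u|lborel. cmod (f u))"
      by (rule lborel_integral_translation[where f = "\<lambda>u. cmod (f u)"]) measurable
    finally show ?thesis .
  qed
  then show "integrable lborel (\<lambda>t. LINT u|lborel. norm (case (t, u) of (t, u) \<Rightarrow> f t * cnj (f (t + u))))"
    using f by simp
qed measurable

lemma integrable_autocorr: "integrable lborel (autocorr f)"
  using lborel_pair.integrable_snd[OF integrable_autocorr_pair] by (simp add: autocorr_def[abs_def])

lemma norm_square_fourier_eq_autocorr:
  "complex_of_real ((cmod (LINT t|lborel. f t * cnj (expo y t)))\<^sup>2) = (LINT u|lborel. autocorr f u * expo y u)"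
proof -
  let ?F = "LINT t|lborel. f t * cnj (expo y t)"
  have "complex_of_real ((cmod ?F)\<^sup>2) = ?F * cnj ?F" by (rule complex_norm_square)
  also have "cnj ?F = (LINT s|lborel. cnj (f s) * expo y s)"
    by (simp add: Bochner_Integration.integral_cnj[symmetric] del: Bochner_Integration.integral_cnj)
  also have "?F * \<dots> = (LINT t|lborel. f t * cnj (expo y t) * (LINT s|lborel. cnj (f s) * expo y s))"
    by (rule Bochner_Integration.integral_mult_left_zero[symmetric])
  also have "\<dots> = (LINT t|lborel. (LINT u|lborel. f t * cnj (f (t + u)) * expo y u))"
  proof (rule Bochner_Integration.integral_cong[OF refl])
    fix t :: 'a
    \<comment> \<open>The substitution s = u + t turns the product of two integrals into a double
      integral over t and the lag u.\<close>
    have "(LINT s|lborel. cnj (f s) * expo y s) = (LINT u|lborel. cnj (f (u + t)) * expo y (u + t))"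
      by (rule lborel_integral_translation[where f = "\<lambda>s. cnj (f s) * expo y s", symmetric]) measurable
    also have "\<dots> = expo y t * (LINT u|lborel. cnj (f (t + u)) * expo y u)"
      by (subst Bochner_Integration.integral_mult_right_zero[symmetric])
        (simp add: expo_add_right algebra_simps)
    finally have "f t * cnj (expo y t) * (LINT s|lborel. cnj (f s) * expo y s)
       = f t * (cnj (expo y t) * expo y t) * (LINT u|lborel. cnj (f (t + u)) * expo y u)"
      by (simp only: mult.assoc)
    then show "f t * cnj (expo y t) * (LINT s|lborel. cnj (f s) * expo y s) = (LINT u|lborel. f t * cnj (f (t + u)) * expo y u)"
      by (simp add: mult.assoc)
  qed
  also have "\<dots> = (LINT u|lborel. (LINT t|lborel. f t * cnj (f (t + u)) * expo y u))"
  proof (rule lborel_pair.Fubini_integral[symmetric])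
    show "integrable (lborel \<Otimes>\<^sub>M lborel) (\<lambda>(t, u). f t * cnj (f (t + u)) * expo y u)"
      using integrable_autocorr_pair
      by (rule Bochner_Integration.integrable_bound) (auto simp: norm_mult)
  qed
  also have "\<dots> = (LINT u|lborel. autocorr f u * expo y u)"
    by (simp add: autocorr_def)
  finally show ?thesis .
qed

text \<open>The squared transform is not yet known to be integrable. The Gaussian weight makes
  Fubini available and, integrated first, becomes a Gaussian in the lag; rescaling leaves an average
  of the autocorrelation near 0.\<close>

lemma gauss_weighted_fourier:
  assumes "\<delta> > 0"
  shows "complex_of_real (LINT y|lborel. gauss (\<delta> *\<^sub>R y) * (cmod (LINT t|lborel. f t * cnj (expo y t)))\<^sup>2)
    = (LINT v|lborel. gauss_ft v * autocorr f (\<delta> *\<^sub>R v))"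
proof -
  have \<phi>: "integrable lborel (autocorr f)" by (rule integrable_autocorr)
  then have [measurable]: "autocorr f \<in> borel_measurable borel" by auto
  have g: "integrable lborel (\<lambda>y::'a. gauss (\<delta> *\<^sub>R y))"
    using assms integrable_gauss by (rule lborel_integrable_scale)
  have gint: "(LINT y|lborel. complex_of_real (gauss (\<delta> *\<^sub>R y)) * expo y u)
    = of_real ((1 / \<delta>) ^ DIM('a) * gauss_ft ((1 / \<delta>) *\<^sub>R u))" for u :: 'a
  proof -
    have "(LINT y|lborel. complex_of_real (gauss (\<delta> *\<^sub>R y)) * expo y u)
      = (1 / \<delta>) ^ DIM('a) *\<^sub>R (LINT y|lborel. complex_of_real (gauss (\<delta> *\<^sub>R ((1 / \<delta>) *\<^sub>R y))) * expo ((1 / \<delta>) *\<^sub>R y) u)"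
      by (rule lborel_integral_scale) (use assms in \<open>simp, measurable\<close>)
    also have "(LINT y|lborel. complex_of_real (gauss (\<delta> *\<^sub>R ((1 / \<delta>) *\<^sub>R y))) * expo ((1 / \<delta>) *\<^sub>R y) u)
      = (LINT y|lborel. complex_of_real (gauss y) * expo ((1 / \<delta>) *\<^sub>R u) y)"
      using assms by (intro Bochner_Integration.integral_cong refl) (simp add: expo_def inner_commute)
    finally show ?thesis by (simp add: gauss_fourier scaleR_conv_of_real)
  qed
  have "complex_of_real (LINT y|lborel. gauss (\<delta> *\<^sub>R y) * (cmod (LINT t|lborel. f t * cnj (expo y t)))\<^sup>2)
     = (LINT y|lborel. complex_of_real (gauss (\<delta> *\<^sub>R y) * (cmod (LINT t|lborel. f t * cnj (expo y t)))\<^sup>2))"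
    by (rule integral_complex_of_real[symmetric])
  also have "\<dots> = (LINT y|lborel. (LINT u|lborel. gauss (\<delta> *\<^sub>R y) * (autocorr f u * expo y u)))"
    by (simp add: norm_square_fourier_eq_autocorr del: of_real_power)
  also have "\<dots> = (LINT u|lborel. (LINT y|lborel. gauss (\<delta> *\<^sub>R y) * (autocorr f u * expo y u)))"
  proof (rule lborel_pair.Fubini_integral[symmetric])
    have "integrable (lborel \<Otimes>\<^sub>M lborel) (\<lambda>(y::'a, u::'a). complex_of_real (gauss (\<delta> *\<^sub>R y)) * autocorr f u)"
    proof (rule lborel_pair.Fubini_integrable)
      show "integrable lborel (\<lambda>y::'a. LINT u|lborel. norm (case (y, u) of (y, u) \<Rightarrow> complex_of_real (gauss (\<delta> *\<^sub>R y)) * autocorr f u))"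
        using g by (simp add: norm_mult gauss_pos less_imp_le)
    qed (use \<phi> in auto)
    then show "integrable (lborel \<Otimes>\<^sub>M lborel) (\<lambda>(y::'a, u::'a). complex_of_real (gauss (\<delta> *\<^sub>R y)) * (autocorr f u * expo y u))"
      by (rule Bochner_Integration.integrable_bound) (auto simp: norm_mult)
  qed
  also have "\<dots> = (LINT u|lborel. autocorr f u * (LINT y|lborel. complex_of_real (gauss (\<delta> *\<^sub>R y)) * expo y u))"
    by (subst Bochner_Integration.integral_mult_right_zero[symmetric]) (simp add: algebra_simps)
  also have "\<dots> = (LINT u|lborel. autocorr f u * of_real ((1 / \<delta>) ^ DIM('a) * gauss_ft ((1 / \<delta>) *\<^sub>R u)))"
    unfolding gint ..
  also have "\<dots> = \<delta> ^ DIM('a) *\<^sub>R (LINT v|lborel. autocorr f (\<delta> *\<^sub>R v) *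
       of_real ((1 / \<delta>) ^ DIM('a) * gauss_ft ((1 / \<delta>) *\<^sub>R (\<delta> *\<^sub>R v))))"
    by (rule lborel_integral_scale) (use assms in \<open>simp, measurable\<close>)
  also have "\<dots> = (LINT v|lborel. \<delta> ^ DIM('a) *\<^sub>R (autocorr f (\<delta> *\<^sub>R v) *
       of_real ((1 / \<delta>) ^ DIM('a) * gauss_ft ((1 / \<delta>) *\<^sub>R (\<delta> *\<^sub>R v)))))"
    by (rule integral_scaleR_right[symmetric])
  also have "\<dots> = (LINT v|lborel. gauss_ft v * autocorr f (\<delta> *\<^sub>R v))"
    using assms by (intro Bochner_Integration.integral_cong refl)
      (simp add: scaleR_conv_of_real power_divide)
  finally show ?thesis .
qed

end

lemma borel_measurable_fourier:
  assumes [measurable]: "f \<in> borel_measurable borel"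
  shows "(\<lambda>y::'a::euclidean_space. LINT t|lborel. f t * cnj (expo y t)) \<in> borel_measurable borel"
proof -
  have "(\<lambda>(y, t). f t * cnj (expo y t)) \<in> borel_measurable (borel \<Otimes>\<^sub>M lborel)" by measurable
  then show ?thesis using lborel.borel_measurable_lebesgue_integral by fastforce
qed

text \<open>Let the width \<delta> tend to 0: the averages of the autocorrelation converge to its
  value at 0 by dominated convergence, while the weighted integrals of the squared transform
  increase to the full integral. Working with nonnegative integrals there yields finiteness as
  well.\<close>

theorem plancherel_borel:
  fixes f :: "'a::euclidean_space \<Rightarrow> complex"
  assumes f: "integrable lborel f" and b: "\<And>t. cmod (f t) \<le> C"
  shows "(\<integral>\<^sup>+y. ennreal ((cmod (LINT t|lborel. f t * cnj (expo y t)))\<^sup>2) \<partial>lborel)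
    = ennreal (LINT t|lborel. (cmod (f t))\<^sup>2)"
proof -
  have [measurable]: "f \<in> borel_measurable borel" using f by auto
  define F where "F y = (LINT t|lborel. f t * cnj (expo y t))" for y
  have Fm [measurable]: "F \<in> borel_measurable borel"
    unfolding F_def[abs_def] by (rule borel_measurable_fourier) measurable
  define \<delta> where "\<delta> n = 1 / real (Suc n)" for n
  have \<delta>: "\<delta> n > 0" for n by (simp add: \<delta>_def)
  have \<delta>0: "\<delta> \<longlonglongrightarrow> 0" unfolding \<delta>_def[abs_def] using LIMSEQ_inverse_real_of_nat by (simp add: field_simps)
  have \<phi>m [measurable]: "autocorr f \<in> borel_measurable borel" using integrable_autocorr[OF f] by auto
  define L where "L = (LINT t|lborel. cmod (f t))"
  have "(\<lambda>n. LINT v|lborel. complex_of_real (gauss_ft v) * autocorr f (\<delta> n *\<^sub>R v))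
    \<longlonglongrightarrow> (LINT v|lborel. complex_of_real (gauss_ft (v::'a)) * autocorr f 0)"
  proof (rule integral_dominated_convergence[where w = "\<lambda>v. gauss_ft v * (C * L)"])
    show "AE v in lborel. (\<lambda>n. complex_of_real (gauss_ft v) * autocorr f (\<delta> n *\<^sub>R v)) \<longlonglongrightarrow> of_real (gauss_ft v) * autocorr f 0"
    proof (intro AE_I2 tendsto_mult tendsto_const autocorr_tendsto[OF f b])
      fix v :: 'a
      show "(\<lambda>n. \<delta> n *\<^sub>R v) \<longlonglongrightarrow> 0" using tendsto_scaleR[OF \<delta>0 tendsto_const[of v]] by simp
    qed
    show "AE v in lborel. norm (complex_of_real (gauss_ft v) * autocorr f (\<delta> n *\<^sub>R v)) \<le> gauss_ft v * (C * L)" for n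
      using cmod_autocorr_le[OF f b]
      by (intro AE_I2) (simp add: norm_mult L_def gauss_ft_pos less_imp_le abs_of_pos)
    show "integrable lborel (\<lambda>v::'a. gauss_ft v * (C * L))" using integrable_gauss_ft by auto
  qed auto
  also have "(LINT v|lborel. complex_of_real (gauss_ft (v::'a)) * autocorr f 0) = autocorr f 0"
    by (simp add: integral_gauss_ft)
  also have "autocorr f 0 = of_real (LINT t|lborel. (cmod (f t))\<^sup>2)"
    unfolding autocorr_def by (simp add: complex_norm_square[symmetric] del: of_real_power)
  finally have "(\<lambda>n. LINT v|lborel. complex_of_real (gauss_ft v) * autocorr f (\<delta> n *\<^sub>R v))
    \<longlonglongrightarrow> of_real (LINT t|lborel. (cmod (f t))\<^sup>2)" .
  then have "(\<lambda>n. complex_of_real (LINT y|lborel. gauss (\<delta> n *\<^sub>R y) * (cmod (F y))\<^sup>2))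
    \<longlonglongrightarrow> of_real (LINT t|lborel. (cmod (f t))\<^sup>2)"
    unfolding F_def gauss_weighted_fourier[OF f \<delta>] .
  then have lim1: "(\<lambda>n. LINT y|lborel. gauss (\<delta> n *\<^sub>R y) * (cmod (F y))\<^sup>2) \<longlonglongrightarrow> (LINT t|lborel. (cmod (f t))\<^sup>2)"
    unfolding tendsto_of_real_iff .
  have Fb: "cmod (F y) \<le> L" for y
    unfolding F_def L_def by (rule order_trans[OF integral_norm_bound]) (simp add: norm_mult)
  have gi: "integrable lborel (\<lambda>y::'a. gauss (\<delta> n *\<^sub>R y))" for n
    using \<delta>[of n] integrable_gauss by (rule lborel_integrable_scale)
  have nn: "(\<integral>\<^sup>+y. ennreal (gauss (\<delta> n *\<^sub>R y) * (cmod (F y))\<^sup>2) \<partial>lborel)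
    = ennreal (LINT y|lborel. gauss (\<delta> n *\<^sub>R y) * (cmod (F y))\<^sup>2)" for n
  proof (rule nn_integral_eq_integral)
    show "integrable lborel (\<lambda>y. gauss (\<delta> n *\<^sub>R y) * (cmod (F y))\<^sup>2)"
    proof (rule Bochner_Integration.integrable_bound)
      show "integrable lborel (\<lambda>y::'a. gauss (\<delta> n *\<^sub>R y) * L\<^sup>2)" using gi by auto
      show "AE y in lborel. norm (gauss (\<delta> n *\<^sub>R y) * (cmod (F y))\<^sup>2) \<le> norm (gauss (\<delta> n *\<^sub>R y) * L\<^sup>2)"
        using Fb by (intro AE_I2) (auto simp: abs_mult intro!: mult_left_mono power_mono)
    qed measurable
  qed (auto simp: gauss_pos less_imp_le)
  have lim2: "(\<lambda>n. \<integral>\<^sup>+y. ennreal (gauss (\<delta> n *\<^sub>R y) * (cmod (F y))\<^sup>2) \<partial>lborel)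
    \<longlonglongrightarrow> (\<integral>\<^sup>+y. ennreal ((cmod (F y))\<^sup>2) \<partial>lborel)"
  proof (rule nn_integral_LIMSEQ)
    show "incseq (\<lambda>n y. ennreal (gauss (\<delta> n *\<^sub>R y) * (cmod (F y))\<^sup>2))"
    proof (rule incseq_SucI, rule le_funI, rule ennreal_leI, rule mult_right_mono)
      fix n and y :: 'a
      have "\<delta> (Suc n) \<le> \<delta> n" by (simp add: \<delta>_def field_simps)
      then show "gauss (\<delta> n *\<^sub>R y) \<le> gauss (\<delta> (Suc n) *\<^sub>R y)"
        using \<delta> by (auto simp: gauss_def less_imp_le intro!: power_mono mult_right_mono)
    qed simp
    fix y :: 'a
    have "(\<lambda>n. \<delta> n *\<^sub>R y) \<longlonglongrightarrow> 0" using tendsto_scaleR[OF \<delta>0 tendsto_const[of y]] by simp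
    then have "(\<lambda>n. gauss (\<delta> n *\<^sub>R y)) \<longlonglongrightarrow> exp (- (1/2) * (norm (0::'a))\<^sup>2)"
      unfolding gauss_def by (intro tendsto_intros)
    then have "(\<lambda>n. gauss (\<delta> n *\<^sub>R y) * (cmod (F y))\<^sup>2) \<longlonglongrightarrow> 1 * (cmod (F y))\<^sup>2"
      by (intro tendsto_mult tendsto_const) simp
    then show "(\<lambda>n. ennreal (gauss (\<delta> n *\<^sub>R y) * (cmod (F y))\<^sup>2)) \<longlonglongrightarrow> ennreal ((cmod (F y))\<^sup>2)"
      by (intro tendsto_ennrealI) simp
  qed measurable
  from lim1 have "(\<lambda>n. ennreal (LINT y|lborel. gauss (\<delta> n *\<^sub>R y) * (cmod (F y))\<^sup>2))
     \<longlonglongrightarrow> ennreal (LINT t|lborel. (cmod (f t))\<^sup>2)"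
    by (rule tendsto_ennrealI)
  from LIMSEQ_unique[OF lim2[unfolded nn] this] show ?thesis
    unfolding F_def .
qed


section \<open>Fourier transforms of Lebesgue measurable functions\<close>

definition ft :: "('a::euclidean_space \<Rightarrow> complex) \<Rightarrow> 'a \<Rightarrow> complex" where
  "ft f y = (LINT t|lebesgue. f t * cnj (expo y t))"

lemma borel_measurable_lebesgue_expo [measurable]: "expo y \<in> borel_measurable lebesgue"
  by (rule measurable_completion) simp

text \<open>Real and imaginary part are changed on null sets, and the result is set to 0 on a Borel
  null set containing all points of disagreement. Hence every value of \<open>g\<close> is 0 or a
  value of \<open>f\<close>, and pointwise bounds of the modulus survive.\<close>

lemma lebesgue_ex_borel_version:
  fixes f :: "'a::euclidean_space \<Rightarrow> complex"
  assumes f: "f \<in> borel_measurable lebesgue"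
  obtains g where "g \<in> borel_measurable borel" "AE t in lebesgue. f t = g t" "\<And>t. g t = 0 \<or> cmod (g t) \<in> range (\<lambda>t. cmod (f t))"
proof -
  have re: "(\<lambda>t. Re (f t)) \<in> borel_measurable lebesgue" and im: "(\<lambda>t. Im (f t)) \<in> borel_measurable lebesgue"
    using f by measurable
  obtain r i where r: "r \<in> borel_measurable lborel" "AE t in lborel. Re (f t) = r t"
    and i: "i \<in> borel_measurable lborel" "AE t in lborel. Im (f t) = i t"
    using completion_ex_borel_measurable_real[OF re] completion_ex_borel_measurable_real[OF im] by metis
  have "AE t in lborel. f t = Complex (r t) (i t)" using r(2) i(2) by eventually_elim (simp add: complex_eq_iff)
  then obtain N where N: "N \<in> null_sets lborel" "{t \<in> space lborel. \<not> f t = Complex (r t) (i t)} \<subseteq> N"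
    by (auto simp: eventually_ae_filter)
  define g where "g t = (if t \<in> N then 0 else Complex (r t) (i t))" for t
  have [measurable]: "r \<in> borel_measurable borel" "i \<in> borel_measurable borel" "N \<in> sets borel"
    using r i N by auto
  have c: "(\<lambda>t. Complex (r t) (i t)) \<in> borel_measurable borel"
    unfolding Complex_eq by measurable
  have "g \<in> borel_measurable borel" unfolding g_def[abs_def] using c by measurable
  moreover have "AE t in lborel. t \<notin> N" using N(1) by (rule AE_not_in)
  then have "AE t in lborel. f t = g t"
    by eventually_elim (use N(2) in \<open>auto simp: g_def\<close>)
  then have "AE t in lebesgue. f t = g t" by (rule AE_completion)
  moreover have "g t = 0 \<or> cmod (g t) \<in> range (\<lambda>t. cmod (f t))" for t
  proof (cases "t \<in> N")
    case False
    then have "\<not> (f t \<noteq> Complex (r t) (i t))" using N(2) by auto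
    then have "g t = f t" using False by (simp add: g_def)
    then show ?thesis by simp
  qed (simp add: g_def)
  ultimately show ?thesis using that by blast
qed

lemma ft_borel_version:
  fixes f :: "'a::euclidean_space \<Rightarrow> complex"
  assumes f: "integrable lebesgue f" and g: "g \<in> borel_measurable borel" "AE t in lebesgue. f t = g t"
  shows "integrable lborel g" and "ft f y = (LINT t|lborel. g t * cnj (expo y t))"
    and "(LINT t|lebesgue. (cmod (f t))\<^sup>2) = (LINT t|lborel. (cmod (g t))\<^sup>2)"
proof -
  have [measurable]: "g \<in> borel_measurable borel" by fact
  have gl [measurable]: "g \<in> borel_measurable lebesgue" using g(1) by (simp add: measurable_completion)
  have "integrable lebesgue g" using f g by (subst integrable_cong_AE[symmetric, of f]) auto
  then show "integrable lborel g" using g(1) by (simp add: integrable_completion)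
  have fm [measurable]: "f \<in> borel_measurable lebesgue" using f by auto
  have "ft f y = (LINT t|lebesgue. g t * cnj (expo y t))"
    unfolding ft_def by (rule integral_cong_AE) (use g(2) in auto)
  then show "ft f y = (LINT t|lborel. g t * cnj (expo y t))"
    by (subst (asm) integral_completion) auto
  have "(LINT t|lebesgue. (cmod (f t))\<^sup>2) = (LINT t|lebesgue. (cmod (g t))\<^sup>2)"
    by (rule integral_cong_AE) (use g(2) in auto)
  then show "(LINT t|lebesgue. (cmod (f t))\<^sup>2) = (LINT t|lborel. (cmod (g t))\<^sup>2)"
    by (subst (asm) integral_completion) auto
qed

lemma integrable_mult_expo:
  assumes "integrable lebesgue f"
  shows "integrable lebesgue (\<lambda>t. f t * expo y t)" "integrable lebesgue (\<lambda>t. f t * cnj (expo y t))"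
proof -
  have [measurable]: "f \<in> borel_measurable lebesgue" using assms by auto
  show "integrable lebesgue (\<lambda>t. f t * expo y t)" "integrable lebesgue (\<lambda>t. f t * cnj (expo y t))"
    by (rule Bochner_Integration.integrable_bound[OF assms]; simp add: norm_mult)+
qed

lemma ft_expo_mult: "ft (\<lambda>t. f t * expo z t) y = ft f (y - z)"
  unfolding ft_def by (rule Bochner_Integration.integral_cong) (auto simp: expo_diff_left)

lemma ft_sum:
  assumes "\<And>z. z \<in> I \<Longrightarrow> integrable lebesgue (f z)"
  shows "ft (\<lambda>t. \<Sum>z\<in>I. c z * f z t) y = (\<Sum>z\<in>I. c z * ft (f z) y)"
proof -
  have "ft (\<lambda>t. \<Sum>z\<in>I. c z * f z t) y = (LINT t|lebesgue. (\<Sum>z\<in>I. c z * (f z t * cnj (expo y t))))"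
    unfolding ft_def by (simp add: sum_distrib_right mult.assoc)
  also have "\<dots> = (\<Sum>z\<in>I. (LINT t|lebesgue. c z * (f z t * cnj (expo y t))))"
    by (rule Bochner_Integration.integral_sum) (intro integrable_mult_right integrable_mult_expo assms)
  finally show ?thesis by (simp add: ft_def)
qed

lemma ft_mult_sum_expo:
  assumes "integrable lebesgue f"
  shows "ft (\<lambda>t. f t * (\<Sum>z\<in>I. c z * expo z t)) y = (\<Sum>z\<in>I. c z * ft f (y - z))"
proof -
  have "ft (\<lambda>t. f t * (\<Sum>z\<in>I. c z * expo z t)) y = ft (\<lambda>t. \<Sum>z\<in>I. c z * (f t * expo z t)) y"
    by (simp add: sum_distrib_left algebra_simps)
  also have "\<dots> = (\<Sum>z\<in>I. c z * ft (\<lambda>t. f t * expo z t) y)"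
    by (rule ft_sum) (rule integrable_mult_expo[OF assms])
  finally show ?thesis by (simp add: ft_expo_mult)
qed

lemma ft_tendsto:
  assumes f: "integrable lebesgue f" and "y \<longlonglongrightarrow> l"
  shows "(\<lambda>n. ft f (y n)) \<longlonglongrightarrow> ft f l"
  unfolding ft_def
proof (rule integral_dominated_convergence[where w = "\<lambda>t. cmod (f t)"])
  show "AE t in lebesgue. (\<lambda>n. f t * cnj (expo (y n) t)) \<longlonglongrightarrow> f t * cnj (expo l t)"
    using assms(2) by (intro AE_I2 tendsto_intros tendsto_expo_left)
qed (use integrable_mult_expo(2)[OF f] f in \<open>auto simp: norm_mult\<close>)

lemma continuous_on_ft:
  assumes "integrable lebesgue f"
  shows "continuous_on A (ft f)"
  unfolding continuous_on_sequentially using ft_tendsto[OF assms] by (auto simp: o_def)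

lemma borel_measurable_ft:
  assumes "integrable lebesgue f"
  shows "ft f \<in> borel_measurable borel"
  using continuous_on_ft[OF assms] by (rule borel_measurable_continuous_onI)

theorem plancherel:
  assumes f: "integrable lebesgue f" and b: "\<And>t. cmod (f t) \<le> C"
  shows "(\<integral>\<^sup>+y. ennreal ((cmod (ft f y))\<^sup>2) \<partial>lborel) = ennreal (LINT t|lebesgue. (cmod (f t))\<^sup>2)"
    and "integrable lborel (\<lambda>y. (cmod (ft f y))\<^sup>2)"
    and "(LINT y|lborel. (cmod (ft f y))\<^sup>2) = (LINT t|lebesgue. (cmod (f t))\<^sup>2)"
proof -
  have C: "C \<ge> 0" using b[of 0] norm_ge_zero order_trans by blast
  obtain g where g: "g \<in> borel_measurable borel" "AE t in lebesgue. f t = g t"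
    and r: "\<And>t. g t = 0 \<or> cmod (g t) \<in> range (\<lambda>t. cmod (f t))"
    using lebesgue_ex_borel_version[of f] f by auto
  have gb: "cmod (g t) \<le> C" for t using r[of t] b C by auto
  show eq: "(\<integral>\<^sup>+y. ennreal ((cmod (ft f y))\<^sup>2) \<partial>lborel) = ennreal (LINT t|lebesgue. (cmod (f t))\<^sup>2)"
    unfolding ft_borel_version(2,3)[OF f g] by (rule plancherel_borel[OF ft_borel_version(1)[OF f g] gb])
  have [measurable]: "ft f \<in> borel_measurable borel" by (rule borel_measurable_ft[OF f])
  show int: "integrable lborel (\<lambda>y. (cmod (ft f y))\<^sup>2)"
    by (rule integrableI_nonneg) (use eq in auto)
  have "ennreal (LINT y|lborel. (cmod (ft f y))\<^sup>2) = ennreal (LINT t|lebesgue. (cmod (f t))\<^sup>2)"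
    unfolding eq[symmetric] by (rule nn_integral_eq_integral[symmetric]) (use int in auto)
  then show "(LINT y|lborel. (cmod (ft f y))\<^sup>2) = (LINT t|lebesgue. (cmod (f t))\<^sup>2)"
    by (subst (asm) ennreal_inj) (auto intro: integral_nonneg_AE)
qed

lemma integrable_square_if_bounded:
  fixes f :: "'a \<Rightarrow> complex"
  assumes f: "integrable M f" and b: "\<And>t. cmod (f t) \<le> C"
  shows "integrable M (\<lambda>t. (cmod (f t))\<^sup>2)"
proof (rule Bochner_Integration.integrable_bound)
  have C: "C \<ge> 0" using b norm_ge_zero order_trans by blast
  show "integrable M (\<lambda>t. C * cmod (f t))" using f by auto
  show "AE t in M. norm ((cmod (f t))\<^sup>2) \<le> norm (C * cmod (f t))"
    using b C by (intro AE_I2) (auto simp: power2_eq_square intro: mult_right_mono)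
  show "(\<lambda>t. (cmod (f t))\<^sup>2) \<in> borel_measurable M" using f by (auto intro: borel_measurable_integrable)
qed

section \<open>Tails of square integrable functions and of Fourier transforms\<close>

lemma tail_integral_small:
  fixes h :: "'a::euclidean_space \<Rightarrow> real"
  assumes h: "integrable lborel h" "\<And>y. h y \<ge> 0" and e: "e > 0"
  obtains R where "R > 0" "(LINT y|lborel. h y * indicator (- ball 0 R) y) < e"
proof -
  have [measurable]: "h \<in> borel_measurable borel" using h by auto
  have "(\<lambda>n. LINT y|lborel. h y * indicator (- ball 0 (real n)) y) \<longlonglongrightarrow> (LINT y|lborel. (0::real) * h y)"
  proof (rule integral_dominated_convergence[where w = h])
    show "AE y in lborel. (\<lambda>n. h y * indicator (- ball 0 (real n)) y) \<longlonglongrightarrow> 0 * h y"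
    proof (rule AE_I2)
      fix y :: 'a
      obtain N :: nat where N: "norm y < N" using reals_Archimedean2 by blast
      have "h y * indicator (- ball 0 (real n)) y = 0" if "n \<ge> N" for n
        using N that by (auto simp: indicator_def)
      then have "eventually (\<lambda>n. h y * indicator (- ball 0 (real n)) y = 0) sequentially"
        by (auto simp: eventually_sequentially)
      then show "(\<lambda>n. h y * indicator (- ball 0 (real n)) y) \<longlonglongrightarrow> 0 * h y" by (simp add: tendsto_eventually)
    qed
  qed (use h in \<open>auto simp: indicator_def\<close>)
  then have "(\<lambda>n. LINT y|lborel. h y * indicator (- ball 0 (real n)) y) \<longlonglongrightarrow> 0" by simp
  then have "eventually (\<lambda>n. (LINT y|lborel. h y * indicator (- ball 0 (real n)) y) < e) sequentially"
    using e by (rule order_tendstoD)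
  then obtain N where "\<And>n. n \<ge> N \<Longrightarrow> (LINT y|lborel. h y * indicator (- ball 0 (real n)) y) < e"
    by (auto simp: eventually_sequentially)
  from this[of "Suc N"] show ?thesis by (intro that[of "real (Suc N)"]) auto
qed

lemma borel_ball [measurable]: "ball x r \<in> sets (borel :: 'a::euclidean_space measure)"
  by simp

lemma integrable_indicator_ball:
  "integrable lborel (\<lambda>t. indicator (ball (x::'a::euclidean_space) r) t :: real)"
  "integrable lborel (\<lambda>t. indicator (ball (x::'a::euclidean_space) r) t :: complex)"
proof -
  show i: "integrable lborel (\<lambda>t. indicator (ball (x::'a::euclidean_space) r) t :: real)"
    using emeasure_lborel_ball_finite[of x r] by (intro integrable_real_indicator) auto
  have "(\<lambda>t. indicator (ball x r) t :: complex) = (\<lambda>t. of_real (indicator (ball x r) t))"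
    by (auto simp: indicator_def)
  then show "integrable lborel (\<lambda>t. indicator (ball x r) t :: complex)"
    using i by simp
qed

lemma integral_indicator_ball_complex:
  "(LINT t|lborel. indicator (ball (x::'a::euclidean_space) r) t :: complex) = of_real (measure lborel (ball x r))"
proof -
  have "(\<lambda>t. indicator (ball x r) t :: complex) = (\<lambda>t. of_real (indicator (ball x r) t))"
    by (auto simp: indicator_def)
  then show ?thesis by simp
qed

lemma indicator_square: "(indicator A x :: 'b::semiring_1)\<^sup>2 = indicator A x"
  by (simp add: indicator_def)

lemma nonneg_quadratic_form_discriminant:
  fixes F G b :: real
  assumes q: "\<And>x y. 0 \<le> x\<^sup>2 * F - 2 * x * y * b + y\<^sup>2 * G"
  shows "b\<^sup>2 \<le> F * G"
proof (cases "G = 0")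
  case True
  have "b = 0"
  proof (rule ccontr)
    assume "b \<noteq> 0"
    \<comment> \<open>With G = 0 the form at x = 1 is F - 2 y b, and this y makes it -1.\<close>
    then show False using q[of 1 "(F + 1) / (2 * b)"] True by (simp add: field_simps)
  qed
  then show ?thesis using True by simp
next
  case False
  then have "G > 0" using q[of 0 1] by simp
  \<comment> \<open>At the point (G, b) the form factors as G (F G - b^2).\<close>
  have "0 \<le> G * (F * G - b\<^sup>2)" using q[of G b] by (simp add: power2_eq_square algebra_simps)
  then show ?thesis using \<open>G > 0\<close> by (simp add: zero_le_mult_iff)
qed

lemma
  fixes f g :: "'a \<Rightarrow> real"
  assumes [measurable]: "f \<in> borel_measurable M" "g \<in> borel_measurable M"
    and f: "integrable M (\<lambda>x. (f x)\<^sup>2)" and g: "integrable M (\<lambda>x. (g x)\<^sup>2)"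
  shows integrable_mult_square_integrable: "integrable M (\<lambda>x. f x * g x)"
    and integral_Cauchy_Schwarz: "(LINT x|M. f x * g x)\<^sup>2 \<le> (LINT x|M. (f x)\<^sup>2) * (LINT x|M. (g x)\<^sup>2)"
proof -
  show int: "integrable M (\<lambda>x. f x * g x)"
  proof (rule Bochner_Integration.integrable_bound)
    show "integrable M (\<lambda>x. (f x)\<^sup>2 + (g x)\<^sup>2)" using f g by auto
    have "\<bar>a * b\<bar> \<le> \<bar>a\<^sup>2 + b\<^sup>2\<bar>" for a b :: real
    proof -
      have "2 * (\<bar>a\<bar> * \<bar>b\<bar>) \<le> a\<^sup>2 + b\<^sup>2"
        using sum_squares_bound[of "\<bar>a\<bar>" "\<bar>b\<bar>"] by simp
      moreover have "0 \<le> \<bar>a\<bar> * \<bar>b\<bar>" by simp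
      ultimately show ?thesis unfolding abs_mult by linarith
    qed
    then show "AE x in M. norm (f x * g x) \<le> norm ((f x)\<^sup>2 + (g x)\<^sup>2)" by simp
  qed measurable
  show "(LINT x|M. f x * g x)\<^sup>2 \<le> (LINT x|M. (f x)\<^sup>2) * (LINT x|M. (g x)\<^sup>2)"
  proof (rule nonneg_quadratic_form_discriminant)
    fix a b :: real
    have "0 \<le> (LINT x|M. (a * f x - b * g x)\<^sup>2)" by (simp add: integral_nonneg_AE)
    also have "(LINT x|M. (a * f x - b * g x)\<^sup>2)
      = (LINT x|M. a\<^sup>2 * (f x)\<^sup>2 - 2 * a * b * (f x * g x) + b\<^sup>2 * (g x)\<^sup>2)"
      by (rule Bochner_Integration.integral_cong) (auto simp: power2_eq_square algebra_simps)
    also have "\<dots> = a\<^sup>2 * (LINT x|M. (f x)\<^sup>2) - 2 * a * b * (LINT x|M. f x * g x) + b\<^sup>2 * (LINT x|M. (g x)\<^sup>2)"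
      using f g int by simp
    finally show "0 \<le> \<dots>" .
  qed
qed


lemma norm_expo_minus_1_le: "cmod (expo y t - 1) \<le> 2 * pi * (norm y * norm t)"
proof -
  have "cmod (cis x - 1) \<le> \<bar>x\<bar>" for x :: real
    using iexp_approx1[of x 0] by (simp add: cis_conv_exp)
  from this[of "2 * pi * (y \<bullet> t)"] have "cmod (expo y t - 1) \<le> 2 * pi * \<bar>y \<bullet> t\<bar>"
    by (simp add: expo_eq_cis abs_mult)
  also have "\<dots> \<le> 2 * pi * (norm y * norm t)"
    using Cauchy_Schwarz_ineq2[of y t] by simp
  finally show ?thesis .
qed

text \<open>A function of bounded support is a product \<open>h m\<close> where \<open>m\<close> is the Fourier transform of a
  uniform distribution on a small ball; so the transform of \<open>f\<close> is a local average of that of \<open>h\<close>,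
  and sums over separated sets are dominated by integrals.\<close>

lemma fourier_eq_local_average:
  fixes f :: "'a::euclidean_space \<Rightarrow> complex"
  assumes f: "f \<in> borel_measurable borel" "\<And>t. cmod (f t) \<le> C" "\<And>t. t \<notin> ball 0 \<rho> \<Longrightarrow> f t = 0"
    and s: "s > 0" "\<rho> > 0" "2 * pi * (s * \<rho>) \<le> 1 / 2"
  shows "\<exists>h. h \<in> borel_measurable borel \<and> (\<forall>t. cmod (h t) \<le> 2 * C) \<and> integrable lborel h \<and>
    (\<forall>\<xi>. measure lborel (ball (0::'a) s) * (LINT t|lborel. f t * cnj (expo \<xi> t))
       = (LINT \<eta>|lborel. indicator (ball 0 s) \<eta> * (LINT t|lborel. h t * cnj (expo (\<xi> + \<eta>) t))))"
proof -
  have C: "C \<ge> 0" using f(2)[of 0] norm_ge_zero order_trans by blast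
  define v where "v = measure lborel (ball (0::'a) s)"
  have v: "v > 0"
    using content_ball_pos[OF s(1), of "0::'a"] by (simp add: v_def)
  define k where "k t = (LINT \<eta>|lborel. indicator (ball 0 s) \<eta> * cnj (expo \<eta> t))" for t :: 'a
  have [measurable]: "f \<in> borel_measurable borel" by fact
  have iB: "integrable lborel (\<lambda>\<eta>. indicator (ball (0::'a) s) \<eta> :: complex)"
    by (rule integrable_indicator_ball)
  have iBe: "integrable lborel (\<lambda>\<eta>. indicator (ball (0::'a) s) \<eta> * cnj (expo \<eta> t))" for t :: 'a
    by (rule Bochner_Integration.integrable_bound[OF iB]) (auto simp: norm_mult)
  have km [measurable]: "k \<in> borel_measurable borel"
  proof -
    have "(\<lambda>(t::'a, \<eta>). indicator (ball 0 s) \<eta> * cnj (expo \<eta> t)) \<in> borel_measurable (borel \<Otimes>\<^sub>M lborel)"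
      by measurable
    from lborel.borel_measurable_lebesgue_integral[OF this] show ?thesis by (simp add: k_def[abs_def])
  qed
  \<comment> \<open>On the support of \<open>f\<close> the exponentials with \<eta> in the small
    ball differ from 1 by at most \<open>2 * pi * (s * \<rho>)\<close>, hence by at most 1/2; the
    division by \<open>k\<close> is safe there.\<close>
  have k: "cmod (k t) \<ge> v / 2" if "t \<in> ball 0 \<rho>" for t
  proof -
    have "of_real v - k t = (LINT \<eta>|lborel. indicator (ball 0 s) \<eta> - indicator (ball 0 s) \<eta> * cnj (expo \<eta> t))"
      unfolding k_def v_def using iB iBe[of t] by (simp add: integral_indicator_ball_complex)
    then have "cmod (of_real v - k t) \<le> (LINT \<eta>|lborel. cmod (indicator (ball 0 s) \<eta> - indicator (ball 0 s) \<eta> * cnj (expo \<eta> t)))"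
      by (simp only: integral_norm_bound)
    also have "\<dots> \<le> (LINT \<eta>|lborel. indicator (ball (0::'a) s) \<eta> * (1 / 2))"
    proof (rule integral_mono')
      show "integrable lborel (\<lambda>\<eta>::'a. indicator (ball 0 s) \<eta> * (1 / 2) :: real)"
        by (intro integrable_mult_left integrable_indicator_ball)
      fix \<eta> :: 'a
      show "cmod (indicator (ball 0 s) \<eta> - indicator (ball 0 s) \<eta> * cnj (expo \<eta> t)) \<le> indicator (ball 0 s) \<eta> * (1 / 2)"
      proof (cases "\<eta> \<in> ball 0 s")
        case True
        have "cmod (1 - cnj (expo \<eta> t)) = cmod (expo \<eta> t - 1)"
          by (metis complex_cnj_diff complex_cnj_one complex_mod_cnj norm_minus_commute)
        also have "\<dots> \<le> 2 * pi * (norm \<eta> * norm t)" by (rule norm_expo_minus_1_le)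
        also have "\<dots> \<le> 2 * pi * (s * \<rho>)"
          using True that s by (intro mult_left_mono mult_mono) auto
        finally show ?thesis using True s by simp
      qed simp
    qed simp
    also have "\<dots> = v / 2" by (simp add: v_def)
    finally have "cmod (of_real v - k t) \<le> v / 2" .
    moreover have "v \<le> cmod (of_real v - k t) + cmod (k t)"
      using norm_triangle_ineq[of "of_real v - k t" "k t"] v by simp
    ultimately show ?thesis by simp
  qed
  \<comment> \<open>Outside \<open>ball 0 \<rho>\<close> both \<open>f\<close> and \<open>h\<close>
    vanish, whatever the value of \<open>k\<close>.\<close>
  define h where "h t = v * f t / k t" for t
  have hf: "v * f t = h t * k t" for t
    using k[of t] v f(3)[of t] by (cases "t \<in> ball 0 \<rho>") (auto simp: h_def)
  have hm [measurable]: "h \<in> borel_measurable borel" unfolding h_def[abs_def] by measurable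
  have hb: "cmod (h t) \<le> 2 * C * indicator (ball 0 \<rho>) t" for t
  proof (cases "t \<in> ball 0 \<rho>")
    case True
    have "v * cmod (f t) \<le> v * C" using f(2) v by simp
    also have "\<dots> \<le> 2 * C * cmod (k t)" using mult_left_mono[OF k[OF True] C] by (simp add: mult_ac)
    finally have "v * cmod (f t) / cmod (k t) \<le> 2 * C"
      using k[OF True] v by (subst pos_divide_le_eq) auto
    then show ?thesis using True v by (simp add: h_def norm_divide norm_mult)
  qed (simp add: h_def f(3))
  have hi: "integrable lborel h"
  proof (rule Bochner_Integration.integrable_bound)
    show "integrable lborel (\<lambda>t. 2 * C * indicator (ball (0::'a) \<rho>) t)"
      by (intro integrable_mult_right integrable_indicator_ball)
    show "AE t in lborel. norm (h t) \<le> norm (2 * C * indicator (ball 0 \<rho>) t)"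
      using hb C by (intro AE_I2) (simp add: abs_mult)
  qed measurable
  show ?thesis
  proof (intro exI conjI allI, rule hm)
    show "integrable lborel h" by (rule hi)
    show "cmod (h t) \<le> 2 * C" for t using hb[of t] C by (cases "t \<in> ball 0 \<rho>") auto
    fix \<xi> :: 'a
    have "of_real v * (LINT t|lborel. f t * cnj (expo \<xi> t)) = (LINT t|lborel. of_real v * (f t * cnj (expo \<xi> t)))"
      by simp
    also have "\<dots> = (LINT t|lborel. h t * cnj (expo \<xi> t) * k t)"
      using hf by (intro Bochner_Integration.integral_cong refl) (simp add: mult.assoc[symmetric])
    also have "\<dots> = (LINT t|lborel. (LINT \<eta>|lborel. h t * cnj (expo \<xi> t) * (indicator (ball 0 s) \<eta> * cnj (expo \<eta> t))))"
      by (simp add: k_def)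
    also have "\<dots> = (LINT \<eta>|lborel. (LINT t|lborel. h t * cnj (expo \<xi> t) * (indicator (ball 0 s) \<eta> * cnj (expo \<eta> t))))"
    proof (rule lborel_pair.Fubini_integral[symmetric])
      have "integrable (lborel \<Otimes>\<^sub>M lborel) (\<lambda>(t::'a, \<eta>::'a). h t * indicator (ball 0 s) \<eta>)"
      proof (rule lborel_pair.Fubini_integrable)
        show "integrable lborel (\<lambda>t::'a. LINT \<eta>|lborel. norm (case (t, \<eta>) of (t, \<eta>) \<Rightarrow> h t * indicator (ball 0 s) \<eta>))"
          using hi by (simp add: norm_mult)
      qed (use iB in auto)
      then show "integrable (lborel \<Otimes>\<^sub>M lborel) (\<lambda>(t::'a, \<eta>::'a). h t * cnj (expo \<xi> t) * (indicator (ball 0 s) \<eta> * cnj (expo \<eta> t)))"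
        by (rule Bochner_Integration.integrable_bound) (auto simp: norm_mult)
    qed
    also have "\<dots> = (LINT \<eta>|lborel. indicator (ball 0 s) \<eta> * (LINT t|lborel. h t * cnj (expo (\<xi> + \<eta>) t)))"
      by (subst Bochner_Integration.integral_mult_right_zero[symmetric]) (simp add: expo_add_left algebra_simps)
    finally show "measure lborel (ball (0::'a) s) * (LINT t|lborel. f t * cnj (expo \<xi> t))
       = (LINT \<eta>|lborel. indicator (ball 0 s) \<eta> * (LINT t|lborel. h t * cnj (expo (\<xi> + \<eta>) t)))"
      by (simp add: v_def)
  qed
qed

text \<open>By the local average, each squared value at \<xi> is at most the mean of the integrable
  function |H|^2 over a ball about \<xi>. Separation makes these balls disjoint, so the sum is at
  most a multiple of the tail of one fixed integral; hence \<open>R\<close> is the same for all sets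
  with the given separation.\<close>

lemma fourier_tail_separated:
  fixes f :: "'a::euclidean_space \<Rightarrow> complex"
  assumes f: "f \<in> borel_measurable borel" "\<And>t. cmod (f t) \<le> C" "\<And>t. t \<notin> ball 0 \<rho> \<Longrightarrow> f t = 0"
    and "\<rho> > 0" "\<sigma> > 0" "e > 0"
  obtains R where "R > 0" "\<And>F. finite F \<Longrightarrow> F \<inter> ball 0 R = {} \<Longrightarrow>
     (\<And>x y. x \<in> F \<Longrightarrow> y \<in> F \<Longrightarrow> x \<noteq> y \<Longrightarrow> \<sigma> \<le> dist x y) \<Longrightarrow>
     (\<Sum>\<xi>\<in>F. (cmod (LINT t|lborel. f t * cnj (expo \<xi> t)))\<^sup>2) \<le> e"
proof -
  \<comment> \<open>\<open>\<sigma> / 2\<close> makes balls of radius \<open>s\<close> about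
    different points of the set disjoint; the second bound is the phase condition of the local
    average.\<close>
  define s where "s = min (\<sigma> / 2) (1 / (4 * pi * \<rho>))"
  have s: "s > 0" "2 * s \<le> \<sigma>" using assms by (auto simp: s_def)
  have "s * \<rho> \<le> 1 / (4 * pi * \<rho>) * \<rho>" using assms by (intro mult_right_mono) (auto simp: s_def)
  then have s3: "2 * pi * (s * \<rho>) \<le> 1 / 2" using \<open>\<rho> > 0\<close> by (simp add: field_simps)
  obtain h where h: "h \<in> borel_measurable borel" "\<And>t. cmod (h t) \<le> 2 * C" "integrable lborel h"
    and avg: "\<And>\<xi>. measure lborel (ball (0::'a) s) * (LINT t|lborel. f t * cnj (expo \<xi> t))
       = (LINT \<eta>|lborel. indicator (ball 0 s) \<eta> * (LINT t|lborel. h t * cnj (expo (\<xi> + \<eta>) t)))"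
    using fourier_eq_local_average[OF f s(1) \<open>\<rho> > 0\<close> s3] by blast
  define H where "H y = (LINT t|lborel. h t * cnj (expo y t))" for y
  have [measurable]: "H \<in> borel_measurable borel"
    unfolding H_def[abs_def] using h(1) by (rule borel_measurable_fourier)
  define v where "v = measure lborel (ball (0::'a) s)"
  have v: "v > 0"
    using content_ball_pos[OF s(1), of "0::'a"] by (simp add: v_def)
  have iH: "integrable lborel (\<lambda>y. (cmod (H y))\<^sup>2)"
  proof (rule integrableI_nonneg)
    show "(\<integral>\<^sup>+y. ennreal ((cmod (H y))\<^sup>2) \<partial>lborel) < \<infinity>"
      using plancherel_borel[OF h(3,2)] by (simp add: H_def)
  qed auto
  obtain R where R: "R > 0" "(LINT y|lborel. (cmod (H y))\<^sup>2 * indicator (- ball 0 R) y) < e * v"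
    using tail_integral_small[OF iH _ mult_pos_pos[OF \<open>e > 0\<close> v]] by auto
  have iA: "integrable lborel (\<lambda>y. indicator A y * (cmod (H y))\<^sup>2)" if "A \<in> sets borel" for A
    using that by (intro Bochner_Integration.integrable_bound[OF iH]) (auto simp: indicator_def)
  have pt: "v * (cmod (LINT t|lborel. f t * cnj (expo \<xi> t)))\<^sup>2 \<le> (LINT y|lborel. indicator (ball \<xi> s) y * (cmod (H y))\<^sup>2)" for \<xi>
  proof -
    have tr: "(LINT y|lborel. indicator (ball \<xi> s) y * (cmod (H y))\<^sup>2) = (LINT \<eta>|lborel. indicator (ball 0 s) \<eta> * (cmod (H (\<xi> + \<eta>)))\<^sup>2)"
      by (subst lborel_integral_translation[symmetric, of _ \<xi>]) (auto simp: add.commute indicator_def dist_norm intro!: Bochner_Integration.integral_cong)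
    have i0: "integrable lborel (\<lambda>\<eta>. indicator (ball 0 s) \<eta> * (cmod (H (\<xi> + \<eta>)))\<^sup>2)"
      using lborel_integrable_translation[OF iA[of "ball \<xi> s"], of \<xi>]
      by (rule Bochner_Integration.integrable_cong[THEN iffD1, rotated 2]) (auto simp: add.commute indicator_def dist_norm)
    have "v * cmod (LINT t|lborel. f t * cnj (expo \<xi> t)) = cmod (v * (LINT t|lborel. f t * cnj (expo \<xi> t)))"
      using v by (simp add: norm_mult)
    also have "\<dots> = cmod (LINT \<eta>|lborel. indicator (ball 0 s) \<eta> * H (\<xi> + \<eta>))"
      unfolding v_def avg H_def ..
    also have "\<dots> \<le> (LINT \<eta>|lborel. cmod (indicator (ball 0 s) \<eta> * H (\<xi> + \<eta>)))"
      by (rule integral_norm_bound)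
    also have "\<dots> = (LINT \<eta>|lborel. indicator (ball 0 s) \<eta> * (indicator (ball 0 s) \<eta> * cmod (H (\<xi> + \<eta>))))"
      by (rule Bochner_Integration.integral_cong) (auto simp: indicator_def)
    finally have "(v * cmod (LINT t|lborel. f t * cnj (expo \<xi> t)))\<^sup>2
      \<le> (LINT \<eta>|lborel. indicator (ball 0 s) \<eta> * (indicator (ball 0 s) \<eta> * cmod (H (\<xi> + \<eta>))))\<^sup>2"
      by (rule power_mono) (use v in simp)
    also have "\<dots> \<le> (LINT \<eta>|lborel. (indicator (ball (0::'a) s) \<eta> :: real)\<^sup>2) * (LINT \<eta>|lborel. (indicator (ball 0 s) \<eta> * cmod (H (\<xi> + \<eta>)))\<^sup>2)"
    proof (rule integral_Cauchy_Schwarz)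
      show "integrable lborel (\<lambda>\<eta>. (indicator (ball (0::'a) s) \<eta> :: real)\<^sup>2)"
        unfolding indicator_square by (rule integrable_indicator_ball)
      show "integrable lborel (\<lambda>\<eta>. (indicator (ball 0 s) \<eta> * cmod (H (\<xi> + \<eta>)))\<^sup>2)"
        using i0 by (simp add: power_mult_distrib indicator_square)
    qed measurable
    also have "\<dots> = v * (LINT y|lborel. indicator (ball \<xi> s) y * (cmod (H y))\<^sup>2)"
      unfolding tr by (simp add: power_mult_distrib indicator_square v_def)
    finally have "v * (v * (cmod (LINT t|lborel. f t * cnj (expo \<xi> t)))\<^sup>2)
       \<le> v * (LINT y|lborel. indicator (ball \<xi> s) y * (cmod (H y))\<^sup>2)"
      by (simp only: power_mult_distrib power2_eq_square[of v] mult.assoc)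
    then show ?thesis using v by (simp only: mult_le_cancel_left_pos)
  qed
  show ?thesis
  \<comment> \<open>Points outside \<open>ball 0 (R + s)\<close> have their balls of radius
    \<open>s\<close> outside \<open>ball 0 R\<close>.\<close>
  proof (rule that[of "R + s"])
    show "R + s > 0" using R s by simp
    fix F :: "'a set"
    assume F: "finite F" "F \<inter> ball 0 (R + s) = {}"
      and sep: "\<And>x y. x \<in> F \<Longrightarrow> y \<in> F \<Longrightarrow> x \<noteq> y \<Longrightarrow> \<sigma> \<le> dist x y"
    have pw: "(\<Sum>\<xi>\<in>F. indicator (ball \<xi> s) y) \<le> (indicator (- ball 0 R) y :: real)" for y
    proof (cases "\<exists>\<xi>\<in>F. y \<in> ball \<xi> s")
      case True
      then obtain \<xi> where \<xi>: "\<xi> \<in> F" "dist \<xi> y < s" by auto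
      have "y \<notin> ball \<zeta> s" if "\<zeta> \<in> F - {\<xi>}" for \<zeta>
        using sep[of \<xi> \<zeta>] that \<xi> s dist_triangle2[of \<xi> \<zeta> y] by auto
      then have "(\<Sum>\<zeta>\<in>F. indicator (ball \<zeta> s) y) = (indicator (ball \<xi> s) y :: real)"
        using F(1) \<xi>(1) by (subst sum.remove) (auto intro!: sum.neutral)
      moreover have "y \<notin> ball 0 R"
        using F(2) \<xi> norm_triangle_ineq2[of \<xi> y] by (auto simp: dist_norm disjoint_iff)
      ultimately show ?thesis by (simp add: indicator_def)
    next
      case False
      then have "(\<Sum>\<xi>\<in>F. indicator (ball \<xi> s) y) = (0::real)" by (intro sum.neutral) auto
      then show ?thesis by simp
    qed
    have "v * (\<Sum>\<xi>\<in>F. (cmod (LINT t|lborel. f t * cnj (expo \<xi> t)))\<^sup>2)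
      \<le> (\<Sum>\<xi>\<in>F. (LINT y|lborel. indicator (ball \<xi> s) y * (cmod (H y))\<^sup>2))"
      unfolding sum_distrib_left by (rule sum_mono) (rule pt)
    also have "\<dots> = (LINT y|lborel. (\<Sum>\<xi>\<in>F. indicator (ball \<xi> s) y * (cmod (H y))\<^sup>2))"
      by (rule Bochner_Integration.integral_sum[symmetric]) (auto intro: iA)
    also have "\<dots> \<le> (LINT y|lborel. (cmod (H y))\<^sup>2 * indicator (- ball 0 R) y)"
    proof (rule integral_mono)
      show "integrable lborel (\<lambda>y. \<Sum>\<xi>\<in>F. indicator (ball \<xi> s) y * (cmod (H y))\<^sup>2)"
        by (intro Bochner_Integration.integrable_sum iA) auto
      show "integrable lborel (\<lambda>y. (cmod (H y))\<^sup>2 * indicator (- ball 0 R) y)"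
        using iA[of "- ball 0 R"] by (simp add: mult.commute)
      show "(\<Sum>\<xi>\<in>F. indicator (ball \<xi> s) y * (cmod (H y))\<^sup>2) \<le> (cmod (H y))\<^sup>2 * indicator (- ball 0 R) y" for y
        unfolding sum_distrib_right[symmetric] using mult_right_mono[OF pw[of y], of "(cmod (H y))\<^sup>2"] by (simp add: mult.commute)
    qed
    also have "\<dots> \<le> v * e" using R(2) by (simp add: mult.commute)
    finally show "(\<Sum>\<xi>\<in>F. (cmod (LINT t|lborel. f t * cnj (expo \<xi> t)))\<^sup>2) \<le> e"
      using v by simp
  qed
qed

lemma ft_tail_separated:
  fixes f :: "'a::euclidean_space \<Rightarrow> complex"
  assumes f: "f \<in> borel_measurable lebesgue" "\<And>t. cmod (f t) \<le> C" "\<And>t. t \<notin> ball 0 \<rho> \<Longrightarrow> f t = 0"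
    and "\<sigma> > 0" "e > 0"
  shows "\<exists>R>0. \<forall>F. finite F \<longrightarrow> F \<inter> ball 0 R = {} \<longrightarrow>
     (\<forall>x\<in>F. \<forall>y\<in>F. x \<noteq> y \<longrightarrow> \<sigma> \<le> dist x y) \<longrightarrow> (\<Sum>\<xi>\<in>F. (cmod (ft f \<xi>))\<^sup>2) \<le> e"
proof -
  have C: "C \<ge> 0" using f(2)[of 0] norm_ge_zero order_trans by blast
  \<comment> \<open>The maximum supplies the positive radius required by
    \<open>fourier_tail_separated\<close>, also when \<rho> is not positive.\<close>
  define r where "r = max \<rho> 1"
  obtain g where g: "g \<in> borel_measurable borel" "AE t in lebesgue. f t = g t"
    and rg: "\<And>t. g t = 0 \<or> cmod (g t) \<in> range (\<lambda>t. cmod (f t))"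
    using lebesgue_ex_borel_version[OF f(1)] by blast
  have [measurable]: "g \<in> borel_measurable borel" by fact
  define g' where "g' t = indicator (ball 0 r) t * g t" for t
  have m: "g' \<in> borel_measurable borel" unfolding g'_def[abs_def] by measurable
  have gb: "cmod (g t) \<le> C" for t using rg[of t] f(2) C by auto
  have b: "cmod (g' t) \<le> C" for t using gb[of t] C by (simp add: g'_def norm_mult indicator_def)
  have ae: "AE t in lebesgue. f t = g' t"
    using g(2) by eventually_elim (use f(3) in \<open>auto simp: g'_def indicator_def r_def\<close>)
  have fi: "integrable lebesgue f"
  proof (rule Bochner_Integration.integrable_bound)
    show "integrable lebesgue (\<lambda>t. C * indicator (ball (0::'a) r) t)"
      using integrable_indicator_ball(1)[of 0 r] by (intro integrable_mult_right) (simp add: integrable_completion)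
    show "AE t in lebesgue. norm (f t) \<le> norm (C * indicator (ball 0 r) t)"
      using f(2,3) C by (intro AE_I2) (auto simp: indicator_def r_def)
  qed (rule f)
  obtain R where "R > 0" and R: "\<And>F. finite F \<Longrightarrow> F \<inter> ball 0 R = {} \<Longrightarrow>
     (\<And>x y. x \<in> F \<Longrightarrow> y \<in> F \<Longrightarrow> x \<noteq> y \<Longrightarrow> \<sigma> \<le> dist x y) \<Longrightarrow>
     (\<Sum>\<xi>\<in>F. (cmod (LINT t|lborel. g' t * cnj (expo \<xi> t)))\<^sup>2) \<le> e"
    by (rule fourier_tail_separated[OF m b, of r \<sigma> e]) (use assms in \<open>auto simp: g'_def r_def\<close>)
  show ?thesis
    unfolding ft_borel_version(2)[OF fi m ae] using \<open>R > 0\<close> R by (intro exI[of _ R]) simp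
qed


section \<open>Orthonormal systems for a positive definite form\<close>

text \<open>Its vectors are coefficient families on \<open>I\<close>, not functions: the form of a
  frame is a sum over \<Lambda> plus an integral, the Gram form of a Riesz sequence is an integral,
  and both are instances.\<close>

definition hform :: "'i set \<Rightarrow> ('i \<Rightarrow> 'i \<Rightarrow> complex) \<Rightarrow> ('i \<Rightarrow> complex) \<Rightarrow> ('i \<Rightarrow> complex) \<Rightarrow> complex" where
  "hform I M c d = (\<Sum>i\<in>I. \<Sum>j\<in>I. c i * cnj (d j) * M i j)"

lemma hform_sum_left: "hform I M (\<lambda>i. \<Sum>k\<in>K. a k * c k i) d = (\<Sum>k\<in>K. a k * hform I M (c k) d)"
proof -
  have "hform I M (\<lambda>i. \<Sum>k\<in>K. a k * c k i) d = (\<Sum>i\<in>I. \<Sum>j\<in>I. \<Sum>k\<in>K. a k * (c k i * cnj (d j) * M i j))"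
    by (simp add: hform_def sum_distrib_right mult.assoc)
  also have "\<dots> = (\<Sum>i\<in>I. \<Sum>k\<in>K. \<Sum>j\<in>I. a k * (c k i * cnj (d j) * M i j))"
    by (intro sum.cong refl sum.swap)
  also have "\<dots> = (\<Sum>k\<in>K. \<Sum>i\<in>I. \<Sum>j\<in>I. a k * (c k i * cnj (d j) * M i j))"
    by (rule sum.swap)
  finally show ?thesis by (simp add: hform_def sum_distrib_left)
qed

lemma hform_diff_left: "hform I M (\<lambda>i. c i - c' i) d = hform I M c d - hform I M c' d"
  by (simp add: hform_def algebra_simps sum_subtractf)

lemma hform_scale_left: "hform I M (\<lambda>i. a * c i) d = a * hform I M c d"
  by (simp add: hform_def sum_distrib_left mult.assoc)

lemma hform_cnj:
  assumes "\<And>i j. i \<in> I \<Longrightarrow> j \<in> I \<Longrightarrow> M j i = cnj (M i j)"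
  shows "hform I M d c = cnj (hform I M c d)"
proof -
  have "cnj (hform I M c d) = (\<Sum>i\<in>I. \<Sum>j\<in>I. cnj (c i) * d j * M j i)"
    unfolding hform_def cnj_sum
  proof (intro sum.cong refl)
    fix i j assume "i \<in> I" "j \<in> I"
    then have "M j i = cnj (M i j)" by (rule assms)
    then show "cnj (c i * cnj (d j) * M i j) = cnj (c i) * d j * M j i" by simp
  qed
  also have "\<dots> = (\<Sum>j\<in>I. \<Sum>i\<in>I. cnj (c i) * d j * M j i)" by (rule sum.swap)
  also have "\<dots> = hform I M d c" unfolding hform_def by (intro sum.cong refl) simp
  finally show ?thesis by (rule sym)
qed

lemma hform_self_real:
  assumes "\<And>i j. i \<in> I \<Longrightarrow> j \<in> I \<Longrightarrow> M j i = cnj (M i j)"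
  shows "hform I M c c = of_real (Re (hform I M c c))"
proof -
  have "hform I M c c = cnj (hform I M c c)" by (rule hform_cnj) (rule assms)
  then have "Im (hform I M c c) = - Im (hform I M c c)" by (metis cnj.simps(2))
  then show ?thesis by (simp add: complex_eq_iff)
qed

definition orthonormal_for :: "'i set \<Rightarrow> ('i \<Rightarrow> 'i \<Rightarrow> complex) \<Rightarrow> ('i \<Rightarrow> 'i \<Rightarrow> complex) \<Rightarrow> bool" where
  "orthonormal_for I M g \<longleftrightarrow> (\<forall>j\<in>I. \<forall>k\<in>I. hform I M (g j) (g k) = (if j = k then 1 else 0))"

lemma orthonormal_for_exists:
  assumes I: "finite I"
    and herm: "\<And>i j. i \<in> I \<Longrightarrow> j \<in> I \<Longrightarrow> M j i = cnj (M i j)"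
    and pos: "\<And>c. (\<exists>i\<in>I. c i \<noteq> 0) \<Longrightarrow> Re (hform I M c c) > 0"
  obtains g where "orthonormal_for I M g"
proof -
  \<comment> \<open>Gram-Schmidt by induction on the index set. The support condition keeps the new
    vector nonzero: no earlier \<open>g j\<close> has an \<open>a\<close> coordinate, so subtracting
    projections leaves \<open>w a = 1\<close>.\<close>
  have "\<exists>g. (\<forall>j\<in>J. \<forall>k\<in>J. hform I M (g j) (g k) = (if j = k then 1 else 0)) \<and> (\<forall>j\<in>J. \<forall>i. i \<notin> J \<longrightarrow> g j i = 0)"
    if "finite J" "J \<subseteq> I" for J
    using that
  proof (induction J)
    case (insert a J)
    then have "J \<subseteq> I" by simp
    from insert.IH[OF this] obtain g
      where on: "\<forall>j\<in>J. \<forall>k\<in>J. hform I M (g j) (g k) = (if j = k then 1 else 0)"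
      and supp: "\<forall>j\<in>J. \<forall>i. i \<notin> J \<longrightarrow> g j i = 0" by (elim exE conjE)
    define e where "e i = (if i = a then 1 else 0 :: complex)" for i
    define w where "w i = e i - (\<Sum>j\<in>J. hform I M e (g j) * g j i)" for i
    have wa: "w a = 1" using supp insert.hyps by (simp add: w_def e_def)
    have wo: "w i = 0" if "i \<notin> insert a J" for i using that supp by (simp add: w_def e_def)
    have wg: "hform I M w (g k) = 0" if "k \<in> J" for k
    proof -
      have "hform I M w (g k) = hform I M e (g k) - (\<Sum>j\<in>J. hform I M e (g j) * hform I M (g j) (g k))"
        unfolding w_def hform_diff_left hform_sum_left ..
      also have "(\<Sum>j\<in>J. hform I M e (g j) * hform I M (g j) (g k)) = (\<Sum>j\<in>J. if j = k then hform I M e (g k) else 0)"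
        by (intro sum.cong refl) (use on that in auto)
      also have "\<dots> = hform I M e (g k)" using that insert.hyps by simp
      finally show ?thesis by simp
    qed
    have gw: "hform I M (g k) w = 0" if "k \<in> J" for k
      using hform_cnj[where d = "g k" and c = w, OF herm] wg[OF that] by simp
    define h where "h = Re (hform I M w w)"
    have h: "h > 0" unfolding h_def by (rule pos) (use insert.prems wa in \<open>auto intro!: bexI[of _ a]\<close>)
    define w' where "w' i = of_real (1 / sqrt h) * w i" for i
    have w'l: "hform I M w' d = of_real (1 / sqrt h) * hform I M w d" for d
      unfolding w'_def by (rule hform_scale_left)
    have w'r: "hform I M d w' = of_real (1 / sqrt h) * hform I M d w" for d
      using hform_cnj[where d = d and c = w', OF herm] hform_cnj[where d = d and c = w, OF herm] by (simp add: w'l)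
    have w'w': "hform I M w' w' = 1"
    proof -
      have "hform I M w' w' = of_real (1 / sqrt h * (1 / sqrt h) * h)"
        using hform_self_real[where I = I and M = M and c = w, OF herm]
        unfolding w'l w'r h_def[symmetric] by (simp only: of_real_mult mult.assoc)
      also have "1 / sqrt h * (1 / sqrt h) * h = 1" using h by (simp add: field_simps)
      finally show ?thesis by simp
    qed
    have "a \<notin> J" by (rule insert.hyps)
    then show ?case
    proof (intro exI[of _ "g(a := w')"] conjI ballI allI impI)
      fix j k
      assume "j \<in> insert a J" "k \<in> insert a J"
      then show "hform I M ((g(a := w')) j) ((g(a := w')) k) = (if j = k then 1 else 0)"
        using \<open>a \<notin> J\<close> by (auto simp: on w'w' w'l[of "g k"] w'r[of "g j"] wg gw)
    next
      fix j i
      assume "j \<in> insert a J" "i \<notin> insert a J"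
      then show "(g(a := w')) j i = 0"
        using \<open>a \<notin> J\<close> supp wo[of i] by (auto simp: w'_def)
    qed
  qed simp
  from this[OF I order_refl] show ?thesis using that unfolding orthonormal_for_def by blast
qed

text \<open>The sum is the squared norm, with respect to the form, of the functional with
  coefficients \<open>a\<close>; the hypothesis bounds that norm by \<open>k\<close>.\<close>

lemma orthonormal_bessel:
  assumes on: "orthonormal_for I M g" and I: "finite I" and k: "k \<ge> 0"
    and herm: "\<And>i j. i \<in> I \<Longrightarrow> j \<in> I \<Longrightarrow> M j i = cnj (M i j)"
    and bound: "\<And>c. (cmod (\<Sum>i\<in>I. c i * a i))\<^sup>2 \<le> k * Re (hform I M c c)"
  shows "(\<Sum>j\<in>I. (cmod (\<Sum>i\<in>I. g j i * a i))\<^sup>2) \<le> k"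
proof -
  define p where "p j = (\<Sum>i\<in>I. g j i * a i)" for j
  define s where "s = (\<Sum>j\<in>I. (cmod (p j))\<^sup>2)"
  \<comment> \<open>The vector representing the functional: functional and form both take the value
    \<open>s\<close> at it, so the bound reads \<open>s\<^sup>2 \<le> k * s\<close>.\<close>
  define c where "c i = (\<Sum>j\<in>I. cnj (p j) * g j i)" for i
  have s: "complex_of_real s = (\<Sum>j\<in>I. cnj (p j) * p j)"
    unfolding s_def of_real_sum complex_norm_square by (simp add: mult.commute)
  have "(\<Sum>i\<in>I. c i * a i) = (\<Sum>i\<in>I. \<Sum>j\<in>I. cnj (p j) * (g j i * a i))"
    by (simp add: c_def sum_distrib_right mult.assoc)
  also have "\<dots> = (\<Sum>j\<in>I. \<Sum>i\<in>I. cnj (p j) * (g j i * a i))" by (rule sum.swap)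
  also have "\<dots> = of_real s" unfolding s by (simp add: p_def sum_distrib_left)
  finally have ca: "(\<Sum>i\<in>I. c i * a i) = of_real s" .
  have "hform I M c c = (\<Sum>j\<in>I. cnj (p j) * hform I M (g j) c)"
    unfolding c_def[abs_def] by (rule hform_sum_left)
  also have "\<dots> = (\<Sum>j\<in>I. cnj (p j) * p j)"
  proof (rule sum.cong[OF refl])
    fix j assume j: "j \<in> I"
    have "hform I M c (g j) = (\<Sum>k\<in>I. cnj (p k) * hform I M (g k) (g j))"
      unfolding c_def[abs_def] by (rule hform_sum_left)
    also have "\<dots> = (\<Sum>k\<in>I. if k = j then cnj (p j) else 0)"
      using on j by (intro sum.cong) (auto simp: orthonormal_for_def)
    finally have "hform I M c (g j) = cnj (p j)" using j I by simp
    then show "cnj (p j) * hform I M (g j) c = cnj (p j) * p j"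
      using hform_cnj[where d = "g j" and c = c, OF herm] by simp
  qed
  finally have "hform I M c c = of_real s" unfolding s .
  then have "s\<^sup>2 \<le> k * s" using bound[of c] unfolding ca by simp
  moreover have "s \<ge> 0" by (simp add: s_def sum_nonneg)
  ultimately have "s \<le> k" using k by (cases "s = 0") (auto simp: power2_eq_square)
  then show ?thesis by (simp add: s_def p_def)
qed

lemma complex_Cauchy_Schwarz_sum:
  fixes a b :: "'i \<Rightarrow> complex"
  shows "(cmod (\<Sum>i\<in>I. a i * b i))\<^sup>2 \<le> (\<Sum>i\<in>I. (cmod (a i))\<^sup>2) * (\<Sum>i\<in>I. (cmod (b i))\<^sup>2)"
proof -
  have "cmod (\<Sum>i\<in>I. a i * b i) \<le> (\<Sum>i\<in>I. cmod (a i) * cmod (b i))"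
    by (rule order_trans[OF norm_sum]) (simp add: norm_mult)
  then have "(cmod (\<Sum>i\<in>I. a i * b i))\<^sup>2 \<le> (\<Sum>i\<in>I. cmod (a i) * cmod (b i))\<^sup>2"
    by (rule power_mono) simp
  also have "\<dots> \<le> (\<Sum>i\<in>I. (cmod (a i))\<^sup>2) * (\<Sum>i\<in>I. (cmod (b i))\<^sup>2)"
    by (rule Cauchy_Schwarz_ineq_sum)
  finally show ?thesis .
qed

text \<open>A cruder bound for functionals about which only the size of the coefficients is known;
  it is what handles remote frequencies.\<close>

lemma orthonormal_bessel_coercive:
  assumes on: "orthonormal_for I M g" and I: "finite I" and A: "A > 0"
    and herm: "\<And>i j. i \<in> I \<Longrightarrow> j \<in> I \<Longrightarrow> M j i = cnj (M i j)"
    and coercive: "\<And>c. A * (\<Sum>i\<in>I. (cmod (c i))\<^sup>2) \<le> Re (hform I M c c)"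
  shows "(\<Sum>j\<in>I. (cmod (\<Sum>i\<in>I. g j i * a i))\<^sup>2) \<le> (\<Sum>i\<in>I. (cmod (a i))\<^sup>2) / A"
proof (rule orthonormal_bessel[OF on I _ herm])
  show "(\<Sum>i\<in>I. (cmod (a i))\<^sup>2) / A \<ge> 0" using A by (simp add: sum_nonneg)
  fix c
  have "(cmod (\<Sum>i\<in>I. c i * a i))\<^sup>2 \<le> (\<Sum>i\<in>I. (cmod (c i))\<^sup>2) * (\<Sum>i\<in>I. (cmod (a i))\<^sup>2)"
    by (rule complex_Cauchy_Schwarz_sum)
  also have "\<dots> \<le> (Re (hform I M c c) / A) * (\<Sum>i\<in>I. (cmod (a i))\<^sup>2)"
    using coercive[of c] A by (intro mult_right_mono) (auto simp: field_simps sum_nonneg)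
  finally show "(cmod (\<Sum>i\<in>I. c i * a i))\<^sup>2 \<le> (\<Sum>i\<in>I. (cmod (a i))\<^sup>2) / A * Re (hform I M c c)"
    by (simp add: mult.commute)
qed

section \<open>Localisation in frequency\<close>

lemma integrable_mult_trig:
  assumes f: "integrable lebesgue f" "\<And>t. cmod (f t) \<le> C"
  shows "integrable lebesgue (\<lambda>t. f t * (\<Sum>z\<in>I. c z * expo z t))"
    and "cmod (f t * (\<Sum>z\<in>I. c z * expo z t)) \<le> C * (\<Sum>z\<in>I. cmod (c z))"
proof -
  have eq: "(\<lambda>t. f t * (\<Sum>z\<in>I. c z * expo z t)) = (\<lambda>t. \<Sum>z\<in>I. c z * (f t * expo z t))"
    by (simp add: sum_distrib_left algebra_simps)
  show "integrable lebesgue (\<lambda>t. f t * (\<Sum>z\<in>I. c z * expo z t))"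
    unfolding eq by (intro Bochner_Integration.integrable_sum integrable_mult_right integrable_mult_expo f)
  have "cmod (\<Sum>z\<in>I. c z * expo z t) \<le> (\<Sum>z\<in>I. cmod (c z))"
    by (rule order_trans[OF norm_sum]) (simp add: norm_mult)
  moreover have "C \<ge> 0" using f(2)[of 0] norm_ge_zero order_trans by blast
  ultimately show "cmod (f t * (\<Sum>z\<in>I. c z * expo z t)) \<le> C * (\<Sum>z\<in>I. cmod (c z))"
    unfolding norm_mult using f(2) by (intro mult_mono) auto
qed

text \<open>By Plancherel the energies can be summed in frequency. Near the ball the sharp bound
  \<kappa> applies. Elsewhere \<open>y - z\<close> has norm at least \<open>R\<close> for all z in
  \<open>I\<close>, so the crude bound sees only the tail of the transform of \<open>f\<close>, once
  for each element of \<open>I\<close>. This error is proportional to \<open>card I\<close>, and its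
  factor becomes small for large \<open>R\<close>, uniformly in \<open>x\<close> and
  \<open>r\<close>.\<close>

lemma localized_energy:
  fixes f :: "'a::euclidean_space \<Rightarrow> complex"
  assumes f: "integrable lebesgue f" "\<And>t. cmod (f t) \<le> C"
    and I: "finite I" "I \<subseteq> ball x r"
    and \<kappa>: "integrable lborel (\<lambda>y. indicator (ball x (r + R)) y * \<kappa> y)"
    and near: "\<And>y. y \<in> ball x (r + R) \<Longrightarrow>
      (\<Sum>j\<in>I. (cmod (ft (\<lambda>t. f t * (\<Sum>z\<in>I. g j z * expo z t)) y))\<^sup>2) \<le> \<kappa> y"
    and A: "A > 0"
    and far: "\<And>b. (\<Sum>j\<in>I. (cmod (\<Sum>z\<in>I. g j z * b z))\<^sup>2) \<le> (\<Sum>z\<in>I. (cmod (b z))\<^sup>2) / A"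
  shows "(\<Sum>j\<in>I. LINT t|lebesgue. (cmod (f t * (\<Sum>z\<in>I. g j z * expo z t)))\<^sup>2)
    \<le> (LINT y|lborel. indicator (ball x (r + R)) y * \<kappa> y)
       + card I * (LINT y|lborel. (cmod (ft f y))\<^sup>2 * indicator (- ball 0 R) y) / A"
proof -
  define F where "F j t = f t * (\<Sum>z\<in>I. g j z * expo z t)" for j t
  note F = integrable_mult_trig[OF f, where I = I and c = "g j" for j, folded F_def]
  note pl = plancherel[OF F]
  have iw: "integrable lborel (\<lambda>y. (cmod (ft f y))\<^sup>2 * indicator (- ball 0 R) y)"
    using borel_measurable_ft[OF f(1)]
    by (intro Bochner_Integration.integrable_bound[OF plancherel(2)[OF f]]) (auto simp: indicator_def)
  have iwz: "integrable lborel (\<lambda>y. (cmod (ft f (y - z)))\<^sup>2 * indicator (- ball 0 R) (y - z))" for z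
    using lborel_integrable_translation[OF iw, of "- z"] by simp
  have pw: "(\<Sum>j\<in>I. (cmod (ft (F j) y))\<^sup>2)
     \<le> indicator (ball x (r + R)) y * \<kappa> y + (\<Sum>z\<in>I. (cmod (ft f (y - z)))\<^sup>2 * indicator (- ball 0 R) (y - z)) / A" for y
  proof (cases "y \<in> ball x (r + R)")
    case True
    have "0 \<le> (\<Sum>z\<in>I. (cmod (ft f (y - z)))\<^sup>2 * indicator (- ball 0 R) (y - z)) / A"
      using A by (intro divide_nonneg_pos sum_nonneg) auto
    with near[OF True] True show ?thesis unfolding F_def[abs_def] by (simp only: indicator_simps mult_1 add_increasing2)
  next
    case False
    have "(\<Sum>j\<in>I. (cmod (ft (F j) y))\<^sup>2) = (\<Sum>j\<in>I. (cmod (\<Sum>z\<in>I. g j z * ft f (y - z)))\<^sup>2)"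
      unfolding F_def ft_mult_sum_expo[OF f(1)] ..
    also have "\<dots> \<le> (\<Sum>z\<in>I. (cmod (ft f (y - z)))\<^sup>2) / A" by (rule far)
    also have "(\<Sum>z\<in>I. (cmod (ft f (y - z)))\<^sup>2) = (\<Sum>z\<in>I. (cmod (ft f (y - z)))\<^sup>2 * indicator (- ball 0 R) (y - z))"
    proof (rule sum.cong[OF refl])
      fix z assume "z \<in> I"
      then have "dist x z < r" using I(2) by auto
      then have "y - z \<notin> ball 0 R" using False dist_triangle[of x y z] by (auto simp: dist_norm norm_minus_commute)
      then show "(cmod (ft f (y - z)))\<^sup>2 = (cmod (ft f (y - z)))\<^sup>2 * indicator (- ball 0 R) (y - z)" by simp
    qed
    finally show ?thesis using False by simp
  qed
  have "(\<Sum>j\<in>I. LINT t|lebesgue. (cmod (F j t))\<^sup>2) = (\<Sum>j\<in>I. LINT y|lborel. (cmod (ft (F j) y))\<^sup>2)"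
    unfolding pl(3) ..
  also have "\<dots> = (LINT y|lborel. (\<Sum>j\<in>I. (cmod (ft (F j) y))\<^sup>2))"
    by (rule Bochner_Integration.integral_sum[symmetric]) (rule pl(2))
  also have "\<dots> \<le> (LINT y|lborel. indicator (ball x (r + R)) y * \<kappa> y
      + (\<Sum>z\<in>I. (cmod (ft f (y - z)))\<^sup>2 * indicator (- ball 0 R) (y - z)) / A)"
  proof (rule integral_mono)
    show "integrable lborel (\<lambda>y. \<Sum>j\<in>I. (cmod (ft (F j) y))\<^sup>2)"
      by (intro Bochner_Integration.integrable_sum pl(2))
    show "integrable lborel (\<lambda>y. indicator (ball x (r + R)) y * \<kappa> y
      + (\<Sum>z\<in>I. (cmod (ft f (y - z)))\<^sup>2 * indicator (- ball 0 R) (y - z)) / A)"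
      by (intro Bochner_Integration.integrable_add \<kappa> integrable_divide Bochner_Integration.integrable_sum iwz)
  qed (rule pw)
  also have "\<dots> = (LINT y|lborel. indicator (ball x (r + R)) y * \<kappa> y)
     + (LINT y|lborel. (\<Sum>z\<in>I. (cmod (ft f (y - z)))\<^sup>2 * indicator (- ball 0 R) (y - z)) / A)"
    by (rule Bochner_Integration.integral_add[OF \<kappa>])
      (intro integrable_divide Bochner_Integration.integrable_sum iwz)
  also have "(LINT y|lborel. (\<Sum>z\<in>I. (cmod (ft f (y - z)))\<^sup>2 * indicator (- ball 0 R) (y - z)) / A)
     = (LINT y|lborel. (\<Sum>z\<in>I. (cmod (ft f (y - z)))\<^sup>2 * indicator (- ball 0 R) (y - z))) / A"
    by simp
  also have "(LINT y|lborel. (\<Sum>z\<in>I. (cmod (ft f (y - z)))\<^sup>2 * indicator (- ball 0 R) (y - z)))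
     = (\<Sum>z\<in>I. LINT y|lborel. (cmod (ft f (y - z)))\<^sup>2 * indicator (- ball 0 R) (y - z))"
    by (rule Bochner_Integration.integral_sum) (rule iwz)
  also have "\<dots> = (\<Sum>z\<in>I. LINT y|lborel. (cmod (ft f y))\<^sup>2 * indicator (- ball 0 R) y)"
  proof (rule sum.cong[OF refl])
    fix z
    show "(LINT y|lborel. (cmod (ft f (y - z)))\<^sup>2 * indicator (- ball 0 R) (y - z)) = (LINT y|lborel. (cmod (ft f y))\<^sup>2 * indicator (- ball 0 R) y)"
      unfolding diff_conv_add_uminus
      by (rule lborel_integral_translation[of "\<lambda>y. (cmod (ft f y))\<^sup>2 * indicator (- ball 0 R) y" "- z"])
        (use borel_measurable_integrable[OF iw] in simp)
  qed
  also have "\<dots> = card I * (LINT y|lborel. (cmod (ft f y))\<^sup>2 * indicator (- ball 0 R) y)" by simp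
  finally show ?thesis by (simp add: F_def)
qed


section \<open>Weak limits and recurrence\<close>

lemma uniform_discrete_imp_finite_Int:
  fixes \<Lambda> :: "'a::euclidean_space set"
  assumes "uniform_discrete \<Lambda>" "bounded B"
  shows "finite (\<Lambda> \<inter> B)"
proof -
  have "uniform_discrete (\<Lambda> \<inter> B)" using assms(1) by (rule uniform_discrete_subset) simp
  moreover have "bounded (\<Lambda> \<inter> B)" using assms(2) by (rule bounded_subset) simp
  ultimately show ?thesis using uniform_discrete_finite_iff by blast
qed

lemma weakly_converges_imp_eventually_near_limit:
  assumes w: "weakly_converges_to X \<Gamma>" and F: "finite F" "F \<subseteq> \<Gamma>" and "\<theta> > 0"
  shows "eventually (\<lambda>n. \<forall>\<gamma>\<in>F. \<exists>x\<in>X n. dist x \<gamma> < \<theta>) sequentially"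
  unfolding eventually_ball_finite_distrib[OF F(1)]
proof
  fix \<gamma> assume "\<gamma> \<in> F"
  then obtain l where l: "\<And>n. l n \<in> X n" "l \<longlonglongrightarrow> \<gamma>"
    using w F(2) unfolding weakly_converges_to_def by blast
  have "eventually (\<lambda>n. dist (l n) \<gamma> < \<theta>) sequentially" using l(2) \<open>\<theta> > 0\<close> by (rule tendstoD)
  then show "eventually (\<lambda>n. \<exists>x\<in>X n. dist x \<gamma> < \<theta>) sequentially"
    by eventually_elim (use l(1) in blast)
qed

text \<open>Otherwise infinitely many of the sets contain an offending point in a fixed ball; a
  limit point of these lies in \<Gamma> by the second condition of weak convergence, contradicting
  their distance from \<Gamma>.\<close>

lemma weakly_converges_imp_eventually_near_members:
  fixes X :: "nat \<Rightarrow> 'a::euclidean_space set"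
  assumes w: "weakly_converges_to X \<Gamma>" and "\<theta> > 0"
  shows "eventually (\<lambda>n. \<forall>x\<in>X n. norm x \<le> R \<longrightarrow> (\<exists>\<gamma>\<in>\<Gamma>. dist x \<gamma> < \<theta>)) sequentially"
proof (rule ccontr)
  assume "\<not> ?thesis"
  then have "frequently (\<lambda>n. \<exists>x\<in>X n. norm x \<le> R \<and> (\<forall>\<gamma>\<in>\<Gamma>. \<theta> \<le> dist x \<gamma>)) sequentially"
    unfolding not_eventually by (rule frequently_elim1) (force simp: not_less)
  then have "infinite {n. \<exists>x\<in>X n. norm x \<le> R \<and> (\<forall>\<gamma>\<in>\<Gamma>. \<theta> \<le> dist x \<gamma>)}"
    unfolding INFM_iff_infinite[symmetric] cofinite_eq_sequentially .
  then obtain s :: "nat \<Rightarrow> nat" where s: "strict_mono s" and mem: "\<And>k. s k \<in> {n. \<exists>x\<in>X n. norm x \<le> R \<and> (\<forall>\<gamma>\<in>\<Gamma>. \<theta> \<le> dist x \<gamma>)}"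
    using infinite_enumerate by blast
  from mem have "\<forall>k. \<exists>x. x \<in> X (s k) \<and> norm x \<le> R \<and> (\<forall>\<gamma>\<in>\<Gamma>. \<theta> \<le> dist x \<gamma>)" by blast
  then obtain x where x: "\<And>k. x k \<in> X (s k)" "\<And>k. norm (x k) \<le> R" "\<And>k. \<forall>\<gamma>\<in>\<Gamma>. \<theta> \<le> dist (x k) \<gamma>"
    by metis
  have "\<forall>k. x k \<in> cball 0 R" using x(2) by simp
  then obtain \<gamma> r where r: "strict_mono r" "(x \<circ> r) \<longlonglongrightarrow> \<gamma>"
    using compact_cball[of "0::'a" R] unfolding compact_def by blast
  have "\<gamma> \<in> \<Gamma>"
    using w strict_mono_o[OF s r(1)] x(1) r(2) unfolding weakly_converges_to_def
    by (metis comp_apply)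
  moreover have "eventually (\<lambda>k. dist ((x \<circ> r) k) \<gamma> < \<theta>) sequentially" using r(2) \<open>\<theta> > 0\<close> by (rule tendstoD)
  then obtain k where "dist (x (r k)) \<gamma> < \<theta>" by (auto simp: eventually_sequentially)
  ultimately show False using x(3)[of "r k"] by force
qed

lemma weak_limits_self:
  assumes "closed \<Lambda>"
  shows "\<Lambda> \<in> weak_limits \<Lambda>"
proof -
  have "weakly_converges_to (\<lambda>n. (\<lambda>l. l - 0) ` \<Lambda>) \<Lambda>"
    unfolding weakly_converges_to_def using assms
    by (auto intro: exI[of _ "\<lambda>_. x" for x] simp: closed_sequential_limits)
  then show ?thesis unfolding weak_limits_def by (auto intro!: exI[of _ "\<lambda>_. 0"])
qed

lemma infdist_translate: "infdist z ((\<lambda>l. l - y) ` \<Lambda>) = infdist (z + y) (\<Lambda> :: 'a::real_normed_vector set)"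
proof -
  have "dist z (l - y) = dist (z + y) l" for l by (simp add: dist_norm algebra_simps)
  then show ?thesis by (simp add: infdist_def image_image)
qed

lemma abs_infdist_diff_le: "\<bar>infdist x A - infdist y A\<bar> \<le> dist x y"
  using infdist_triangle[of x A y] infdist_triangle[of y A x] by (simp add: dist_commute)

text \<open>The translates are described by their distance functions. Relative density bounds these
  and they are 1-Lipschitz, so a diagonal sequence converges on a countable dense set and hence
  everywhere. The limit set is where the limit function vanishes.\<close>

lemma translates_weakly_convergent_subsequence:
  fixes \<Lambda> :: "'a::euclidean_space set"
  assumes cl: "closed \<Lambda>" and dense: "relatively_dense \<Lambda>"
  shows "\<exists>k \<Gamma>. strict_mono k \<and> weakly_converges_to (\<lambda>n. (\<lambda>l. l - y (k n :: nat)) ` \<Lambda>) \<Gamma>"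
proof -
  obtain r where r: "r > 0" "UNIV = (\<Union>l\<in>\<Lambda>. ball l r)" using dense unfolding relatively_dense_def by blast
  then have ne: "\<Lambda> \<noteq> {}" by auto
  define d where "d n z = infdist (z + y n) \<Lambda>" for n z
  have d0: "d n z \<ge> 0" for n z by (simp add: d_def infdist_nonneg)
  have dr: "d n z \<le> r" for n z
  proof -
    have "z + y n \<in> (\<Union>l\<in>\<Lambda>. ball l r)" using r(2) by blast
    then obtain l where "l \<in> \<Lambda>" "dist l (z + y n) < r" by auto
    then show ?thesis unfolding d_def using infdist_le[of l \<Lambda> "z + y n"] by (simp add: dist_commute)
  qed
  have lip: "\<bar>d n z - d n w\<bar> \<le> dist z w" for n z w
    using abs_infdist_diff_le[of "z + y n" \<Lambda> "w + y n"] by (simp add: d_def)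
  obtain Q :: "'a set" where Q: "countable Q" "\<And>U. open U \<Longrightarrow> U \<noteq> {} \<Longrightarrow> \<exists>q\<in>Q. q \<in> U"
    using countable_dense_exists by blast
  have dn: "norm (d n q) \<le> r" for n q using d0[of n q] dr[of n q] by simp
  have "\<exists>k :: nat \<Rightarrow> nat. strict_mono k \<and> (\<forall>q\<in>Q. \<exists>l. (\<lambda>n. d (k n) q) \<longlonglongrightarrow> l)"
    by (rule function_convergent_subsequence[where f = d and M = r, OF Q(1) dn]) blast
  then obtain k :: "nat \<Rightarrow> nat" where k: "strict_mono k" and conv: "\<And>q. q \<in> Q \<Longrightarrow> \<exists>l. (\<lambda>n. d (k n) q) \<longlonglongrightarrow> l"
    by blast
  have conv': "\<exists>l. (\<lambda>n. d (k n) z) \<longlonglongrightarrow> l" for z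
  proof -
    have "Cauchy (\<lambda>n. d (k n) z)"
    proof (rule metric_CauchyI)
      fix e :: real assume "e > 0"
      then obtain q where q: "q \<in> Q" "q \<in> ball z (e / 4)" using Q(2)[of "ball z (e / 4)"] by auto
      have "Cauchy (\<lambda>n. d (k n) q)" using conv[OF q(1)] by (auto intro: LIMSEQ_imp_Cauchy)
      then obtain M where M: "\<And>m n. m \<ge> M \<Longrightarrow> n \<ge> M \<Longrightarrow> dist (d (k m) q) (d (k n) q) < e / 4"
        using metric_CauchyD[of _ "e / 4"] \<open>e > 0\<close> by (metis zero_less_divide_iff zero_less_numeral)
      have "dist (d (k m) z) (d (k n) z) < e" if "m \<ge> M" "n \<ge> M" for m n
        using M[OF that] lip[of "k m" z q] lip[of "k n" z q] q(2)
        unfolding dist_real_def mem_ball abs_le_iff abs_less_iff by linarith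
      then show "\<exists>M. \<forall>m\<ge>M. \<forall>n\<ge>M. dist (d (k m) z) (d (k n) z) < e" by blast
    qed
    then show ?thesis using Cauchy_convergent convergent_def by blast
  qed
  define \<Gamma> where "\<Gamma> = {z. (\<lambda>n. d (k n) z) \<longlonglongrightarrow> 0}"
  have "weakly_converges_to (\<lambda>n. (\<lambda>l. l - y (k n)) ` \<Lambda>) \<Gamma>"
    unfolding weakly_converges_to_def
  proof (intro conjI ballI allI impI)
    fix \<gamma> assume "\<gamma> \<in> \<Gamma>"
    then have lim: "(\<lambda>n. d (k n) \<gamma>) \<longlonglongrightarrow> 0" by (simp add: \<Gamma>_def)
    have "\<exists>l. l \<in> \<Lambda> \<and> d (k n) \<gamma> = dist (\<gamma> + y (k n)) l" for n
      unfolding d_def using infdist_attains_inf[OF cl ne, of "\<gamma> + y (k n)"] by auto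
    then have "\<exists>l. \<forall>n. l n \<in> \<Lambda> \<and> d (k n) \<gamma> = dist (\<gamma> + y (k n)) (l n)" by (intro choice allI)
    then obtain l where l: "\<forall>n. l n \<in> \<Lambda> \<and> d (k n) \<gamma> = dist (\<gamma> + y (k n)) (l n)" ..
    have "dist (l n - y (k n)) \<gamma> = d (k n) \<gamma>" for n
    proof -
      have "dist (l n - y (k n)) \<gamma> = dist (\<gamma> + y (k n)) (l n)"
        by (simp add: dist_norm norm_minus_commute algebra_simps)
      then show ?thesis using l by simp
    qed
    then have "(\<lambda>n. l n - y (k n)) \<longlonglongrightarrow> \<gamma>"
      using lim by (subst tendsto_dist_iff) simp
    moreover have "l n - y (k n) \<in> (\<lambda>l. l - y (k n)) ` \<Lambda>" for n using l by simp
    ultimately show "\<exists>l. (\<forall>n. l n \<in> (\<lambda>l. l - y (k n)) ` \<Lambda>) \<and> l \<longlonglongrightarrow> \<gamma>"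
      by (intro exI[of _ "\<lambda>n. l n - y (k n)"]) simp
  next
    fix s l \<gamma>
    assume a: "strict_mono (s::nat \<Rightarrow> nat) \<and> (\<forall>j. l j \<in> (\<lambda>l. l - y (k (s j))) ` \<Lambda>) \<and> l \<longlonglongrightarrow> \<gamma>"
    then have s: "strict_mono s" and l: "\<forall>j. l j \<in> (\<lambda>l. l - y (k (s j))) ` \<Lambda>" and lim: "l \<longlonglongrightarrow> \<gamma>" by auto
    \<comment> \<open>Since the distances converge along the whole sequence, a subsequence decides
      that their limit is 0.\<close>
    obtain L where L: "(\<lambda>n. d (k n) \<gamma>) \<longlonglongrightarrow> L" using conv' by blast
    then have "(\<lambda>j. d (k (s j)) \<gamma>) \<longlonglongrightarrow> L" using LIMSEQ_subseq_LIMSEQ[OF L s] by (simp add: o_def)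
    moreover have "(\<lambda>j. d (k (s j)) \<gamma>) \<longlonglongrightarrow> 0"
    proof (rule Lim_null_comparison)
      show "(\<lambda>j. dist (l j) \<gamma>) \<longlonglongrightarrow> 0" using lim by (rule tendsto_dist_iff[THEN iffD1])
      have "norm (d (k (s j)) \<gamma>) \<le> dist (l j) \<gamma>" for j
      proof -
        have "d (k (s j)) \<gamma> = infdist \<gamma> ((\<lambda>l. l - y (k (s j))) ` \<Lambda>)" by (simp add: d_def infdist_translate)
        also have "\<dots> \<le> dist \<gamma> (l j)" using l by (intro infdist_le) blast
        finally show ?thesis using d0 by (simp add: dist_commute)
      qed
      then show "eventually (\<lambda>j. norm (d (k (s j)) \<gamma>) \<le> dist (l j) \<gamma>) sequentially" by simp
    qed
    ultimately have "L = 0" by (rule LIMSEQ_unique)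
    with L show "\<gamma> \<in> \<Gamma>" by (simp add: \<Gamma>_def)
  qed
  with k show ?thesis by blast
qed

text \<open>A weak limit \<Gamma> of translates by \<open>y\<close> has \<Lambda> among its own weak
  limits, by repetitivity. So \<Lambda> looks like \<Gamma> - z near the origin, and \<Gamma> looks
  like a translate of \<Lambda> by \<open>y (k n)\<close> on a larger ball. As \<open>z\<close> is
  fixed before \<open>n\<close>, the copy of the ball of radius \<open>R\<close> about
  \<open>y (k n) + z\<close> lies in the ball of radius \<open>k n\<close> about
  \<open>y (k n)\<close>. Prescribing \<open>y\<close> therefore decides in which growing balls the
  copies are found.\<close>

lemma almost_repetitive_recurrence:
  fixes \<Lambda> :: "'a::euclidean_space set"
  assumes rep: "almost_repetitive \<Lambda>" and "\<theta> > 0"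
  obtains n :: nat and x where "norm (x - y n) + R \<le> n"
    "\<And>l. l \<in> \<Lambda> \<Longrightarrow> norm l \<le> R \<Longrightarrow> \<exists>m\<in>\<Lambda>. dist (m - x) l < \<theta>"
    "\<And>m. m \<in> \<Lambda> \<Longrightarrow> norm (m - x) \<le> R \<Longrightarrow> \<exists>l\<in>\<Lambda>. dist (m - x) l < \<theta>"
proof -
  have sep: "uniform_discrete \<Lambda>" and dense: "relatively_dense \<Lambda>"
    and W: "\<And>\<Gamma>. \<Gamma> \<in> weak_limits \<Lambda> \<Longrightarrow> weak_limits \<Gamma> = weak_limits \<Lambda>"
    using rep by (auto simp: almost_repetitive_def separated_iff_uniform_discrete)
  have cl: "closed \<Lambda>" using sep by (rule uniform_discrete_imp_closed)
  obtain k \<Gamma> where k: "strict_mono k" and w\<Gamma>: "weakly_converges_to (\<lambda>n. (\<lambda>l. l - y (k n :: nat)) ` \<Lambda>) \<Gamma>"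
    using translates_weakly_convergent_subsequence[OF cl dense, of y] by blast
  have "\<Gamma> \<in> weak_limits \<Lambda>" using w\<Gamma> unfolding weak_limits_def by (auto intro!: exI[of _ "\<lambda>n. y (k n)"])
  then have "\<Lambda> \<in> weak_limits \<Gamma>" using W weak_limits_self[OF cl] by blast
  then obtain x where w\<Lambda>: "weakly_converges_to (\<lambda>n. (\<lambda>l. l - x n) ` \<Gamma>) \<Lambda>"
    unfolding weak_limits_def by blast
  define F where "F = \<Lambda> \<inter> cball 0 R"
  have "finite F"
    unfolding F_def using sep by (rule uniform_discrete_imp_finite_Int) simp
  have "\<theta> / 2 > 0" using \<open>\<theta> > 0\<close> by simp
  \<comment> \<open>The radius \<open>R + \<theta>\<close> leaves room for points that approximate a
    point of norm \<open>R\<close>.\<close>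
  have "eventually (\<lambda>n. (\<forall>l\<in>F. \<exists>g\<in>(\<lambda>l. l - x n) ` \<Gamma>. dist g l < \<theta> / 2) \<and>
      (\<forall>g\<in>(\<lambda>l. l - x n) ` \<Gamma>. norm g \<le> R + \<theta> \<longrightarrow> (\<exists>l\<in>\<Lambda>. dist g l < \<theta> / 2))) sequentially"
    using weakly_converges_imp_eventually_near_limit[OF w\<Lambda> \<open>finite F\<close> _ \<open>\<theta> / 2 > 0\<close>]
      weakly_converges_imp_eventually_near_members[OF w\<Lambda> \<open>\<theta> / 2 > 0\<close>, of "R + \<theta>"]
    by (intro eventually_conj) (auto simp: F_def)
  then obtain n0 where n0: "\<forall>l\<in>F. \<exists>g\<in>(\<lambda>l. l - x n0) ` \<Gamma>. dist g l < \<theta> / 2"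
    "\<forall>g\<in>(\<lambda>l. l - x n0) ` \<Gamma>. norm g \<le> R + \<theta> \<longrightarrow> (\<exists>l\<in>\<Lambda>. dist g l < \<theta> / 2)"
    by (auto simp: eventually_sequentially)
  define z where "z = x n0"
  from n0(1) have "\<forall>l\<in>F. \<exists>g. g \<in> \<Gamma> \<and> dist (g - z) l < \<theta> / 2" unfolding z_def by blast
  then obtain G where G: "\<And>l. l \<in> F \<Longrightarrow> G l \<in> \<Gamma>" "\<And>l. l \<in> F \<Longrightarrow> dist (G l - z) l < \<theta> / 2" by metis
  have "eventually (\<lambda>n. (\<forall>g\<in>G ` F. \<exists>m\<in>(\<lambda>l. l - y (k n)) ` \<Lambda>. dist m g < \<theta> / 2) \<and>
      ((\<forall>m\<in>(\<lambda>l. l - y (k n)) ` \<Lambda>. norm m \<le> R + norm z \<longrightarrow> (\<exists>g\<in>\<Gamma>. dist m g < \<theta> / 2)) \<and>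
      n \<ge> nat \<lceil>norm z + R\<rceil>)) sequentially"
    using eventually_ge_at_top[of "nat \<lceil>norm z + R\<rceil>"] weakly_converges_imp_eventually_near_limit[OF w\<Gamma> _ _ \<open>\<theta> / 2 > 0\<close>, of "G ` F"]
      weakly_converges_imp_eventually_near_members[OF w\<Gamma> \<open>\<theta> / 2 > 0\<close>, of "R + norm z"] \<open>finite F\<close> G(1)
    by (intro eventually_conj) auto
  then obtain n where n: "\<forall>g\<in>G ` F. \<exists>m\<in>(\<lambda>l. l - y (k n)) ` \<Lambda>. dist m g < \<theta> / 2"
      "\<forall>m\<in>(\<lambda>l. l - y (k n)) ` \<Lambda>. norm m \<le> R + norm z \<longrightarrow> (\<exists>g\<in>\<Gamma>. dist m g < \<theta> / 2)"
      "n \<ge> nat \<lceil>norm z + R\<rceil>"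
    by (auto simp: eventually_sequentially)
  show ?thesis
  proof (rule that[of "y (k n) + z" "k n"])
    have "n \<le> k n" using k by (rule strict_mono_imp_increasing)
    then show "norm (y (k n) + z - y (k n)) + R \<le> k n" using n(3) by simp
  next
    fix l assume l: "l \<in> \<Lambda>" "norm l \<le> R"
    then have lF: "l \<in> F" by (simp add: F_def)
    then obtain m where m: "m \<in> \<Lambda>" "dist (m - y (k n)) (G l) < \<theta> / 2" using n(1) by blast
    have "dist (m - (y (k n) + z)) l \<le> dist (m - y (k n) - z) (G l - z) + dist (G l - z) l"
      using dist_triangle[of "m - y (k n) - z" l "G l - z"] by (simp add: diff_diff_eq)
    also have "dist (m - y (k n) - z) (G l - z) = dist (m - y (k n)) (G l)" by (simp add: dist_norm)
    finally show "\<exists>m\<in>\<Lambda>. dist (m - (y (k n) + z)) l < \<theta>" using m G(2)[OF lF] by force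
  next
    fix m assume m: "m \<in> \<Lambda>" "norm (m - (y (k n) + z)) \<le> R"
    have "norm (m - y (k n)) \<le> R + norm z"
      using m(2) norm_triangle_ineq[of "m - (y (k n) + z)" z] by simp
    then obtain g where g: "g \<in> \<Gamma>" "dist (m - y (k n)) g < \<theta> / 2" using n(2) m(1) by blast
    have d1: "dist (m - (y (k n) + z)) (g - z) < \<theta> / 2" using g(2) by (simp add: dist_norm algebra_simps)
    then have "norm (g - z) \<le> R + \<theta>"
      using m(2) norm_triangle_ineq2[of "g - z" "m - (y (k n) + z)"] \<open>\<theta> > 0\<close> by (simp add: dist_norm norm_minus_commute)
    then obtain l where "l \<in> \<Lambda>" "dist (g - z) l < \<theta> / 2" using n0(2) g(1) unfolding z_def by blast
    then show "\<exists>l\<in>\<Lambda>. dist (m - (y (k n) + z)) l < \<theta>"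
      using d1 dist_triangle[of "m - (y (k n) + z)" l "g - z"] by (intro bexI[of _ l]) auto
  qed
qed


section \<open>Lattices\<close>

text \<open>The lattice (1/N) Z^d. Here \<open>N\<close> is the side of the cube on which its
  exponentials are orthogonal, so \<open>N ^ DIM('a)\<close> is both the volume of the cube and the
  number of lattice points per unit volume.\<close>

definition scaled_lattice :: "real \<Rightarrow> 'a::euclidean_space set" where
  "scaled_lattice N = {z. \<forall>b\<in>Basis. N * (z \<bullet> b) \<in> \<int>}"

definition cube :: "real \<Rightarrow> 'a::euclidean_space set" where
  "cube N = cbox (- (N / 2) *\<^sub>R One) ((N / 2) *\<^sub>R One)"

lemma mem_cube: "t \<in> cube N \<longleftrightarrow> (\<forall>b\<in>Basis. \<bar>t \<bullet> b\<bar> \<le> N / 2)"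
  by (auto simp: cube_def mem_box)

lemma bounded_cube: "bounded (cube N)"
  by (simp add: cube_def bounded_cbox)

lemma borel_cube [measurable]: "cube N \<in> sets borel"
  by (simp add: cube_def)

lemma measure_cube:
  assumes "N > 0"
  shows "emeasure lborel (cube N :: 'a::euclidean_space set) = ennreal (N ^ DIM('a))"
    and "measure lborel (cube N :: 'a::euclidean_space set) = N ^ DIM('a)"
proof -
  show *: "emeasure lborel (cube N :: 'a set) = ennreal (N ^ DIM('a))"
    unfolding cube_def by (subst emeasure_lborel_cbox) (use assms in \<open>auto simp: inner_diff_left inner_add_left\<close>)
  show "measure lborel (cube N :: 'a set) = N ^ DIM('a)"
    using assms by (simp add: measure_def *)
qed

lemma integrable_indicator_cis:
  "integrable lborel (\<lambda>x. indicator {a..b} x * cis (c * x))"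
proof (rule Bochner_Integration.integrable_bound)
  show "integrable lborel (\<lambda>x. indicator {a..b} x :: real)" by (rule integrable_real_indicator) (auto simp: emeasure_lborel_Icc_eq)
  show "(\<lambda>x. indicator {a..b} x * cis (c * x)) \<in> borel_measurable lborel"
    unfolding cis_conv_exp by measurable
qed (auto simp: norm_mult indicator_def)

lemma integral_cis_period:
  assumes N: "N > 0" and m: "N * u \<in> \<int>"
  shows "(LINT x|lborel. indicator {- (N / 2)..N / 2} x * cis (2 * pi * u * x)) = (if u = 0 then of_real N else 0)"
proof (cases "u = 0")
  case True
  have "(LINT x|lborel. complex_of_real (indicator {- (N / 2)..N / 2} x)) = of_real N"
    using N by (subst integral_complex_of_real) simp
  moreover have "(\<lambda>x. indicator {- (N / 2)..N / 2} x * cis (2 * pi * u * x)) = (\<lambda>x. complex_of_real (indicator {- (N / 2)..N / 2} x))"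
    using True by (auto simp: indicator_def)
  ultimately show ?thesis using True by simp
next
  case False
  define c where "c = 2 * pi * u"
  have c: "c \<noteq> 0" using False by (simp add: c_def)
  define F where "F x = cis (c * x) / (\<i> * c)" for x
  have "((\<lambda>x. cis (c * x)) has_vector_derivative \<i> * c * cis (c * x)) (at x within A)" for x A
  proof -
    have "((\<lambda>z. exp (\<i> * c * z)) has_field_derivative \<i> * c * exp (\<i> * c * of_real x)) (at (of_real x))"
      by (auto intro!: derivative_eq_intros)
    from has_vector_derivative_real_field[OF this, of A] show ?thesis by (simp add: cis_conv_exp mult.assoc)
  qed
  then have d: "(F has_vector_derivative cis (c * x)) (at x within A)" for x A
    unfolding F_def using c by (auto intro!: derivative_eq_intros has_vector_derivative_divide[THEN has_vector_derivative_eq_rhs])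
  have "(LINT x|lborel. indicator {- (N / 2)..N / 2} x *\<^sub>R cis (c * x)) = F (N / 2) - F (- (N / 2))"
    by (rule integral_FTC_Icc) (use N d in \<open>auto simp: cis_conv_exp intro!: continuous_intros\<close>)
  also have "\<dots> = 0"
  proof -
    obtain k where k: "N * u = of_int k" using m by (auto elim: Ints_cases)
    have "c * (N / 2) = pi * of_int k" using k by (simp add: c_def mult.commute mult.left_commute)
    \<comment> \<open>The boundary values are conjugate, and real because the sine vanishes at
      integer multiples of \<open>pi\<close>.\<close>
    moreover have "cis (pi * of_int k) = cis (- (pi * of_int k))"
      by (simp add: complex_eq_iff sin_zero_iff_int2)
    ultimately show ?thesis by (simp add: F_def)
  qed
  also have "(\<lambda>x. indicator {- (N / 2)..N / 2} x *\<^sub>R cis (c * x)) = (\<lambda>x. indicator {- (N / 2)..N / 2} x * cis (2 * pi * u * x))"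
    by (auto simp: c_def indicator_def)
  finally show ?thesis using False by simp
qed

lemma integral_cube_expo:
  fixes u :: "'a::euclidean_space"
  assumes N: "N > 0" and u: "u \<in> scaled_lattice N"
  shows "(LINT t|lborel. indicator (cube N) t * expo u t) = (if u = 0 then of_real (N ^ DIM('a)) else 0)"
proof -
  let ?h = "\<lambda>b x. indicator {- (N / 2)..N / 2} x * cis (2 * pi * (u \<bullet> b) * x)"
  have ind: "indicator (cube N) t = (\<Prod>b\<in>Basis. indicator {- (N / 2)..N / 2} (t \<bullet> b) :: complex)" for t :: 'a
  proof -
    have mem: "t \<in> cube N \<longleftrightarrow> (\<forall>b\<in>Basis. t \<bullet> b \<in> {- (N / 2)..N / 2})" by (auto simp: cube_def mem_box)
    show ?thesis
    proof (cases "\<forall>b\<in>Basis. t \<bullet> b \<in> {- (N / 2)..N / 2}")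
      case True
      then have "(\<Prod>b\<in>Basis. indicator {- (N / 2)..N / 2} (t \<bullet> b) :: complex) = 1"
        by (intro prod.neutral ballI) (simp only: indicator_simps)
      then show ?thesis using True mem by simp
    next
      case False
      then obtain b where b: "b \<in> Basis" "t \<bullet> b \<notin> {- (N / 2)..N / 2}" by blast
      then have "(\<Prod>b\<in>Basis. indicator {- (N / 2)..N / 2} (t \<bullet> b) :: complex) = 0"
        by (intro prod_zero bexI[OF _ b(1)]) (auto simp: indicator_def)
      then show ?thesis using False mem by simp
    qed
  qed
  have "(LINT t|lborel. indicator (cube N) t * expo u t) = (LINT t|lborel. (\<Prod>b\<in>Basis. ?h b (t \<bullet> b)))"
    by (simp only: ind expo_eq_prod prod.distrib)
  also have "\<dots> = (\<Prod>b\<in>Basis. LINT x|lborel. ?h b x)"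
    by (rule lborel_integral_prod_Basis) (rule integrable_indicator_cis)
  also have "\<dots> = (\<Prod>b\<in>Basis. if u \<bullet> b = 0 then of_real N else 0)"
    using u by (intro prod.cong refl integral_cis_period[OF N]) (auto simp: scaled_lattice_def)
  also have "\<dots> = (if u = 0 then of_real (N ^ DIM('a)) else 0)"
  proof (cases "u = 0")
    case False
    then obtain b where "b \<in> Basis" "u \<bullet> b \<noteq> 0" using euclidean_all_zero_iff by blast
    then show ?thesis using False by (auto intro: prod_zero)
  qed simp
  finally show ?thesis .
qed

lemma scaled_lattice_diff: "z \<in> scaled_lattice N \<Longrightarrow> w \<in> scaled_lattice N \<Longrightarrow> z - w \<in> scaled_lattice N"
  by (auto simp: scaled_lattice_def inner_diff_left right_diff_distrib)

lemma uniform_discrete_scaled_lattice: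
  assumes N: "N > 0"
  shows "uniform_discrete (scaled_lattice N :: 'a::euclidean_space set)"
proof -
  have "z = w" if zw: "z \<in> scaled_lattice N" "w \<in> scaled_lattice N" "dist z w < 1 / N" for z w :: 'a
  proof (rule euclidean_eqI)
    fix b :: 'a assume b: "b \<in> Basis"
    have "N * ((z - w) \<bullet> b) \<in> \<int>" using scaled_lattice_diff[OF zw(1,2)] b by (simp add: scaled_lattice_def)
    then obtain k where k: "N * ((z - w) \<bullet> b) = of_int k" by (auto elim: Ints_cases)
    have "\<bar>(z - w) \<bullet> b\<bar> < 1 / N" using Basis_le_norm[OF b, of "z - w"] zw(3) by (simp add: dist_norm)
    then have "\<bar>N * ((z - w) \<bullet> b)\<bar> < 1" using N by (simp add: abs_mult field_simps)
    then have "k = 0" unfolding k by linarith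
    then show "z \<bullet> b = w \<bullet> b" using k N by (simp add: inner_diff_left)
  qed
  then show ?thesis unfolding uniform_discrete_def using N by (intro exI[of _ "1 / N"]) auto
qed

lemma finite_scaled_lattice_ball:
  assumes "N > 0"
  shows "finite (scaled_lattice N \<inter> ball (x::'a::euclidean_space) r)"
  using uniform_discrete_scaled_lattice[OF assms] bounded_ball by (rule uniform_discrete_imp_finite_Int)

text \<open>Every point of the smaller ball lies in the cell of side 1/N whose corner arises by
  rounding its coordinates down; the corner is at most \<open>DIM('a) / N\<close> away, hence in the
  larger ball.\<close>

lemma scaled_lattice_count:
  fixes x :: "'a::euclidean_space"
  assumes N: "N > 0"
  shows "N ^ DIM('a) * measure lborel (ball x (r - DIM('a) / N)) \<le> card (scaled_lattice N \<inter> ball x r)"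
proof -
  let ?I = "scaled_lattice N \<inter> ball x r"
  define cell where "cell z = cbox z (z + (1 / N) *\<^sub>R One)" for z :: 'a
  have fin: "finite ?I" by (rule finite_scaled_lattice_ball[OF N])
  have cell: "emeasure lborel (cell z) = ennreal ((1 / N) ^ DIM('a))" for z
    unfolding cell_def by (subst emeasure_lborel_cbox) (use N in \<open>auto simp: inner_diff_left inner_add_left\<close>)
  have sub: "ball x (r - DIM('a) / N) \<subseteq> (\<Union>z\<in>?I. cell z)"
  proof
    fix t assume t: "t \<in> ball x (r - DIM('a) / N)"
    define z where "z = (\<Sum>b\<in>Basis. (of_int \<lfloor>N * (t \<bullet> b)\<rfloor> / N) *\<^sub>R b)"
    have zb: "z \<bullet> b = of_int \<lfloor>N * (t \<bullet> b)\<rfloor> / N" if "b \<in> Basis" for b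
      using that by (simp add: z_def inner_sum_left_Basis)
    have le: "z \<bullet> b \<le> t \<bullet> b" "t \<bullet> b \<le> z \<bullet> b + 1 / N" if "b \<in> Basis" for b
    proof -
      have "of_int \<lfloor>N * (t \<bullet> b)\<rfloor> \<le> N * (t \<bullet> b)" "N * (t \<bullet> b) \<le> of_int \<lfloor>N * (t \<bullet> b)\<rfloor> + 1" by linarith+
      then show "z \<bullet> b \<le> t \<bullet> b" "t \<bullet> b \<le> z \<bullet> b + 1 / N"
        using N by (simp_all add: zb[OF that] field_simps)
    qed
    have "norm (t - z) \<le> (\<Sum>b\<in>Basis. \<bar>(t - z) \<bullet> b\<bar>)" by (rule norm_le_l1)
    also have "\<dots> \<le> (\<Sum>b\<in>(Basis::'a set). 1 / N)"
      using le by (intro sum_mono) (force simp: inner_diff_left)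
    finally have "norm (t - z) \<le> DIM('a) / N" by simp
    then have "dist x z < r" using t dist_triangle[of x z t] by (simp add: dist_norm norm_minus_commute)
    moreover have "z \<in> scaled_lattice N" using N by (auto simp: scaled_lattice_def zb)
    moreover have "t \<in> cell z" using le by (simp add: cell_def mem_box inner_add_left)
    ultimately show "t \<in> (\<Union>z\<in>?I. cell z)" by auto
  qed
  have "emeasure lborel (ball x (r - DIM('a) / N)) \<le> emeasure lborel (\<Union>z\<in>?I. cell z)"
    by (rule emeasure_mono[OF sub]) (use fin in \<open>auto simp: cell_def\<close>)
  also have "\<dots> \<le> (\<Sum>z\<in>?I. emeasure lborel (cell z))"
    by (rule emeasure_subadditive_finite[OF fin]) (auto simp: cell_def)
  also have "\<dots> = ennreal (card ?I * (1 / N) ^ DIM('a))"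
    using N by (simp add: cell ennreal_mult ennreal_of_nat_eq_real_of_nat)
  finally have "measure lborel (ball x (r - DIM('a) / N)) \<le> card ?I * (1 / N) ^ DIM('a)"
    unfolding measure_def using N by (intro enn2real_leI) auto
  then show ?thesis using N by (simp add: field_simps power_one_over)
qed


section \<open>The space of square integrable functions\<close>

lemma L2_measurable: "f \<in> L2 S \<Longrightarrow> f \<in> borel_measurable (lebesgue_on S)"
  and L2_integrable: "f \<in> L2 S \<Longrightarrow> integrable (lebesgue_on S) (\<lambda>t. (cmod (f t))\<^sup>2)"
  by (simp_all add: L2_def)

lemma L2_nrm_nonneg: "L2_nrm S f \<ge> 0"
  by (simp add: L2_nrm_def)

lemma L2_nrm_square: "(L2_nrm S f)\<^sup>2 = (LINT t|lebesgue_on S. (cmod (f t))\<^sup>2)"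
  by (simp add: L2_nrm_def integral_nonneg_AE)

lemma L2_scale: "f \<in> L2 S \<Longrightarrow> (\<lambda>t. c * f t) \<in> L2 S"
  by (auto simp: L2_def norm_mult power_mult_distrib intro: borel_measurable_times)

lemma L2_zero: "(\<lambda>t. 0) \<in> L2 S"
  by (simp add: L2_def)

lemma L2_add:
  assumes "f \<in> L2 S" "g \<in> L2 S"
  shows "(\<lambda>t. f t + g t) \<in> L2 S"
proof -
  note [measurable] = L2_measurable[OF assms(1)] L2_measurable[OF assms(2)]
  have "integrable (lebesgue_on S) (\<lambda>t. (cmod (f t + g t))\<^sup>2)"
  proof (rule Bochner_Integration.integrable_bound)
    show "integrable (lebesgue_on S) (\<lambda>t. 2 * (cmod (f t))\<^sup>2 + 2 * (cmod (g t))\<^sup>2)"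
      using L2_integrable[OF assms(1)] L2_integrable[OF assms(2)] by auto
    have "(cmod (a + b))\<^sup>2 \<le> 2 * (cmod a)\<^sup>2 + 2 * (cmod b)\<^sup>2" for a b
    proof -
      have "(cmod (a + b))\<^sup>2 \<le> (cmod a + cmod b)\<^sup>2" by (intro power_mono norm_triangle_ineq) simp
      also have "\<dots> \<le> 2 * (cmod a)\<^sup>2 + 2 * (cmod b)\<^sup>2"
        using sum_squares_bound[of "cmod a" "cmod b"] by (simp add: power2_sum)
      finally show ?thesis .
    qed
    then show "AE t in lebesgue_on S. norm ((cmod (f t + g t))\<^sup>2) \<le> norm (2 * (cmod (f t))\<^sup>2 + 2 * (cmod (g t))\<^sup>2)"
      by (intro AE_I2) simp
  qed measurable
  then show ?thesis unfolding L2_def by simp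
qed

lemma L2_diff: "f \<in> L2 S \<Longrightarrow> g \<in> L2 S \<Longrightarrow> (\<lambda>t. f t - g t) \<in> L2 S"
  using L2_add[of f S "\<lambda>t. - 1 * g t"] L2_scale[of g S "- 1"] by simp

lemma L2_sum: "(\<And>i. i \<in> I \<Longrightarrow> f i \<in> L2 S) \<Longrightarrow> (\<lambda>t. \<Sum>i\<in>I. c i * f i t) \<in> L2 S"
proof (induction I rule: infinite_finite_induct)
  case (insert i I)
  then show ?case using L2_add[OF L2_scale[of "f i" S "c i"], of "\<lambda>t. \<Sum>i\<in>I. c i * f i t"] by simp
qed (simp_all add: L2_zero)

lemma
  assumes "f \<in> L2 S" "g \<in> L2 S"
  shows L2_inner_integrable: "integrable (lebesgue_on S) (\<lambda>t. f t * cnj (g t))"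
    and L2_Cauchy_Schwarz: "cmod (L2_inner S f g) \<le> L2_nrm S f * L2_nrm S g"
proof -
  note [measurable] = L2_measurable[OF assms(1)] L2_measurable[OF assms(2)]
  note sq = L2_integrable[OF assms(1)] L2_integrable[OF assms(2)]
  have int: "integrable (lebesgue_on S) (\<lambda>t. cmod (f t) * cmod (g t))"
    by (rule integrable_mult_square_integrable[OF _ _ sq]) measurable
  show "integrable (lebesgue_on S) (\<lambda>t. f t * cnj (g t))"
    by (rule Bochner_Integration.integrable_bound[OF int]) (auto simp: norm_mult)
  have "cmod (L2_inner S f g) \<le> (LINT t|lebesgue_on S. cmod (f t) * cmod (g t))"
    unfolding L2_inner_def by (rule order_trans[OF integral_norm_bound]) (simp add: norm_mult)
  then have "(cmod (L2_inner S f g))\<^sup>2 \<le> (LINT t|lebesgue_on S. cmod (f t) * cmod (g t))\<^sup>2"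
    by (rule power_mono) simp
  also have "\<dots> \<le> (L2_nrm S f * L2_nrm S g)\<^sup>2"
    unfolding power_mult_distrib L2_nrm_square by (rule integral_Cauchy_Schwarz[OF _ _ sq]) measurable
  finally show "cmod (L2_inner S f g) \<le> L2_nrm S f * L2_nrm S g"
    by (rule power2_le_imp_le) (simp add: L2_nrm_nonneg)
qed

lemma L2_inner_commute: "L2_inner S g f = cnj (L2_inner S f g)"
  unfolding L2_inner_def by (subst Bochner_Integration.integral_cnj[symmetric]) (simp add: mult.commute)

lemma L2_inner_self: "L2_inner S f f = of_real ((L2_nrm S f)\<^sup>2)"
  unfolding L2_inner_def L2_nrm_square integral_complex_of_real[symmetric] complex_norm_square ..

lemma L2_inner_sum_left:
  assumes "\<And>i. i \<in> I \<Longrightarrow> f i \<in> L2 S" "g \<in> L2 S"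
  shows "L2_inner S (\<lambda>t. \<Sum>i\<in>I. c i * f i t) g = (\<Sum>i\<in>I. c i * L2_inner S (f i) g)"
proof -
  have "L2_inner S (\<lambda>t. \<Sum>i\<in>I. c i * f i t) g = (LINT t|lebesgue_on S. (\<Sum>i\<in>I. c i * (f i t * cnj (g t))))"
    unfolding L2_inner_def by (simp add: sum_distrib_right mult.assoc)
  also have "\<dots> = (\<Sum>i\<in>I. LINT t|lebesgue_on S. c i * (f i t * cnj (g t)))"
    by (rule Bochner_Integration.integral_sum) (intro integrable_mult_right L2_inner_integrable assms)
  finally show ?thesis by (simp add: L2_inner_def)
qed

lemma L2_inner_sum_right:
  assumes "\<And>i. i \<in> I \<Longrightarrow> f i \<in> L2 S" "g \<in> L2 S"
  shows "L2_inner S g (\<lambda>t. \<Sum>i\<in>I. c i * f i t) = (\<Sum>i\<in>I. cnj (c i) * L2_inner S g (f i))"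
proof -
  have "L2_inner S g (\<lambda>t. \<Sum>i\<in>I. c i * f i t) = cnj (L2_inner S (\<lambda>t. \<Sum>i\<in>I. c i * f i t) g)"
    by (rule L2_inner_commute)
  also have "\<dots> = (\<Sum>i\<in>I. cnj (c i) * cnj (L2_inner S (f i) g))"
    by (simp add: L2_inner_sum_left[OF assms])
  also have "\<dots> = (\<Sum>i\<in>I. cnj (c i) * L2_inner S g (f i))"
    by (simp only: L2_inner_commute[symmetric])
  finally show ?thesis .
qed

lemma L2_inner_diff_left:
  assumes "f \<in> L2 S" "g \<in> L2 S" "h \<in> L2 S"
  shows "L2_inner S (\<lambda>t. f t - g t) h = L2_inner S f h - L2_inner S g h"
  unfolding L2_inner_def left_diff_distrib
  by (rule Bochner_Integration.integral_diff) (intro L2_inner_integrable assms)+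

lemma L2_nrm_diff_square:
  assumes "f \<in> L2 S" "g \<in> L2 S"
  shows "(L2_nrm S (\<lambda>t. f t - g t))\<^sup>2 = (L2_nrm S f)\<^sup>2 - 2 * Re (L2_inner S f g) + (L2_nrm S g)\<^sup>2"
proof -
  have pt: "(cmod (f t - g t))\<^sup>2 = (cmod (f t))\<^sup>2 - 2 * Re (f t * cnj (g t)) + (cmod (g t))\<^sup>2" for t
    unfolding cmod_power2 by (simp add: power2_eq_square algebra_simps)
  define r where "r t = Re (f t * cnj (g t))" for t
  have r: "integrable (lebesgue_on S) r" "Re (L2_inner S f g) = (LINT t|lebesgue_on S. r t)"
    unfolding L2_inner_def r_def[abs_def] using L2_inner_integrable[OF assms]
    by (rule integrable_Re, rule integral_Re[symmetric])
  show ?thesis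
    unfolding L2_nrm_square pt r(2) r_def[symmetric]
    using r(1) L2_integrable[OF assms(1)] L2_integrable[OF assms(2)] by simp
qed

lemma L2_nrm_diff_commute: "L2_nrm S (\<lambda>t. f t - g t) = L2_nrm S (\<lambda>t. g t - f t)"
  by (simp add: L2_nrm_def norm_minus_commute)

lemma L2_nrm_triangle_diff:
  assumes "f \<in> L2 S" "g \<in> L2 S"
  shows "L2_nrm S (\<lambda>t. f t - g t) \<le> L2_nrm S f + L2_nrm S g"
proof -
  have "- Re (L2_inner S f g) \<le> L2_nrm S f * L2_nrm S g"
    using L2_Cauchy_Schwarz[OF assms] abs_Re_le_cmod[of "L2_inner S f g"] by linarith
  then have "(L2_nrm S (\<lambda>t. f t - g t))\<^sup>2 \<le> (L2_nrm S f + L2_nrm S g)\<^sup>2"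
    unfolding L2_nrm_diff_square[OF assms] by (simp add: power2_sum)
  then show ?thesis by (rule power2_le_imp_le) (simp add: L2_nrm_nonneg)
qed

lemma L2_nrm_triangle:
  assumes "f \<in> L2 S" "g \<in> L2 S" "h \<in> L2 S"
  shows "L2_nrm S (\<lambda>t. f t - h t) \<le> L2_nrm S (\<lambda>t. f t - g t) + L2_nrm S (\<lambda>t. g t - h t)"
proof -
  have "L2_nrm S (\<lambda>t. (f t - g t) - (h t - g t)) \<le> L2_nrm S (\<lambda>t. f t - g t) + L2_nrm S (\<lambda>t. h t - g t)"
    by (intro L2_nrm_triangle_diff L2_diff assms)
  then show ?thesis by (simp add: L2_nrm_diff_commute[of S h g])
qed

lemma abs_L2_nrm_diff_le:
  assumes "f \<in> L2 S" "g \<in> L2 S"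
  shows "\<bar>L2_nrm S f - L2_nrm S g\<bar> \<le> L2_nrm S (\<lambda>t. f t - g t)"
proof -
  have "L2_nrm S (\<lambda>t. f t - 0) \<le> L2_nrm S (\<lambda>t. f t - g t) + L2_nrm S (\<lambda>t. g t - 0)"
    "L2_nrm S (\<lambda>t. g t - 0) \<le> L2_nrm S (\<lambda>t. g t - f t) + L2_nrm S (\<lambda>t. f t - 0)"
    by (intro L2_nrm_triangle assms L2_zero)+
  then show ?thesis using L2_nrm_diff_commute[of S f g] by simp
qed

lemma measurable_lebesgue_on_iff:
  fixes f :: "'a::euclidean_space \<Rightarrow> complex"
  assumes "S \<in> sets lebesgue"
  shows "f \<in> borel_measurable (lebesgue_on S) \<longleftrightarrow> (\<lambda>t. indicator S t * f t) \<in> borel_measurable lebesgue"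
proof -
  have "(\<lambda>t. indicator S t *\<^sub>R f t) = (\<lambda>t. indicator S t * f t)" by (auto simp: indicator_def)
  then show ?thesis using borel_measurable_restrict_space_iff[of S lebesgue f] assms by simp
qed

lemma
  fixes f :: "'a::euclidean_space \<Rightarrow> complex"
  assumes S: "S \<in> sets lebesgue"
  shows L2_inner_expo_eq_ft: "L2_inner S f (expo l) = ft (\<lambda>t. indicator S t * f t) l"
    and L2_nrm_square_indicator: "(L2_nrm S f)\<^sup>2 = (LINT t|lebesgue. (cmod (indicator S t * f t))\<^sup>2)"
proof -
  have "L2_inner S f (expo l) = (LINT t|lebesgue. indicator S t *\<^sub>R (f t * cnj (expo l t)))"
    unfolding L2_inner_def by (rule integral_restrict_space) (use S in simp)
  also have "\<dots> = ft (\<lambda>t. indicator S t * f t) l"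
    unfolding ft_def by (rule Bochner_Integration.integral_cong) (auto simp: indicator_def)
  finally show "L2_inner S f (expo l) = ft (\<lambda>t. indicator S t * f t) l" .
  have "(L2_nrm S f)\<^sup>2 = (LINT t|lebesgue. indicator S t *\<^sub>R (cmod (f t))\<^sup>2)"
    unfolding L2_nrm_square by (rule integral_restrict_space) (use S in simp)
  also have "\<dots> = (LINT t|lebesgue. (cmod (indicator S t * f t))\<^sup>2)"
    by (rule Bochner_Integration.integral_cong) (auto simp: indicator_def)
  finally show "(L2_nrm S f)\<^sup>2 = (LINT t|lebesgue. (cmod (indicator S t * f t))\<^sup>2)" .
qed

lemma L2_bounded:
  assumes S: "S \<in> lmeasurable" and f: "f \<in> borel_measurable (lebesgue_on S)" "\<And>t. cmod (f t) \<le> C"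
  shows "f \<in> L2 S"
proof -
  interpret finite_measure "lebesgue_on S" by (rule finite_measure_lebesgue_on[OF S])
  have "integrable (lebesgue_on S) (\<lambda>t. (cmod (f t))\<^sup>2)"
  proof (rule integrable_const_bound[of _ "C\<^sup>2"])
    show "AE t in lebesgue_on S. norm ((cmod (f t))\<^sup>2) \<le> C\<^sup>2" using f(2) by (auto intro!: AE_I2 power_mono)
  qed (use f(1) in measurable)
  then show ?thesis using f(1) by (simp add: L2_def)
qed

lemma borel_measurable_lebesgue_on: "f \<in> borel_measurable lebesgue \<Longrightarrow> f \<in> borel_measurable (lebesgue_on S)"
  by (rule measurable_restrict_space1)

lemma expo_L2:
  assumes "S \<in> lmeasurable"
  shows "expo l \<in> L2 S"
  by (rule L2_bounded[OF assms, of _ 1]) (simp_all add: borel_measurable_lebesgue_on borel_measurable_lebesgue_expo)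

lemma trig_L2: "S \<in> lmeasurable \<Longrightarrow> (\<lambda>t. \<Sum>l\<in>F. c l * expo l t) \<in> L2 S"
  by (rule L2_sum) (rule expo_L2)

lemma L2_expo_mult:
  assumes "f \<in> L2 S"
  shows "(\<lambda>t. expo y t * f t) \<in> L2 S" and "L2_nrm S (\<lambda>t. expo y t * f t) = L2_nrm S f"
proof -
  have "expo y \<in> borel_measurable (lebesgue_on S)"
    by (simp add: borel_measurable_lebesgue_on borel_measurable_lebesgue_expo)
  then show "(\<lambda>t. expo y t * f t) \<in> L2 S"
    using assms by (auto simp: L2_def norm_mult intro: borel_measurable_times)
  show "L2_nrm S (\<lambda>t. expo y t * f t) = L2_nrm S f"
    by (simp add: L2_nrm_def norm_mult)
qed

text \<open>The function is cut off where its modulus or the norm of its argument exceeds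
  \<open>n\<close>. The approximant is bounded and vanishes everywhere outside
  \<open>S \<inter> ball 0 \<rho>\<close>, as the tail estimate over separated sets demands.\<close>

lemma L2_dense_bounded:
  fixes f :: "'a::euclidean_space \<Rightarrow> complex"
  assumes S: "S \<in> sets lebesgue" and f: "f \<in> L2 S" and e: "e > 0"
  obtains h C \<rho> where "h \<in> borel_measurable lebesgue" "\<And>t. cmod (h t) \<le> C" "\<And>t. t \<notin> S \<inter> ball 0 \<rho> \<Longrightarrow> h t = 0"
    "h \<in> L2 S" "L2_nrm S (\<lambda>t. f t - h t) < e"
proof -
  define f' where "f' t = indicator S t * f t" for t
  have f'm [measurable]: "f' \<in> borel_measurable lebesgue"
    unfolding f'_def[abs_def] using L2_measurable[OF f] measurable_lebesgue_on_iff[OF S] by blast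
  define h where "h n t = (if cmod (f' t) \<le> real n then f' t else 0) * indicator (ball 0 (real n)) t" for n t
  have [measurable]: "ball x r \<in> sets lebesgue" for x :: 'a and r by simp
  have hm: "h n \<in> borel_measurable lebesgue" for n unfolding h_def[abs_def] by measurable
  note fm [measurable] = L2_measurable[OF f]
  have hm' [measurable]: "h n \<in> borel_measurable (lebesgue_on S)" for n
    by (rule borel_measurable_lebesgue_on[OF hm])
  have hle: "cmod (h n t) \<le> cmod (f t)" for n t by (auto simp: h_def f'_def indicator_def)
  have fle: "cmod (f t - h n t) \<le> cmod (f t)" if "t \<in> S" for n t
    using that by (auto simp: h_def f'_def indicator_def)
  have hL: "h n \<in> L2 S" for n
  proof -
    have "integrable (lebesgue_on S) (\<lambda>t. (cmod (h n t))\<^sup>2)"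
      by (rule Bochner_Integration.integrable_bound[OF L2_integrable[OF f]])
        (use hle in \<open>auto intro!: AE_I2 power_mono\<close>)
    then show ?thesis by (simp add: L2_def hm')
  qed
  have "(\<lambda>n. LINT t|lebesgue_on S. (cmod (f t - h n t))\<^sup>2) \<longlonglongrightarrow> (LINT t|lebesgue_on S. 0)"
  proof (rule integral_dominated_convergence[where w = "\<lambda>t. (cmod (f t))\<^sup>2"])
    show "integrable (lebesgue_on S) (\<lambda>t. (cmod (f t))\<^sup>2)" by (rule L2_integrable[OF f])
    show "AE t in lebesgue_on S. (\<lambda>n. (cmod (f t - h n t))\<^sup>2) \<longlonglongrightarrow> 0"
    proof (rule AE_I2)
      fix t assume "t \<in> space (lebesgue_on S)"
      then have t: "t \<in> S" by (simp add: space_restrict_space)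
      obtain N :: nat where N: "max (cmod (f t)) (norm t) < N" using reals_Archimedean2 by blast
      have "(cmod (f t - h n t))\<^sup>2 = 0" if "n \<ge> N" for n
        using N that t by (auto simp: h_def f'_def indicator_def)
      then have "eventually (\<lambda>n. (cmod (f t - h n t))\<^sup>2 = 0) sequentially" by (auto simp: eventually_sequentially)
      then show "(\<lambda>n. (cmod (f t - h n t))\<^sup>2) \<longlonglongrightarrow> 0" by (rule tendsto_eventually)
    qed
    show "AE t in lebesgue_on S. norm ((cmod (f t - h n t))\<^sup>2) \<le> (cmod (f t))\<^sup>2" for n
      using fle by (intro AE_I2) (auto simp: space_restrict_space intro!: power_mono)
  qed measurable
  then have "(\<lambda>n. (L2_nrm S (\<lambda>t. f t - h n t))\<^sup>2) \<longlonglongrightarrow> 0" unfolding L2_nrm_square by simp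
  then have "eventually (\<lambda>n. (L2_nrm S (\<lambda>t. f t - h n t))\<^sup>2 < e\<^sup>2) sequentially"
    by (rule order_tendstoD(2)) (use e in simp)
  then obtain n where "(L2_nrm S (\<lambda>t. f t - h n t))\<^sup>2 < e\<^sup>2" by (auto simp: eventually_sequentially)
  then have small: "L2_nrm S (\<lambda>t. f t - h n t) < e" by (rule power2_less_imp_less) (use e in simp)
  show ?thesis
  proof (rule that[of "h n" "real n" "real n"])
    show "cmod (h n t) \<le> real n" for t by (simp add: h_def indicator_def)
    fix t assume "t \<notin> S \<inter> ball 0 (real n)"
    then show "h n t = 0" unfolding h_def f'_def by (cases "t \<in> S") simp_all
  qed (rule hm, rule hL, rule small)
qed


section \<open>Bessel bounds, completeness and synthesis\<close>

abbreviation trig :: "'a::euclidean_space set \<Rightarrow> ('a \<Rightarrow> complex) \<Rightarrow> 'a \<Rightarrow> complex" where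
  "trig F c t \<equiv> (\<Sum>l\<in>F. c l * expo l t)"

text \<open>By duality this is the same as the Bessel inequality with constant \<open>B\<close>; it
  is the upper half that frames and Riesz sequences have in common, in finite terms.\<close>

definition synthesis_bound :: "'a::euclidean_space set \<Rightarrow> 'a set \<Rightarrow> real \<Rightarrow> bool" where
  "synthesis_bound S \<Lambda> B \<longleftrightarrow>
     (\<forall>F c. finite F \<and> F \<subseteq> \<Lambda> \<longrightarrow> (L2_nrm S (trig F c))\<^sup>2 \<le> B * (\<Sum>l\<in>F. (cmod (c l))\<^sup>2))"

lemma le_if_square_le_mult:
  fixes x y :: real
  assumes "x\<^sup>2 \<le> y * x" "0 \<le> x" "0 \<le> y"
  shows "x \<le> y"
  using assms by (cases "x = 0") (auto simp: power2_eq_square)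

text \<open>The squared norm of a sum g is the sum of c_l <e_l, g>. Cauchy-Schwarz and the Bessel
  inequality for g itself bound its square by the squared norm times the desired right hand side,
  and one factor cancels.\<close>

lemma synthesis_bound_if_bessel:
  assumes S: "S \<in> lmeasurable" and "B \<ge> 0"
    and bessel: "\<And>f F. f \<in> L2 S \<Longrightarrow> finite F \<Longrightarrow> F \<subseteq> \<Lambda> \<Longrightarrow>
      (\<Sum>l\<in>F. (cmod (L2_inner S f (expo l)))\<^sup>2) \<le> B * (L2_nrm S f)\<^sup>2"
  shows "synthesis_bound S \<Lambda> B"
  unfolding synthesis_bound_def
proof (intro allI impI)
  fix F and c :: "'a \<Rightarrow> complex"
  assume F: "finite F \<and> F \<subseteq> \<Lambda>"
  define n where "n = (L2_nrm S (trig F c))\<^sup>2"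
  define K where "K = (\<Sum>l\<in>F. (cmod (c l))\<^sup>2)"
  have "complex_of_real n = L2_inner S (trig F c) (trig F c)"
    unfolding n_def by (rule L2_inner_self[symmetric])
  also have "\<dots> = (\<Sum>l\<in>F. c l * L2_inner S (expo l) (trig F c))"
    by (rule L2_inner_sum_left) (intro expo_L2 trig_L2 S)+
  finally have "complex_of_real n = (\<Sum>l\<in>F. c l * L2_inner S (expo l) (trig F c))" .
  then have "n\<^sup>2 = (cmod (\<Sum>l\<in>F. c l * L2_inner S (expo l) (trig F c)))\<^sup>2"
    using norm_of_real[of n, where 'a = complex] by simp
  also have "\<dots> \<le> K * (\<Sum>l\<in>F. (cmod (L2_inner S (expo l) (trig F c)))\<^sup>2)"
    unfolding K_def by (rule complex_Cauchy_Schwarz_sum)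
  also have "(\<Sum>l\<in>F. (cmod (L2_inner S (expo l) (trig F c)))\<^sup>2) = (\<Sum>l\<in>F. (cmod (L2_inner S (trig F c) (expo l)))\<^sup>2)"
    by (subst L2_inner_commute) simp
  also have "K * \<dots> \<le> K * (B * n)"
    unfolding n_def K_def using F by (intro mult_left_mono bessel trig_L2 S sum_nonneg) auto
  finally have "n\<^sup>2 \<le> B * K * n" by (simp add: mult_ac)
  then have "n \<le> B * K"
    by (rule le_if_square_le_mult) (use \<open>B \<ge> 0\<close> in \<open>auto simp: n_def K_def sum_nonneg\<close>)
  then show "(L2_nrm S (trig F c))\<^sup>2 \<le> B * (\<Sum>l\<in>F. (cmod (c l))\<^sup>2)" by (simp add: n_def K_def)
qed

lemma L2_inner_trig_coefficients:
  assumes S: "S \<in> lmeasurable" and f: "f \<in> L2 S"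
  shows "L2_inner S f (trig F (\<lambda>l. of_real a * L2_inner S f (expo l)))
     = of_real (a * (\<Sum>l\<in>F. (cmod (L2_inner S f (expo l)))\<^sup>2))"
proof -
  have "L2_inner S f (trig F (\<lambda>l. of_real a * L2_inner S f (expo l)))
    = (\<Sum>l\<in>F. cnj (of_real a * L2_inner S f (expo l)) * L2_inner S f (expo l))"
    by (rule L2_inner_sum_right) (intro expo_L2 S f)+
  also have "\<dots> = (\<Sum>l\<in>F. of_real (a * (cmod (L2_inner S f (expo l)))\<^sup>2))"
    unfolding of_real_mult complex_norm_square by (simp add: mult_ac)
  finally show ?thesis by (simp add: sum_distrib_left)
qed

text \<open>The same duality, tested on the sum whose coefficients are those of
  \<open>f\<close>.\<close>

lemma bessel_if_synthesis_bound:
  assumes S: "S \<in> lmeasurable" and "B \<ge> 0" and syn: "synthesis_bound S \<Lambda> B"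
    and f: "f \<in> L2 S" and F: "finite F" "F \<subseteq> \<Lambda>"
  shows "(\<Sum>l\<in>F. (cmod (L2_inner S f (expo l)))\<^sup>2) \<le> B * (L2_nrm S f)\<^sup>2"
proof -
  define s where "s = (\<Sum>l\<in>F. (cmod (L2_inner S f (expo l)))\<^sup>2)"
  define g where "g = trig F (\<lambda>l. of_real 1 * L2_inner S f (expo l))"
  have inner: "L2_inner S f g = of_real s"
    unfolding g_def using L2_inner_trig_coefficients[OF S f, where F = F and a = 1] by (simp add: s_def)
  have "g \<in> L2 S" unfolding g_def by (rule trig_L2[OF S])
  from L2_Cauchy_Schwarz[OF f this] have "s \<le> L2_nrm S f * L2_nrm S g" unfolding inner by simp
  then have "s\<^sup>2 \<le> (L2_nrm S f * L2_nrm S g)\<^sup>2" by (rule power_mono) (simp add: s_def sum_nonneg)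
  also have "\<dots> \<le> (L2_nrm S f)\<^sup>2 * (B * s)"
    unfolding power_mult_distrib g_def s_def using syn F
    by (intro mult_left_mono) (auto simp: synthesis_bound_def norm_mult)
  finally have "s\<^sup>2 \<le> B * (L2_nrm S f)\<^sup>2 * s" by (simp add: mult_ac)
  then have "s \<le> B * (L2_nrm S f)\<^sup>2"
    by (rule le_if_square_le_mult) (use \<open>B \<ge> 0\<close> in \<open>auto simp: s_def sum_nonneg\<close>)
  then show ?thesis by (simp add: s_def)
qed

lemma trig_add:
  assumes "finite F" "finite G"
  shows "trig F c t + trig G d t = trig (F \<union> G) (\<lambda>l. (if l \<in> F then c l else 0) + (if l \<in> G then d l else 0)) t"
proof -
  have ext: "trig H e t = trig (F \<union> G) (\<lambda>l. if l \<in> H then e l else 0) t" if "H \<subseteq> F \<union> G" for H e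
  proof -
    have "trig (F \<union> G) (\<lambda>l. if l \<in> H then e l else 0) t = trig H (\<lambda>l. if l \<in> H then e l else 0) t"
      using assms that by (intro sum.mono_neutral_right) auto
    then show ?thesis by simp
  qed
  show ?thesis
    unfolding ext[of F c, OF Un_upper1] ext[of G d, OF Un_upper2] sum.distrib[symmetric]
    by (simp add: distrib_right)
qed

text \<open>The relaxed frame iteration: subtracting \<open>B\<^sup>-\<^sup>1\<close> times the frame operator, restricted to
  finitely many frequencies, contracts the norm by a fixed factor.\<close>

lemma exp_complete_if_lower_bound:
  assumes S: "S \<in> lmeasurable" and a: "0 < a" "a \<le> B" and syn: "synthesis_bound S \<Lambda> B"
    and lower: "\<And>f. f \<in> L2 S \<Longrightarrow>
      \<exists>F. finite F \<and> F \<subseteq> \<Lambda> \<and> a * (L2_nrm S f)\<^sup>2 \<le> (\<Sum>l\<in>F. (cmod (L2_inner S f (expo l)))\<^sup>2)"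
  shows "exp_complete S \<Lambda>"
  unfolding exp_complete_def
proof (intro ballI allI impI)
  fix f and \<epsilon> :: real
  assume f: "f \<in> L2 S" and "\<epsilon> > 0"
  have B: "B > 0" using a by simp
  define q where "q = 1 - a / B"
  have q: "0 \<le> q" "q < 1" using a B by (auto simp: q_def)
  have step: "\<exists>F c. finite F \<and> F \<subseteq> \<Lambda> \<and> (L2_nrm S (\<lambda>t. h t - trig F c t))\<^sup>2 \<le> q * (L2_nrm S h)\<^sup>2"
    if h: "h \<in> L2 S" for h
  proof -
    obtain F where F: "finite F" "F \<subseteq> \<Lambda>" "a * (L2_nrm S h)\<^sup>2 \<le> (\<Sum>l\<in>F. (cmod (L2_inner S h (expo l)))\<^sup>2)"
      using lower[OF h] by blast
    define s where "s = (\<Sum>l\<in>F. (cmod (L2_inner S h (expo l)))\<^sup>2)"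
    \<comment> \<open>In the square of the difference, the cross term contributes
      \<open>- 2 * s / B\<close> and the norm of the sum at most \<open>s / B\<close>.\<close>
    define c where "c = (\<lambda>l. of_real (1 / B) * L2_inner S h (expo l))"
    have "L2_inner S h (trig F c) = of_real (1 / B * s)"
      unfolding c_def s_def by (rule L2_inner_trig_coefficients[OF S h])
    then have "Re (L2_inner S h (trig F c)) = s / B" by simp
    moreover have "(L2_nrm S (trig F c))\<^sup>2 \<le> s / B"
    proof -
      have "(L2_nrm S (trig F c))\<^sup>2 \<le> B * (\<Sum>l\<in>F. (cmod (c l))\<^sup>2)"
        using syn F by (simp add: synthesis_bound_def)
      also have "(\<Sum>l\<in>F. (cmod (c l))\<^sup>2) = s / B\<^sup>2"
        by (simp add: c_def s_def norm_mult norm_divide power_divide sum_divide_distrib)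
      finally show ?thesis using B by (simp add: power2_eq_square)
    qed
    ultimately have "(L2_nrm S (\<lambda>t. h t - trig F c t))\<^sup>2 \<le> (L2_nrm S h)\<^sup>2 - s / B"
      unfolding L2_nrm_diff_square[OF h trig_L2[OF S]] by simp
    also have "\<dots> \<le> q * (L2_nrm S h)\<^sup>2"
      using F(3) B unfolding q_def s_def[symmetric] by (simp add: field_simps)
    finally show ?thesis using F by blast
  qed
  have iter: "\<exists>F c. finite F \<and> F \<subseteq> \<Lambda> \<and> (L2_nrm S (\<lambda>t. f t - trig F c t))\<^sup>2 \<le> q ^ n * (L2_nrm S f)\<^sup>2" for n
  proof (induction n)
    case 0
    show ?case by (intro exI[of _ "{}"]) simp
  next
    case (Suc n)
    then obtain F c where F: "finite F" "F \<subseteq> \<Lambda>"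
      and le: "(L2_nrm S (\<lambda>t. f t - trig F c t))\<^sup>2 \<le> q ^ n * (L2_nrm S f)\<^sup>2" by blast
    have h: "(\<lambda>t. f t - trig F c t) \<in> L2 S" by (intro L2_diff f trig_L2 S)
    obtain G d where G: "finite G" "G \<subseteq> \<Lambda>"
      and le2: "(L2_nrm S (\<lambda>t. (f t - trig F c t) - trig G d t))\<^sup>2 \<le> q * (L2_nrm S (\<lambda>t. f t - trig F c t))\<^sup>2"
      using step[OF h] by blast
    define e where "e = (\<lambda>l. (if l \<in> F then c l else 0) + (if l \<in> G then d l else 0))"
    have eq: "(\<lambda>t. f t - trig (F \<union> G) e t) = (\<lambda>t. (f t - trig F c t) - trig G d t)"
      unfolding e_def trig_add[OF F(1) G(1), symmetric] by (simp add: algebra_simps)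
    have "(L2_nrm S (\<lambda>t. f t - trig (F \<union> G) e t))\<^sup>2 \<le> q * (q ^ n * (L2_nrm S f)\<^sup>2)"
      unfolding eq using le2 mult_left_mono[OF le q(1)] by linarith
    then show ?case using F G by (intro exI[of _ "F \<union> G"] exI[of _ e]) (simp add: mult.assoc)
  qed
  have "(\<lambda>n. q ^ n * (L2_nrm S f)\<^sup>2) \<longlonglongrightarrow> 0"
    using q by (intro tendsto_mult_left_zero LIMSEQ_power_zero) auto
  then have "eventually (\<lambda>n. q ^ n * (L2_nrm S f)\<^sup>2 < \<epsilon>\<^sup>2) sequentially"
    by (rule order_tendstoD) (use \<open>\<epsilon> > 0\<close> in simp)
  then obtain n where n: "q ^ n * (L2_nrm S f)\<^sup>2 < \<epsilon>\<^sup>2" by (auto simp: eventually_sequentially)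
  obtain F c where F: "finite F" "F \<subseteq> \<Lambda>" "(L2_nrm S (\<lambda>t. f t - trig F c t))\<^sup>2 \<le> q ^ n * (L2_nrm S f)\<^sup>2"
    using iter[of n] by blast
  have "L2_nrm S (\<lambda>t. f t - trig F c t) < \<epsilon>"
    by (rule power2_less_imp_less) (use F(3) n \<open>\<epsilon> > 0\<close> in auto)
  then show "\<exists>F c. finite F \<and> F \<subseteq> \<Lambda> \<and> L2_nrm S (\<lambda>t. f t - trig F c t) < \<epsilon>" using F by blast
qed

text \<open>Geometric decay makes the successive differences summable in L^1, since S has finite
  measure; hence the sequence converges almost everywhere, and Fatou's lemma carries the L^2 bounds
  over to the limit.\<close>

lemma L2_Riesz_Fischer_geometric:
  fixes s :: "nat \<Rightarrow> 'a::euclidean_space \<Rightarrow> complex"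
  assumes S: "S \<in> lmeasurable" and s: "\<And>n. s n \<in> L2 S"
    and cauchy: "\<And>m n. n \<le> m \<Longrightarrow> L2_nrm S (\<lambda>t. s m t - s n t) \<le> C * (1 / 2) ^ n"
  shows "\<exists>g. g \<in> L2 S \<and> (\<forall>n. L2_nrm S (\<lambda>t. g t - s n t) \<le> C * (1 / 2) ^ n)"
proof -
  let ?M = "lebesgue_on S"
  interpret finite_measure ?M by (rule finite_measure_lebesgue_on[OF S])
  have sm [measurable]: "s n \<in> borel_measurable ?M" for n by (rule L2_measurable[OF s])
  have C: "C \<ge> 0" using cauchy[of 0 0] L2_nrm_nonneg[of S "\<lambda>t. s 0 t - s 0 t"] by simp
  define D where "D n t = s (Suc n) t - s n t" for n t
  have DL: "D n \<in> L2 S" for n unfolding D_def[abs_def] by (intro L2_diff s)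
  have Dm [measurable]: "D n \<in> borel_measurable ?M" for n by (rule L2_measurable[OF DL])
  define K where "K = sqrt (measure ?M (space ?M)) * C"
  have K: "K \<ge> 0" using C by (simp add: K_def)
  have L1: "(\<integral>\<^sup>+t. ennreal (cmod (D n t)) \<partial>?M) \<le> ennreal (K * (1 / 2) ^ n)" for n
  proof -
    have one: "integrable ?M (\<lambda>t. (1::real)\<^sup>2)" by simp
    have sq: "integrable ?M (\<lambda>t. (cmod (D n t))\<^sup>2)" by (rule L2_integrable[OF DL])
    have int: "integrable ?M (\<lambda>t. 1 * cmod (D n t))"
      by (rule integrable_mult_square_integrable[OF _ _ one sq]) measurable
    have "(LINT t|?M. 1 * cmod (D n t))\<^sup>2 \<le> (LINT t|?M. (1::real)\<^sup>2) * (LINT t|?M. (cmod (D n t))\<^sup>2)"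
      by (rule integral_Cauchy_Schwarz[OF _ _ one sq]) measurable
    also have "\<dots> = (sqrt (measure ?M (space ?M)) * L2_nrm S (D n))\<^sup>2"
      by (simp add: power_mult_distrib L2_nrm_square)
    finally have "(LINT t|?M. 1 * cmod (D n t)) \<le> sqrt (measure ?M (space ?M)) * L2_nrm S (D n)"
      by (rule power2_le_imp_le) (simp add: L2_nrm_nonneg)
    also have "\<dots> \<le> K * (1 / 2) ^ n"
      unfolding K_def mult.assoc using cauchy[of n "Suc n"] by (intro mult_left_mono) (auto simp: D_def[abs_def])
    finally have "(LINT t|?M. cmod (D n t)) \<le> K * (1 / 2) ^ n" by simp
    moreover have "(\<integral>\<^sup>+t. ennreal (cmod (D n t)) \<partial>?M) = ennreal (LINT t|?M. cmod (D n t))"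
      by (rule nn_integral_eq_integral) (use int in auto)
    ultimately show ?thesis by (simp add: ennreal_leI)
  qed
  have "(\<integral>\<^sup>+t. (\<Sum>n. ennreal (cmod (D n t))) \<partial>?M) = (\<Sum>n. \<integral>\<^sup>+t. ennreal (cmod (D n t)) \<partial>?M)"
    by (rule nn_integral_suminf) measurable
  also have "\<dots> \<le> (\<Sum>n. ennreal (K * (1 / 2) ^ n))"
    by (intro suminf_le L1) auto
  also have "\<dots> = ennreal (\<Sum>n. K * (1 / 2) ^ n)"
    using K by (intro suminf_ennreal2 summable_mult) (auto intro: summable_geometric)
  also have "\<dots> < \<infinity>" by simp
  finally have fin: "(\<integral>\<^sup>+t. (\<Sum>n. ennreal (cmod (D n t))) \<partial>?M) \<noteq> \<infinity>" by simp
  have "AE t in ?M. (\<Sum>n. ennreal (cmod (D n t))) \<noteq> \<infinity>"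
    by (rule nn_integral_PInf_AE[OF _ fin]) measurable
  then have conv: "AE t in ?M. convergent (\<lambda>n. s n t)"
  proof eventually_elim
    fix t assume "(\<Sum>n. ennreal (cmod (D n t))) \<noteq> \<infinity>"
    then have "summable (\<lambda>n. cmod (D n t))" by (intro summable_suminf_not_top) auto
    then have "summable (\<lambda>n. D n t)" by (rule summable_norm_cancel)
    then have "convergent (\<lambda>n. \<Sum>k<n. D k t)" by (simp add: summable_iff_convergent)
    moreover have "(\<lambda>n. \<Sum>k<n. D k t) = (\<lambda>n. s n t - s 0 t)"
      unfolding D_def by (intro ext) (rule sum_lessThan_telescope)
    ultimately have "convergent (\<lambda>n. s n t - s 0 t)" by simp
    then have "convergent (\<lambda>n. (s n t - s 0 t) + s 0 t)" by (intro convergent_add convergent_const)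
    then show "convergent (\<lambda>n. s n t)" by simp
  qed
  define g where "g t = lim (\<lambda>n. s n t)" for t
  have gm [measurable]: "g \<in> borel_measurable ?M"
    unfolding g_def[abs_def] by (rule borel_measurable_lim_metric) measurable
  have nn: "(\<integral>\<^sup>+t. ennreal ((cmod (g t - s n t))\<^sup>2) \<partial>?M) \<le> ennreal ((C * (1 / 2) ^ n)\<^sup>2)" for n
  proof -
    have "(\<integral>\<^sup>+t. ennreal ((cmod (g t - s n t))\<^sup>2) \<partial>?M)
      = (\<integral>\<^sup>+t. liminf (\<lambda>m. ennreal ((cmod (s (m + n) t - s n t))\<^sup>2)) \<partial>?M)"
    proof (rule nn_integral_cong_AE)
      show "AE t in ?M. ennreal ((cmod (g t - s n t))\<^sup>2) = liminf (\<lambda>m. ennreal ((cmod (s (m + n) t - s n t))\<^sup>2))"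
        using conv
      proof eventually_elim
        fix t assume "convergent (\<lambda>n. s n t)"
        then have "(\<lambda>m. s m t) \<longlonglongrightarrow> g t" by (simp add: convergent_LIMSEQ_iff g_def)
        then have "(\<lambda>m. s (m + n) t) \<longlonglongrightarrow> g t" by (rule LIMSEQ_ignore_initial_segment)
        then have "(\<lambda>m. ennreal ((cmod (s (m + n) t - s n t))\<^sup>2)) \<longlonglongrightarrow> ennreal ((cmod (g t - s n t))\<^sup>2)"
          by (intro tendsto_ennrealI tendsto_intros)
        then show "ennreal ((cmod (g t - s n t))\<^sup>2) = liminf (\<lambda>m. ennreal ((cmod (s (m + n) t - s n t))\<^sup>2))"
          by (intro lim_imp_Liminf[symmetric]) simp_all
      qed
    qed
    also have "\<dots> \<le> liminf (\<lambda>m. \<integral>\<^sup>+t. ennreal ((cmod (s (m + n) t - s n t))\<^sup>2) \<partial>?M)"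
      by (rule nn_integral_liminf) measurable
    also have "\<dots> \<le> liminf (\<lambda>m::nat. ennreal ((C * (1 / 2) ^ n)\<^sup>2))"
    proof (rule Liminf_mono, rule always_eventually, rule allI)
      fix m
      have "(\<integral>\<^sup>+t. ennreal ((cmod (s (m + n) t - s n t))\<^sup>2) \<partial>?M) = ennreal ((L2_nrm S (\<lambda>t. s (m + n) t - s n t))\<^sup>2)"
        unfolding L2_nrm_square by (rule nn_integral_eq_integral[OF L2_integrable[OF L2_diff[OF s s]]]) simp
      also have "\<dots> \<le> ennreal ((C * (1 / 2) ^ n)\<^sup>2)"
        by (intro ennreal_leI power_mono cauchy L2_nrm_nonneg) simp
      finally show "(\<integral>\<^sup>+t. ennreal ((cmod (s (m + n) t - s n t))\<^sup>2) \<partial>?M) \<le> ennreal ((C * (1 / 2) ^ n)\<^sup>2)" .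
    qed
    also have "\<dots> = ennreal ((C * (1 / 2) ^ n)\<^sup>2)" by (simp add: Liminf_const)
    finally show ?thesis .
  qed
  have int: "integrable ?M (\<lambda>t. (cmod (g t - s n t))\<^sup>2)" for n
  proof (rule integrableI_nonneg)
    show "(\<integral>\<^sup>+t. ennreal ((cmod (g t - s n t))\<^sup>2) \<partial>?M) < \<infinity>"
      using nn[of n] by (rule le_less_trans) simp
  qed auto
  have diff: "(\<lambda>t. g t - s n t) \<in> L2 S" for n using int[of n] by (simp add: L2_def)
  show ?thesis
  proof (intro exI conjI allI)
    show "g \<in> L2 S" using L2_add[OF diff[of 0] s[of 0]] by simp
    fix n
    have "ennreal ((L2_nrm S (\<lambda>t. g t - s n t))\<^sup>2) \<le> ennreal ((C * (1 / 2) ^ n)\<^sup>2)"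
      unfolding L2_nrm_square using nn[of n] nn_integral_eq_integral[OF int[of n]] by simp
    then have "(L2_nrm S (\<lambda>t. g t - s n t))\<^sup>2 \<le> (C * (1 / 2) ^ n)\<^sup>2" by (simp add: ennreal_le_iff)
    then show "L2_nrm S (\<lambda>t. g t - s n t) \<le> C * (1 / 2) ^ n"
      by (rule power2_le_imp_le) (use C in simp)
  qed
qed

text \<open>The unconditional sum is a limit along finite subsets. An increasing sequence of finite
  sets is chosen whose partial sums converge geometrically; the synthesis bound then makes all
  larger finite sets close as well.\<close>

lemma has_L2_exp_sum_exists:
  assumes S: "S \<in> lmeasurable" and "B \<ge> 0" and syn: "synthesis_bound S \<Lambda> B"
    and c: "(\<lambda>l. (cmod (c l))\<^sup>2) summable_on \<Lambda>"
  obtains g where "has_L2_exp_sum S \<Lambda> c g"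
proof -
  let ?T = "\<Sum>\<^sub>\<infinity>l\<in>\<Lambda>. (cmod (c l))\<^sup>2"
  \<comment> \<open>Any two finite sets beyond \<open>X n\<close> have coefficient sums within
    \<open>(1 / 4) ^ n\<close> of each other, and the square root gives the ratio 1/2.\<close>
  have "\<exists>X. finite X \<and> X \<subseteq> \<Lambda> \<and> (\<forall>Y. finite Y \<and> X \<subseteq> Y \<and> Y \<subseteq> \<Lambda> \<longrightarrow> dist (\<Sum>l\<in>Y. (cmod (c l))\<^sup>2) ?T < (1 / 4) ^ n / 2)" for n :: nat
    using tendstoD[OF infsum_tendsto[OF c], of "(1 / 4) ^ n / 2"] unfolding eventually_finite_subsets_at_top by simp
  then have "\<exists>X. \<forall>n::nat. finite (X n) \<and> X n \<subseteq> \<Lambda> \<and> (\<forall>Y. finite Y \<and> X n \<subseteq> Y \<and> Y \<subseteq> \<Lambda> \<longrightarrow> dist (\<Sum>l\<in>Y. (cmod (c l))\<^sup>2) ?T < (1 / 4) ^ n / 2)"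
    by (intro choice allI)
  then obtain X where XX: "\<forall>n::nat. finite (X n) \<and> X n \<subseteq> \<Lambda> \<and> (\<forall>Y. finite Y \<and> X n \<subseteq> Y \<and> Y \<subseteq> \<Lambda> \<longrightarrow> dist (\<Sum>l\<in>Y. (cmod (c l))\<^sup>2) ?T < (1 / 4) ^ n / 2)" ..
  then have X: "finite (X n)" "X n \<subseteq> \<Lambda>" for n by auto
  have near: "dist (\<Sum>l\<in>Y. (cmod (c l))\<^sup>2) ?T < (1 / 4) ^ n / 2" if "finite Y" "X n \<subseteq> Y" "Y \<subseteq> \<Lambda>" for n Y
    using XX that by simp
  \<comment> \<open>Unions make the sets increase, as the geometric estimate compares
    \<open>F m\<close> with \<open>F n\<close> for n \<le> m.\<close>
  define F where "F n = (\<Union>k\<le>n. X k)" for n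
  have F: "finite (F n)" "F n \<subseteq> \<Lambda>" "X n \<subseteq> F n" for n using X by (auto simp: F_def)
  have Fmono: "F n \<subseteq> F m" if "n \<le> m" for m n unfolding F_def by (rule UN_mono) (use that in auto)
  have close: "L2_nrm S (\<lambda>t. trig Y c t - trig (F n) c t) \<le> sqrt B * (1 / 2) ^ n"
    if Y: "finite Y" "F n \<subseteq> Y" "Y \<subseteq> \<Lambda>" for Y n
  proof -
    have eq: "(\<lambda>t. trig Y c t - trig (F n) c t) = trig (Y - F n) c"
      by (intro ext) (rule sum_diff[symmetric, OF Y(1,2)])
    have "(L2_nrm S (trig (Y - F n) c))\<^sup>2 \<le> B * (\<Sum>l\<in>Y - F n. (cmod (c l))\<^sup>2)"
      using syn Y unfolding synthesis_bound_def by (meson Diff_subset finite_Diff order_trans)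
    also have "\<dots> = B * ((\<Sum>l\<in>Y. (cmod (c l))\<^sup>2) - (\<Sum>l\<in>F n. (cmod (c l))\<^sup>2))"
      by (simp only: sum_diff[OF Y(1,2)])
    also have "\<dots> \<le> B * (1 / 4) ^ n"
    proof (rule mult_left_mono[OF _ \<open>B \<ge> 0\<close>])
      have "dist (\<Sum>l\<in>Y. (cmod (c l))\<^sup>2) ?T < (1 / 4) ^ n / 2"
        using near[of Y n] Y F(3)[of n] by auto
      moreover have "dist (\<Sum>l\<in>F n. (cmod (c l))\<^sup>2) ?T < (1 / 4) ^ n / 2" by (rule near) (use F in auto)
      ultimately show "(\<Sum>l\<in>Y. (cmod (c l))\<^sup>2) - (\<Sum>l\<in>F n. (cmod (c l))\<^sup>2) \<le> (1 / 4) ^ n"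
        unfolding dist_real_def abs_less_iff by linarith
    qed
    also have "\<dots> = (sqrt B * (1 / 2) ^ n)\<^sup>2"
      using \<open>B \<ge> 0\<close> by (simp add: power_mult_distrib power_mult[symmetric] mult.commute[of n 2])
        (simp add: power_mult power2_eq_square)
    finally show ?thesis unfolding eq by (rule power2_le_imp_le) (use \<open>B \<ge> 0\<close> in simp)
  qed
  have sL: "trig (F n) c \<in> L2 S" for n by (rule trig_L2[OF S])
  obtain g where g: "g \<in> L2 S" "\<And>n. L2_nrm S (\<lambda>t. g t - trig (F n) c t) \<le> sqrt B * (1 / 2) ^ n"
    using L2_Riesz_Fischer_geometric[OF S sL close[OF F(1) Fmono F(2)]] by blast
  have "((\<lambda>Y. L2_nrm S (\<lambda>t. trig Y c t - g t)) \<longlongrightarrow> 0) (finite_subsets_at_top \<Lambda>)"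
  proof (rule tendstoI)
    fix e :: real assume "e > 0"
    have "(\<lambda>n. 2 * sqrt B * (1 / 2) ^ n) \<longlonglongrightarrow> 0"
      by (intro tendsto_mult_right_zero LIMSEQ_power_zero) simp
    then have "eventually (\<lambda>n. 2 * sqrt B * (1 / 2) ^ n < e) sequentially"
      by (rule order_tendstoD) (rule \<open>e > 0\<close>)
    then obtain n where n: "2 * sqrt B * (1 / 2) ^ n < e" by (auto simp: eventually_sequentially)
    have "dist (L2_nrm S (\<lambda>t. trig Y c t - g t)) 0 < e" if Y: "finite Y" "F n \<subseteq> Y" "Y \<subseteq> \<Lambda>" for Y
    proof -
      have "L2_nrm S (\<lambda>t. trig Y c t - g t) \<le> L2_nrm S (\<lambda>t. trig Y c t - trig (F n) c t) + L2_nrm S (\<lambda>t. trig (F n) c t - g t)"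
        by (intro L2_nrm_triangle trig_L2 S g)
      then show ?thesis
        using close[OF Y] g(2)[of n] n L2_nrm_diff_commute[of S g "trig (F n) c"]
        by (simp add: dist_real_def L2_nrm_nonneg)
    qed
    then show "eventually (\<lambda>Y. dist (L2_nrm S (\<lambda>t. trig Y c t - g t)) 0 < e) (finite_subsets_at_top \<Lambda>)"
      unfolding eventually_finite_subsets_at_top
      by (intro exI[of _ "F n"] conjI allI impI) (simp_all add: F(1,2))
  qed
  then have "has_L2_exp_sum S \<Lambda> c g" unfolding has_L2_exp_sum_def using g(1) by (rule conjI[rotated])
  then show ?thesis by (rule that)
qed

lemma exp_Riesz_sequence_if_finite_bounds:
  assumes S: "S \<in> lmeasurable" and AB: "0 < A" "A \<le> B" and syn: "synthesis_bound S \<Lambda> B"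
    and lower: "\<And>F c. finite F \<Longrightarrow> F \<subseteq> \<Lambda> \<Longrightarrow> A * (\<Sum>l\<in>F. (cmod (c l))\<^sup>2) \<le> (L2_nrm S (trig F c))\<^sup>2"
  shows "exp_Riesz_sequence S \<Lambda>"
  unfolding exp_Riesz_sequence_def
proof (rule exI[of _ A], rule exI[of _ B], intro conjI allI impI)
  fix c assume c: "(\<lambda>l. (cmod (c l))\<^sup>2) summable_on \<Lambda>"
  let ?T = "\<Sum>\<^sub>\<infinity>l\<in>\<Lambda>. (cmod (c l))\<^sup>2"
  have "B \<ge> 0" using AB by simp
  then obtain g where g: "has_L2_exp_sum S \<Lambda> c g" by (rule has_L2_exp_sum_exists[OF S _ syn c])
  then have gL: "g \<in> L2 S" and lim0: "((\<lambda>F. L2_nrm S (\<lambda>t. trig F c t - g t)) \<longlongrightarrow> 0) (finite_subsets_at_top \<Lambda>)"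
    by (auto simp: has_L2_exp_sum_def)
  have "((\<lambda>F. L2_nrm S (trig F c) - L2_nrm S g) \<longlongrightarrow> 0) (finite_subsets_at_top \<Lambda>)"
    by (rule Lim_null_comparison[OF always_eventually lim0]) (use abs_L2_nrm_diff_le[OF trig_L2[OF S] gL] in simp)
  then have lim: "((\<lambda>F. (L2_nrm S (trig F c))\<^sup>2) \<longlongrightarrow> (L2_nrm S g)\<^sup>2) (finite_subsets_at_top \<Lambda>)"
    by (intro tendsto_power) (simp add: LIM_zero_iff)
  have fs: "eventually (\<lambda>F. finite F \<and> F \<subseteq> \<Lambda>) (finite_subsets_at_top \<Lambda>)"
    by (auto simp: eventually_finite_subsets_at_top intro!: exI[of _ "{}"])
  have ev1: "eventually (\<lambda>F. A * (\<Sum>l\<in>F. (cmod (c l))\<^sup>2) \<le> (L2_nrm S (trig F c))\<^sup>2) (finite_subsets_at_top \<Lambda>)"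
    using fs by eventually_elim (use lower in blast)
  have ev2: "eventually (\<lambda>F. (L2_nrm S (trig F c))\<^sup>2 \<le> B * (\<Sum>l\<in>F. (cmod (c l))\<^sup>2)) (finite_subsets_at_top \<Lambda>)"
    using fs by eventually_elim (use syn in \<open>simp add: synthesis_bound_def\<close>)
  have limT: "((\<lambda>F. a * (\<Sum>l\<in>F. (cmod (c l))\<^sup>2)) \<longlongrightarrow> a * ?T) (finite_subsets_at_top \<Lambda>)" for a
    by (intro tendsto_mult_left infsum_tendsto c)
  have "A * ?T \<le> (L2_nrm S g)\<^sup>2"
    by (rule tendsto_le[OF finite_subsets_at_top_neq_bot lim limT ev1])
  moreover have "(L2_nrm S g)\<^sup>2 \<le> B * ?T"
    by (rule tendsto_le[OF finite_subsets_at_top_neq_bot limT lim ev2])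
  ultimately show "\<exists>g. has_L2_exp_sum S \<Lambda> c g \<and> A * ?T \<le> (L2_nrm S g)\<^sup>2 \<and> (L2_nrm S g)\<^sup>2 \<le> B * ?T"
    using g by blast
qed (use AB in auto)

text \<open>For a sequence that is zero off \<open>F\<close> the partial sums are eventually
  constant along the filter, so the representative \<open>g\<close> is at distance 0 from
  \<open>trig F c\<close>.\<close>

lemma exp_Riesz_sequence_imp_finite_bounds:
  assumes S: "S \<in> lmeasurable" and R: "exp_Riesz_sequence S \<Lambda>"
  obtains A B where "0 < A" "A \<le> B" "synthesis_bound S \<Lambda> B"
    "\<And>F c. finite F \<Longrightarrow> F \<subseteq> \<Lambda> \<Longrightarrow> A * (\<Sum>l\<in>F. (cmod (c l))\<^sup>2) \<le> (L2_nrm S (trig F c))\<^sup>2"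
proof -
  obtain A B where AB: "0 < A" "A \<le> B"
    and bd: "\<And>c. (\<lambda>l. (cmod (c l))\<^sup>2) summable_on \<Lambda> \<Longrightarrow> \<exists>g. has_L2_exp_sum S \<Lambda> c g \<and>
      A * (\<Sum>\<^sub>\<infinity>l\<in>\<Lambda>. (cmod (c l))\<^sup>2) \<le> (L2_nrm S g)\<^sup>2 \<and> (L2_nrm S g)\<^sup>2 \<le> B * (\<Sum>\<^sub>\<infinity>l\<in>\<Lambda>. (cmod (c l))\<^sup>2)"
    using R unfolding exp_Riesz_sequence_def by blast
  have fb: "A * (\<Sum>l\<in>F. (cmod (c l))\<^sup>2) \<le> (L2_nrm S (trig F c))\<^sup>2 \<and> (L2_nrm S (trig F c))\<^sup>2 \<le> B * (\<Sum>l\<in>F. (cmod (c l))\<^sup>2)"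
    if F: "finite F" "F \<subseteq> \<Lambda>" for F c
  proof -
    define c' where "c' l = (if l \<in> F then c l else 0)" for l
    have "(\<lambda>l. (cmod (c' l))\<^sup>2) summable_on F" using F by simp
    then have sm: "(\<lambda>l. (cmod (c' l))\<^sup>2) summable_on \<Lambda>"
      using F by (subst summable_on_cong_neutral[where T = F and g = "\<lambda>l. (cmod (c' l))\<^sup>2"]) (auto simp: c'_def)
    have "(\<Sum>\<^sub>\<infinity>l\<in>\<Lambda>. (cmod (c' l))\<^sup>2) = (\<Sum>\<^sub>\<infinity>l\<in>F. (cmod (c' l))\<^sup>2)"
      using F by (intro infsum_cong_neutral) (auto simp: c'_def)
    then have tot: "(\<Sum>\<^sub>\<infinity>l\<in>\<Lambda>. (cmod (c' l))\<^sup>2) = (\<Sum>l\<in>F. (cmod (c l))\<^sup>2)" using F by (simp add: c'_def)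
    obtain g where gL: "g \<in> L2 S"
      and lim: "((\<lambda>F. L2_nrm S (\<lambda>t. trig F c' t - g t)) \<longlongrightarrow> 0) (finite_subsets_at_top \<Lambda>)"
      and g: "A * (\<Sum>l\<in>F. (cmod (c l))\<^sup>2) \<le> (L2_nrm S g)\<^sup>2" "(L2_nrm S g)\<^sup>2 \<le> B * (\<Sum>l\<in>F. (cmod (c l))\<^sup>2)"
      using bd[OF sm] unfolding tot has_L2_exp_sum_def by blast
    have tr: "trig Y c' t = trig F c t" if "finite Y" "F \<subseteq> Y" for Y t
    proof -
      have "trig Y c' t = trig F c' t"
        using that by (intro sum.mono_neutral_right) (auto simp: c'_def)
      then show ?thesis by (simp add: c'_def)
    qed
    have "eventually (\<lambda>Y. L2_nrm S (\<lambda>t. trig Y c' t - g t) = L2_nrm S (\<lambda>t. trig F c t - g t)) (finite_subsets_at_top \<Lambda>)"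
      unfolding eventually_finite_subsets_at_top using F tr by (intro exI[of _ F]) auto
    with lim have "((\<lambda>_. L2_nrm S (\<lambda>t. trig F c t - g t)) \<longlongrightarrow> 0) (finite_subsets_at_top \<Lambda>)"
      by (rule Lim_transform_eventually)
    then have "L2_nrm S (\<lambda>t. trig F c t - g t) = 0" by (simp add: tendsto_const_iff)
    then have "L2_nrm S (trig F c) = L2_nrm S g" using abs_L2_nrm_diff_le[OF trig_L2[OF S, where F = F and c = c] gL] by simp
    then show ?thesis using g by simp
  qed
  show ?thesis by (rule that[OF AB]) (use fb in \<open>auto simp: synthesis_bound_def\<close>)
qed


section \<open>Counting frequencies of a frame\<close>

lemma integrable_mult_cnj:
  fixes f g :: "'a \<Rightarrow> complex"
  assumes [measurable]: "f \<in> borel_measurable M" "g \<in> borel_measurable M"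
    and "integrable M (\<lambda>t. (cmod (f t))\<^sup>2)" "integrable M (\<lambda>t. (cmod (g t))\<^sup>2)"
  shows "integrable M (\<lambda>t. f t * cnj (g t))"
proof (rule Bochner_Integration.integrable_bound)
  show "integrable M (\<lambda>t. cmod (f t) * cmod (g t))"
    by (rule integrable_mult_square_integrable[OF _ _ assms(3,4)]) measurable
qed (auto simp: norm_mult)

text \<open>A general measure is allowed because the lemma serves counting measure on \<Lambda>,
  where it yields the frame energy, as well as Lebesgue measure on a set.\<close>

lemma hform_gram:
  fixes u :: "'i \<Rightarrow> 'a \<Rightarrow> complex"
  assumes m: "\<And>i. i \<in> I \<Longrightarrow> u i \<in> borel_measurable M"
    and sq: "\<And>i. i \<in> I \<Longrightarrow> integrable M (\<lambda>t. (cmod (u i t))\<^sup>2)"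
  shows "hform I (\<lambda>i j. LINT t|M. u i t * cnj (u j t)) c c = of_real (LINT t|M. (cmod (\<Sum>i\<in>I. c i * u i t))\<^sup>2)"
    and "integrable M (\<lambda>t. (cmod (\<Sum>i\<in>I. c i * u i t))\<^sup>2)"
proof -
  have int: "integrable M (\<lambda>t. u i t * cnj (u j t))" if "i \<in> I" "j \<in> I" for i j
    using that by (intro integrable_mult_cnj m sq)
  have eq: "of_real ((cmod (\<Sum>i\<in>I. c i * u i t))\<^sup>2) = (\<Sum>i\<in>I. \<Sum>j\<in>I. c i * cnj (c j) * (u i t * cnj (u j t)))" for t
    unfolding complex_norm_square cnj_sum sum_product by (intro sum.cong refl) simp
  have intc: "integrable M (\<lambda>t. complex_of_real ((cmod (\<Sum>i\<in>I. c i * u i t))\<^sup>2))"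
    unfolding eq by (intro Bochner_Integration.integrable_sum integrable_mult_right int)
  then show "integrable M (\<lambda>t. (cmod (\<Sum>i\<in>I. c i * u i t))\<^sup>2)"
    by (rule complex_of_real_integrable_eq[THEN iffD1])
  have "complex_of_real (LINT t|M. (cmod (\<Sum>i\<in>I. c i * u i t))\<^sup>2)
    = (LINT t|M. complex_of_real ((cmod (\<Sum>i\<in>I. c i * u i t))\<^sup>2))"
    by (rule integral_complex_of_real[symmetric])
  also have "\<dots> = (LINT t|M. (\<Sum>i\<in>I. \<Sum>j\<in>I. c i * cnj (c j) * (u i t * cnj (u j t))))"
    unfolding eq ..
  also have "\<dots> = (\<Sum>i\<in>I. LINT t|M. (\<Sum>j\<in>I. c i * cnj (c j) * (u i t * cnj (u j t))))"
    by (rule Bochner_Integration.integral_sum)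
      (intro Bochner_Integration.integrable_sum integrable_mult_right int)
  also have "\<dots> = (\<Sum>i\<in>I. \<Sum>j\<in>I. LINT t|M. c i * cnj (c j) * (u i t * cnj (u j t)))"
    by (intro sum.cong refl Bochner_Integration.integral_sum integrable_mult_right int)
  also have "\<dots> = hform I (\<lambda>i j. LINT t|M. u i t * cnj (u j t)) c c"
    unfolding hform_def by (intro sum.cong refl) simp
  finally show "hform I (\<lambda>i j. LINT t|M. u i t * cnj (u j t)) c c = of_real (LINT t|M. (cmod (\<Sum>i\<in>I. c i * u i t))\<^sup>2)" ..
qed

lemma gram_cnj: "(LINT t|M. u j t * cnj (u i t)) = cnj (LINT t|M. u i t * cnj (u j t :: complex))"
  by (subst Bochner_Integration.integral_cnj[symmetric]) (simp add: mult.commute)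

lemma hform_add: "hform I (\<lambda>i j. M i j + M' i j) c d = hform I M c d + hform I M' c d"
  by (simp add: hform_def distrib_left sum.distrib)

lemma nonneg_infsum_eq_integral:
  fixes f :: "'a \<Rightarrow> real"
  assumes "\<And>x. f x \<ge> 0" "f summable_on \<Lambda>"
  shows "integrable (count_space \<Lambda>) f" "(LINT x|count_space \<Lambda>. f x) = (\<Sum>\<^sub>\<infinity>x\<in>\<Lambda>. f x)"
proof -
  have abs: "(\<lambda>x. norm (f x)) summable_on \<Lambda>" using assms by simp
  then have "Infinite_Set_Sum.abs_summable_on f \<Lambda>" using abs_summable_equivalent by blast
  then show "integrable (count_space \<Lambda>) f" by (simp add: Infinite_Set_Sum.abs_summable_on_def)
  show "(LINT x|count_space \<Lambda>. f x) = (\<Sum>\<^sub>\<infinity>x\<in>\<Lambda>. f x)"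
    using infsetsum_infsum[of f \<Lambda>] abs abs_summable_equivalent[of f \<Lambda>] by (simp add: infsetsum_def)
qed

lemma ft_indicator_mult_trig:
  fixes D :: "'a::euclidean_space set"
  assumes "D \<in> lmeasurable"
  shows "ft (\<lambda>t. indicator D t * trig I c t) y = (\<Sum>z\<in>I. c z * ft (indicator D) (y - z))"
    and "integrable lebesgue (indicator D :: 'a \<Rightarrow> complex)"
proof -
  have i: "integrable lebesgue (indicator D :: 'a \<Rightarrow> real)" using assms by (intro integrable_real_indicator) (auto simp: fmeasurable_def)
  have "(indicator D :: 'a \<Rightarrow> complex) = (\<lambda>t. of_real (indicator D t))" by (auto simp: indicator_def)
  then show i: "integrable lebesgue (indicator D :: 'a \<Rightarrow> complex)" using i by simp
  show "ft (\<lambda>t. indicator D t * trig I c t) y = (\<Sum>z\<in>I. c z * ft (indicator D) (y - z))"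
    by (rule ft_mult_sum_expo[OF i])
qed

lemma L2_nrm_expo_square:
  assumes "D \<in> lmeasurable"
  shows "(L2_nrm D (expo y))\<^sup>2 = measure lebesgue D"
proof -
  have "(L2_nrm D (expo y))\<^sup>2 = (LINT t|lebesgue_on D. 1)" unfolding L2_nrm_square by simp
  also have "\<dots> = measure lebesgue D"
    using assms by (simp add: measure_restrict_space fmeasurableD space_restrict_space)
  finally show ?thesis .
qed

lemma integral_cube_trig:
  fixes I :: "'a::euclidean_space set"
  assumes N: "N > 0" and I: "finite I" "I \<subseteq> scaled_lattice N"
  shows "(LINT t|lebesgue. (cmod (indicator (cube N) t * trig I c t))\<^sup>2) = N ^ DIM('a) * (\<Sum>z\<in>I. (cmod (c z))\<^sup>2)"
proof -
  have cm: "cube N \<in> (lmeasurable :: 'a set set)" unfolding cube_def by (rule lmeasurable_cbox)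
  define u where "u z t = indicator (cube N) t * expo z t" for z t :: 'a
  have um [measurable]: "u z \<in> borel_measurable borel" for z unfolding u_def[abs_def] by measurable
  have ui: "integrable lborel (\<lambda>t. (cmod (u z t))\<^sup>2)" for z
  proof -
    have "(\<lambda>t. (cmod (u z t))\<^sup>2) = (\<lambda>t. indicator (cube N) t)" by (auto simp: u_def norm_mult indicator_def)
    then show ?thesis using measure_cube(1)[OF N, where 'a = 'a] by (simp add: integrable_indicator_iff)
  qed
  have pu: "indicator (cube N) t * trig I c t = (\<Sum>z\<in>I. c z * u z t)" for t
    by (simp add: u_def sum_distrib_left mult_ac)
  have gram: "(LINT t|lborel. u z t * cnj (u w t)) = (if z = w then of_real (N ^ DIM('a)) else 0)"
    if "z \<in> I" "w \<in> I" for z w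
  proof -
    have "(LINT t|lborel. u z t * cnj (u w t)) = (LINT t|lborel. indicator (cube N) t * expo (z - w) t)"
      by (rule Bochner_Integration.integral_cong) (auto simp: u_def expo_diff_left indicator_def)
    also have "\<dots> = (if z - w = 0 then of_real (N ^ DIM('a)) else 0)"
      by (rule integral_cube_expo[OF N scaled_lattice_diff]) (use that I in auto)
    finally show ?thesis by simp
  qed
  have "(LINT t|lebesgue. (cmod (\<Sum>z\<in>I. c z * u z t))\<^sup>2) = (LINT t|lborel. (cmod (\<Sum>z\<in>I. c z * u z t))\<^sup>2)"
    by (rule integral_completion) measurable
  then have "complex_of_real (LINT t|lebesgue. (cmod (\<Sum>z\<in>I. c z * u z t))\<^sup>2)
      = hform I (\<lambda>z w. LINT t|lborel. u z t * cnj (u w t)) c c"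
    using hform_gram(1)[of I u lborel c] um ui by simp
  also have "\<dots> = (\<Sum>z\<in>I. \<Sum>w\<in>I. if w = z then c z * cnj (c z) * of_real (N ^ DIM('a)) else 0)"
    unfolding hform_def by (intro sum.cong refl) (auto simp: gram)
  also have "\<dots> = (\<Sum>z\<in>I. c z * cnj (c z) * of_real (N ^ DIM('a)))" using I by simp
  also have "\<dots> = of_real (N ^ DIM('a) * (\<Sum>z\<in>I. (cmod (c z))\<^sup>2))"
    unfolding complex_norm_square[symmetric] by (simp add: sum_distrib_left mult_ac del: of_real_power)
  finally show ?thesis unfolding pu of_real_eq_iff .
qed

lemma has_sum_sum:
  fixes f :: "'i \<Rightarrow> 'a \<Rightarrow> 'b::topological_comm_monoid_add"
  assumes "\<And>i. i \<in> I \<Longrightarrow> (f i has_sum s i) A"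
  shows "((\<lambda>x. \<Sum>i\<in>I. f i x) has_sum (\<Sum>i\<in>I. s i)) A"
  using assms by (induction I rule: infinite_finite_induct) (auto intro: has_sum_0 has_sum_add)

text \<open>For a basis orthonormal with respect to the frame energy on S \<inter> cube plus the
  energy on D = cube - S, the number \<open>card I\<close> is the sum of both kinds of energy.
  Exchanging sums, the frame part becomes a sum over \<Lambda> of numbers \<open>p l\<close> that
  are at most 1, and at most \<open>1 - \<epsilon>\<close> on \<open>Bad\<close>; the other part is,
  up to a tail, at most the measure of D times the volume of the ball. \<open>R\<close> depends on
  tails only, so it is the same for all balls.\<close>

lemma frame_count:
  fixes S \<Lambda> :: "'a::euclidean_space set" and \<epsilon> \<eta> :: real
  assumes S: "S \<in> lmeasurable"
    and \<sigma>: "\<sigma> > 0" "\<And>x y. x \<in> \<Lambda> \<Longrightarrow> y \<in> \<Lambda> \<Longrightarrow> x \<noteq> y \<Longrightarrow> \<sigma> \<le> dist x y"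
    and A: "A > 0"
    and sm: "\<And>f. f \<in> L2 S \<Longrightarrow> (\<lambda>l. (cmod (L2_inner S f (expo l)))\<^sup>2) summable_on \<Lambda>"
    and lower: "\<And>f. f \<in> L2 S \<Longrightarrow> A * (L2_nrm S f)\<^sup>2 \<le> (\<Sum>\<^sub>\<infinity>l\<in>\<Lambda>. (cmod (L2_inner S f (expo l)))\<^sup>2)"
    and Bad: "Bad \<subseteq> \<Lambda>" "0 < \<epsilon>" "\<epsilon> \<le> 1"
      "\<And>f l. f \<in> L2 S \<Longrightarrow> l \<in> Bad \<Longrightarrow>
         (cmod (L2_inner S f (expo l)))\<^sup>2 \<le> (1 - \<epsilon>) * (\<Sum>\<^sub>\<infinity>l\<in>\<Lambda>. (cmod (L2_inner S f (expo l)))\<^sup>2)"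
    and N: "N > 0" and \<eta>: "\<eta> > 0"
  shows "\<exists>R>0. \<forall>x r. card (scaled_lattice N \<inter> ball x r) * (1 - \<eta>)
     \<le> card (\<Lambda> \<inter> ball x (r + R)) - \<epsilon> * card (Bad \<inter> ball x (r + R))
        + measure lebesgue (cube N - S) * measure lborel (ball x (r + R))"
proof -
  define d where "d = DIM('a)"
  \<comment> \<open>Lattice exponentials have squared norm \<open>N ^ d\<close> on the cube. The
    frame form gives the factor \<open>A\<close> on S \<inter> cube, the added form the factor 1 on
    D, whence the minimum.\<close>
  define A0 where "A0 = min A 1 * N ^ d"
  have A0: "A0 > 0" using A N by (simp add: A0_def)
  \<comment> \<open>Each of the two parts costs a tail of \<open>card I * e / A0\<close>; together
    they are \<open>card I * \<eta>\<close>.\<close>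
  define e where "e = \<eta> * A0 / 2"
  have e: "e > 0" using \<eta> A0 by (simp add: e_def)
  have Sl: "S \<in> sets lebesgue" using S by (rule fmeasurableD)
  have cl: "cube N \<in> (lmeasurable :: 'a set set)" unfolding cube_def by (rule lmeasurable_cbox)
  define Q where "Q = S \<inter> cube N"
  define D where "D = cube N - S"
  have Q: "Q \<in> lmeasurable" and D: "D \<in> lmeasurable"
    unfolding Q_def D_def using S cl by (auto intro: fmeasurable_Int_fmeasurable fmeasurable_Diff fmeasurableD)
  define q where "q = ft (indicator Q)"
  note qi = ft_indicator_mult_trig(2)[OF Q] and Di = ft_indicator_mult_trig(2)[OF D]
  have ind1: "cmod (indicator X t) \<le> 1" for X :: "'a set" and t by (simp add: indicator_def)
  obtain \<rho> where \<rho>: "cube N \<subseteq> ball (0::'a) \<rho>"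
    using bounded_subset_ballD[OF bounded_cube] by blast
  have Q0: "indicator Q t = (0::complex)" if "t \<notin> ball 0 \<rho>" for t
    using that \<rho> by (auto simp: Q_def indicator_def)
  obtain R1 where R1: "R1 > 0" and tail1: "\<forall>F. finite F \<longrightarrow> F \<inter> ball 0 R1 = {} \<longrightarrow>
     (\<forall>x\<in>F. \<forall>y\<in>F. x \<noteq> y \<longrightarrow> \<sigma> \<le> dist x y) \<longrightarrow> (\<Sum>\<xi>\<in>F. (cmod (q \<xi>))\<^sup>2) \<le> e"
    using ft_tail_separated[OF borel_measurable_integrable[OF qi] ind1 Q0 \<sigma>(1) e] unfolding q_def by blast
  have iD: "integrable lborel (\<lambda>y. (cmod (ft (indicator D) y))\<^sup>2)" by (rule plancherel(2)[OF Di ind1])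
  obtain R2 where R2: "R2 > 0" and tail2: "(LINT y|lborel. (cmod (ft (indicator D) y))\<^sup>2 * indicator (- ball 0 R2) y) < e"
    by (rule tail_integral_small[OF iD _ e]) auto
  define R where "R = max R1 R2"
  have fm: "ft (indicator D) \<in> borel_measurable borel" by (rule borel_measurable_ft[OF Di])
  have iDR: "integrable lborel (\<lambda>y. (cmod (ft (indicator D) y))\<^sup>2 * indicator (- ball 0 R') y)" for R'
    by (rule Bochner_Integration.integrable_bound[OF iD]) (use fm in \<open>auto simp: indicator_def\<close>)
  have tail3: "(LINT y|lborel. (cmod (ft (indicator D) y))\<^sup>2 * indicator (- ball 0 R) y) \<le> e"
  proof -
    have "(LINT y|lborel. (cmod (ft (indicator D) y))\<^sup>2 * indicator (- ball 0 R) y)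
      \<le> (LINT y|lborel. (cmod (ft (indicator D) y))\<^sup>2 * indicator (- ball 0 R2) y)"
      by (rule integral_mono[OF iDR iDR]) (auto simp: R_def indicator_def)
    then show ?thesis using tail2 by simp
  qed
  have main: "card (scaled_lattice N \<inter> ball x r) * (1 - \<eta>)
     \<le> card (\<Lambda> \<inter> ball x (r + R)) - \<epsilon> * card (Bad \<inter> ball x (r + R)) + measure lebesgue D * measure lborel (ball x (r + R))" for x r
  proof -
    define I where "I = scaled_lattice N \<inter> ball x r"
    have I: "finite I" "I \<subseteq> scaled_lattice N" "I \<subseteq> ball x r"
      unfolding I_def using finite_scaled_lattice_ball[OF N] by auto
    define a where "a z l = q (l - z)" for z l
    have fL: "(\<lambda>t. indicator (cube N) t * trig I c t) \<in> L2 S" for c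
    proof -
      have "(\<lambda>t. indicator (cube N) t * trig I c t) \<in> borel_measurable lebesgue"
        by (rule measurable_completion) measurable
      then have m: "(\<lambda>t. indicator (cube N) t * trig I c t) \<in> borel_measurable (lebesgue_on S)"
        by (rule borel_measurable_lebesgue_on)
      show ?thesis
      proof (rule L2_bounded[OF S m])
        fix t show "cmod (indicator (cube N) t * trig I c t) \<le> 1 * (\<Sum>z\<in>I. cmod (c z))"
          unfolding norm_mult by (intro mult_mono ind1 order_trans[OF norm_sum]) (auto simp: norm_mult)
      qed
    qed
    have inner: "L2_inner S (\<lambda>t. indicator (cube N) t * trig I c t) (expo l) = (\<Sum>z\<in>I. c z * a z l)" for c l
    proof -
      have "(\<lambda>t. indicator S t * (indicator (cube N) t * trig I c t)) = (\<lambda>t. indicator Q t * trig I c t)"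
        by (auto simp: Q_def indicator_def)
      then show ?thesis
        unfolding L2_inner_expo_eq_ft[OF Sl] using ft_indicator_mult_trig(1)[OF Q, where I = I and c = c and y = l] by (simp add: a_def q_def)
    qed
    \<comment> \<open>The frame energy of a lattice sum cut off by the cube, expressed through its
      coefficients.\<close>
    define E where "E c = (\<Sum>\<^sub>\<infinity>l\<in>\<Lambda>. (cmod (\<Sum>z\<in>I. c z * a z l))\<^sup>2)" for c
    have smE: "(\<lambda>l. (cmod (\<Sum>z\<in>I. c z * a z l))\<^sup>2) summable_on \<Lambda>" for c
      using sm[OF fL] unfolding inner .
    have lowE: "A * (L2_nrm S (\<lambda>t. indicator (cube N) t * trig I c t))\<^sup>2 \<le> E c" for c
      using lower[OF fL] unfolding inner E_def .
    have sma: "(\<lambda>l. (cmod (a z l))\<^sup>2) summable_on \<Lambda>" if "z \<in> I" for z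
    proof -
      have "(\<Sum>w\<in>I. (if w = z then 1 else 0) * a w l) = a z l" for l
      proof -
        have "(\<Sum>w\<in>I. (if w = z then 1 else 0) * a w l) = (\<Sum>w\<in>I. if w = z then a w l else 0)"
          by (intro sum.cong refl) auto
        then show ?thesis using that I(1) by simp
      qed
      then show ?thesis using smE[of "\<lambda>w. if w = z then 1 else 0"] by simp
    qed
    define M1 where "M1 = (\<lambda>z w. LINT l|count_space \<Lambda>. a z l * cnj (a w l))"
    define M2 where "M2 = (\<lambda>z w. LINT t|lebesgue_on D. expo z t * cnj (expo w t))"
    define M where "M = (\<lambda>z w. M1 z w + M2 z w)"
    have H1: "hform I M1 c c = of_real (E c)" for c
    proof -
      have "hform I M1 c c = of_real (LINT l|count_space \<Lambda>. (cmod (\<Sum>z\<in>I. c z * a z l))\<^sup>2)"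
        unfolding M1_def by (rule hform_gram(1)) (auto intro: nonneg_infsum_eq_integral(1) sma)
      then show ?thesis unfolding E_def by (subst (asm) nonneg_infsum_eq_integral(2)[OF _ smE]) auto
    qed
    have H2: "hform I M2 c c = of_real ((L2_nrm D (trig I c))\<^sup>2)" for c
      unfolding M2_def L2_nrm_square by (rule hform_gram(1)) (rule L2_measurable[OF expo_L2[OF D]], rule L2_integrable[OF expo_L2[OF D]])
    have H: "Re (hform I M c c) = E c + (L2_nrm D (trig I c))\<^sup>2" for c
      unfolding M_def hform_add H1 H2 by simp
    have herm: "M w z = cnj (M z w)" for z w
      unfolding M_def M1_def M2_def complex_cnj_add by (intro arg_cong2[where f = "(+)"] gram_cnj)
    have E0: "E c \<ge> 0" for c unfolding E_def by (rule infsum_nonneg) simp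
    have coercive: "A0 * (\<Sum>z\<in>I. (cmod (c z))\<^sup>2) \<le> Re (hform I M c c)" for c
    proof -
      define m where "m = min A 1"
      have "A0 * (\<Sum>z\<in>I. (cmod (c z))\<^sup>2) = m * (LINT t|lebesgue. (cmod (indicator (cube N) t * trig I c t))\<^sup>2)"
        unfolding integral_cube_trig[OF N I(1,2)] by (simp add: A0_def m_def d_def)
      also have "(LINT t|lebesgue. (cmod (indicator (cube N) t * trig I c t))\<^sup>2)
        = (LINT t|lebesgue. (cmod (indicator S t * (indicator (cube N) t * trig I c t)))\<^sup>2 + (cmod (indicator D t * trig I c t))\<^sup>2)"
        by (rule Bochner_Integration.integral_cong) (auto simp: D_def indicator_def)
      also have "\<dots> = (LINT t|lebesgue. (cmod (indicator S t * (indicator (cube N) t * trig I c t)))\<^sup>2)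
          + (LINT t|lebesgue. (cmod (indicator D t * trig I c t))\<^sup>2)"
      proof (rule Bochner_Integration.integral_add)
        have eq: "(indicator S t :: complex) * (indicator (cube N) t * trig I c t) = indicator Q t * trig I c t" for t
          by (auto simp: Q_def indicator_def)
        show "integrable lebesgue (\<lambda>t. (cmod (indicator S t * (indicator (cube N) t * trig I c t)))\<^sup>2)"
          unfolding eq by (rule integrable_square_if_bounded[OF integrable_mult_trig[OF qi ind1]])
        show "integrable lebesgue (\<lambda>t. (cmod (indicator D t * trig I c t))\<^sup>2)"
          by (rule integrable_square_if_bounded[OF integrable_mult_trig[OF Di ind1]])
      qed
      also have "\<dots> = (L2_nrm S (\<lambda>t. indicator (cube N) t * trig I c t))\<^sup>2 + (L2_nrm D (trig I c))\<^sup>2"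
        by (simp only: L2_nrm_square_indicator[OF Sl] L2_nrm_square_indicator[OF fmeasurableD[OF D]])
      finally have "A0 * (\<Sum>z\<in>I. (cmod (c z))\<^sup>2)
         = m * (L2_nrm S (\<lambda>t. indicator (cube N) t * trig I c t))\<^sup>2 + m * (L2_nrm D (trig I c))\<^sup>2"
        by (simp only: distrib_left)
      also have "\<dots> \<le> A * (L2_nrm S (\<lambda>t. indicator (cube N) t * trig I c t))\<^sup>2 + 1 * (L2_nrm D (trig I c))\<^sup>2"
        by (intro add_mono mult_right_mono) (auto simp: m_def)
      also have "\<dots> \<le> Re (hform I M c c)" unfolding H using lowE[of c] by simp
      finally show ?thesis .
    qed
    obtain g where g: "orthonormal_for I M g"
    proof (rule orthonormal_for_exists[OF I(1) herm])
      fix c :: "'a \<Rightarrow> complex" assume "\<exists>i\<in>I. c i \<noteq> 0"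
      then have "0 < (\<Sum>z\<in>I. (cmod (c z))\<^sup>2)" using I(1) by (auto intro: sum_pos2)
      then show "0 < Re (hform I M c c)" using coercive[of c] A0 by (meson less_le_trans mult_pos_pos)
    qed
    have far: "(\<Sum>j\<in>I. (cmod (\<Sum>z\<in>I. g j z * b z))\<^sup>2) \<le> (\<Sum>z\<in>I. (cmod (b z))\<^sup>2) / A0" for b
      by (rule orthonormal_bessel_coercive[OF g I(1) A0 herm coercive])
    \<comment> \<open>Squared norm, with respect to the form, of the functional giving the
      coefficient at \<open>l\<close>. The frame energy dominates that functional with factor
      \<open>k l\<close>, and the full form dominates the frame energy.\<close>
    define p where "p l = (\<Sum>j\<in>I. (cmod (\<Sum>z\<in>I. g j z * a z l))\<^sup>2)" for l
    define k where "k l = (if l \<in> Bad then 1 - \<epsilon> else 1)" for l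
    have pk: "p l \<le> k l" if "l \<in> \<Lambda>" for l
      unfolding p_def
    proof (rule orthonormal_bessel[OF g I(1) _ herm])
      show "0 \<le> k l" using Bad by (simp add: k_def)
      fix c
      have "(cmod (\<Sum>z\<in>I. c z * a z l))\<^sup>2 \<le> k l * E c"
      proof (cases "l \<in> Bad")
        case True
        show ?thesis using Bad(4)[OF fL True, of c] True unfolding inner E_def k_def by simp
      next
        case False
        have "(\<Sum>l\<in>{l}. (cmod (\<Sum>z\<in>I. c z * a z l))\<^sup>2) \<le> E c"
          unfolding E_def using that by (intro finite_sum_le_infsum smE) auto
        then show ?thesis using False by (simp add: k_def)
      qed
      also have "\<dots> \<le> k l * Re (hform I M c c)"
        using Bad unfolding H by (intro mult_left_mono) (auto simp: k_def)
      finally show "(cmod (\<Sum>z\<in>I. c z * a z l))\<^sup>2 \<le> k l * Re (hform I M c c)" .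
    qed
    define L where "L = \<Lambda> \<inter> ball x (r + R)"
    have "uniform_discrete \<Lambda>" using \<sigma> unfolding uniform_discrete_def by (metis not_less)
    then have L: "finite L" unfolding L_def by (rule uniform_discrete_imp_finite_Int) simp
    have p0: "p l \<ge> 0" for l by (simp add: p_def sum_nonneg)
    have k0: "k l \<ge> 0" for l using Bad by (simp add: k_def)
    \<comment> \<open>Frequencies in the enlarged ball are bounded by \<open>k\<close>. Every other
      \<open>l\<close> has \<open>l - z\<close> of norm at least \<open>R1\<close> for each z in
      \<open>I\<close>, so the tail estimate over separated sets applies to each z.\<close>
    have psum: "(\<Sum>l\<in>F. p l) \<le> (\<Sum>l\<in>L. k l) + card I * e / A0" if F: "finite F" "F \<subseteq> \<Lambda>" for F
    proof -
      have "(\<Sum>l\<in>F. p l) = (\<Sum>l\<in>F \<inter> L. p l) + (\<Sum>l\<in>F - L. p l)"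
        using F(1) by (simp add: sum.Int_Diff)
      also have "(\<Sum>l\<in>F \<inter> L. p l) \<le> (\<Sum>l\<in>F \<inter> L. k l)" using F pk by (intro sum_mono) auto
      also have "\<dots> \<le> (\<Sum>l\<in>L. k l)" using L k0 by (intro sum_mono2) auto
      also have "(\<Sum>l\<in>F - L. p l) \<le> (\<Sum>l\<in>F - L. (\<Sum>z\<in>I. (cmod (a z l))\<^sup>2) / A0)"
        unfolding p_def by (intro sum_mono far)
      also have "\<dots> = (\<Sum>z\<in>I. \<Sum>l\<in>F - L. (cmod (a z l))\<^sup>2) / A0"
        by (subst sum_divide_distrib[symmetric], subst sum.swap) (rule refl)
      also have "(\<Sum>z\<in>I. \<Sum>l\<in>F - L. (cmod (a z l))\<^sup>2) \<le> (\<Sum>z\<in>I. e)"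
      proof (rule sum_mono)
        fix z assume z: "z \<in> I"
        have "(\<Sum>l\<in>F - L. (cmod (a z l))\<^sup>2) = (\<Sum>\<xi>\<in>(\<lambda>l. l - z) ` (F - L). (cmod (q \<xi>))\<^sup>2)"
          unfolding a_def by (rule sum.reindex_cong[of "\<lambda>l. l - z", symmetric]) (auto simp: inj_on_def)
        also have "\<dots> \<le> e"
        proof (rule tail1[rule_format])
          show "finite ((\<lambda>l. l - z) ` (F - L))" using F by simp
          show "(\<lambda>l. l - z) ` (F - L) \<inter> ball 0 R1 = {}"
          proof -
            have "l - z \<notin> ball 0 R1" if "l \<in> F - L" for l
            proof
              assume "l - z \<in> ball 0 R1"
              moreover have "dist x z < r" using z I(3) by auto
              ultimately have "dist x l < r + R"
                using dist_triangle[of x l z] by (simp add: dist_norm norm_minus_commute R_def)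
              then show False using that F by (auto simp: L_def)
            qed
            then show ?thesis by auto
          qed
          fix u v assume uv: "u \<in> (\<lambda>l. l - z) ` (F - L)" "v \<in> (\<lambda>l. l - z) ` (F - L)" "u \<noteq> v"
          then obtain l l' where "l \<in> F" "l' \<in> F" "u = l - z" "v = l' - z" by auto
          then show "\<sigma> \<le> dist u v" using \<sigma>(2)[of l l'] uv(3) F by (auto simp: dist_norm)
        qed
        finally show "(\<Sum>l\<in>F - L. (cmod (a z l))\<^sup>2) \<le> e" .
      qed
      finally show ?thesis using A0 by (simp add: divide_right_mono)
    qed
    have part1: "(\<Sum>j\<in>I. E (g j)) \<le> (\<Sum>l\<in>L. k l) + card I * e / A0"
    proof -
      have hs: "((\<lambda>l. (cmod (\<Sum>z\<in>I. g j z * a z l))\<^sup>2) has_sum E (g j)) \<Lambda>" for j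
        unfolding E_def by (rule has_sum_infsum[OF smE])
      have "((\<lambda>l. \<Sum>j\<in>I. (cmod (\<Sum>z\<in>I. g j z * a z l))\<^sup>2) has_sum (\<Sum>j\<in>I. E (g j))) \<Lambda>"
        by (rule has_sum_sum) (rule hs)
      then have hp: "(p has_sum (\<Sum>j\<in>I. E (g j))) \<Lambda>" by (simp only: p_def[symmetric])
      then have "(\<Sum>j\<in>I. E (g j)) = (\<Sum>\<^sub>\<infinity>l\<in>\<Lambda>. p l)" by (rule infsumI[symmetric])
      also have "\<dots> \<le> (\<Sum>l\<in>L. k l) + card I * e / A0"
        by (rule infsum_le_finite_sums[OF has_sum_imp_summable[OF hp] psum])
      finally show ?thesis .
    qed
    have ksum: "(\<Sum>l\<in>L. k l) = card L - \<epsilon> * card (Bad \<inter> ball x (r + R))"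
    proof -
      have "(\<Sum>l\<in>L. k l) = (\<Sum>l\<in>L. 1) - (\<Sum>l\<in>L. if l \<in> Bad then \<epsilon> else 0)"
        unfolding sum_subtractf[symmetric] by (intro sum.cong refl) (simp add: k_def)
      also have "(\<Sum>l\<in>L. if l \<in> Bad then \<epsilon> else 0) = (\<Sum>l\<in>L \<inter> Bad. \<epsilon>)"
        by (rule sum.inter_restrict[OF L, symmetric])
      also have "L \<inter> Bad = Bad \<inter> ball x (r + R)" using Bad(1) by (auto simp: L_def)
      finally show ?thesis by (simp add: mult.commute)
    qed
    \<comment> \<open>On D the coefficient at \<open>y\<close> is an inner product with
      \<open>expo y\<close>, whose squared norm is the measure of D; this is the bound \<kappa>
      needed for \<open>localized_energy\<close>.\<close>
    have part2: "(\<Sum>j\<in>I. (L2_nrm D (trig I (g j)))\<^sup>2)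
       \<le> measure lebesgue D * measure lborel (ball x (r + R)) + card I * e / A0"
    proof -
      have "(\<Sum>j\<in>I. LINT t|lebesgue. (cmod (indicator D t * (\<Sum>z\<in>I. g j z * expo z t)))\<^sup>2)
        \<le> (LINT y|lborel. indicator (ball x (r + R)) y * measure lebesgue D)
          + card I * (LINT y|lborel. (cmod (ft (indicator D) y))\<^sup>2 * indicator (- ball 0 R) y) / A0"
      proof (rule localized_energy[OF Di ind1 I(1,3) _ _ A0 far])
        show "integrable lborel (\<lambda>y. indicator (ball x (r + R)) y * measure lebesgue D)"
          by (intro integrable_mult_left integrable_indicator_ball)
        fix y
        show "(\<Sum>j\<in>I. (cmod (ft (\<lambda>t. indicator D t * (\<Sum>z\<in>I. g j z * expo z t)) y))\<^sup>2) \<le> measure lebesgue D"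
          unfolding ft_indicator_mult_trig(1)[OF D]
        proof (rule orthonormal_bessel[OF g I(1) _ herm])
          fix c
          have "(cmod (\<Sum>z\<in>I. c z * ft (indicator D) (y - z)))\<^sup>2 = (cmod (L2_inner D (trig I c) (expo y)))\<^sup>2"
            unfolding L2_inner_expo_eq_ft[OF fmeasurableD[OF D]] ft_indicator_mult_trig(1)[OF D] ..
          also have "\<dots> \<le> (L2_nrm D (trig I c) * L2_nrm D (expo y))\<^sup>2"
            by (intro power_mono L2_Cauchy_Schwarz trig_L2 expo_L2 D) simp
          also have "\<dots> = measure lebesgue D * (L2_nrm D (trig I c))\<^sup>2"
            unfolding power_mult_distrib L2_nrm_expo_square[OF D] by simp
          also have "\<dots> \<le> measure lebesgue D * Re (hform I M c c)"
            unfolding H using E0[of c] by (intro mult_left_mono) auto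
          finally show "(cmod (\<Sum>z\<in>I. c z * ft (indicator D) (y - z)))\<^sup>2 \<le> measure lebesgue D * Re (hform I M c c)" .
        qed simp
      qed
      also have "\<dots> \<le> measure lebesgue D * measure lborel (ball x (r + R)) + card I * e / A0"
        using tail3 A0 by (intro add_mono divide_right_mono mult_left_mono) (auto simp: mult.commute)
      finally show ?thesis unfolding L2_nrm_square_indicator[OF fmeasurableD[OF D]] .
    qed
    define T where "T = card I * e / A0"
    have "real (card I) = (\<Sum>j\<in>I. Re (hform I M (g j) (g j)))"
      using g by (simp add: orthonormal_for_def)
    also have "\<dots> = (\<Sum>j\<in>I. E (g j)) + (\<Sum>j\<in>I. (L2_nrm D (trig I (g j)))\<^sup>2)"
      unfolding H sum.distrib ..
    also have "\<dots> \<le> (card L - \<epsilon> * card (Bad \<inter> ball x (r + R)) + T)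
        + (measure lebesgue D * measure lborel (ball x (r + R)) + T)"
      using part1 part2 unfolding ksum T_def by (rule add_mono)
    finally have "real (card I) \<le> card L - \<epsilon> * card (Bad \<inter> ball x (r + R))
       + measure lebesgue D * measure lborel (ball x (r + R)) + 2 * T" by linarith
    also have "2 * T = card I * \<eta>" using A0 by (simp add: T_def e_def)
    finally show ?thesis unfolding I_def[symmetric] L_def[symmetric] by (simp add: right_diff_distrib)
  qed
  have "R > 0" using R1 by (simp add: R_def)
  then show ?thesis using main unfolding D_def by blast
qed


section \<open>Counting frequencies of a Riesz sequence\<close>

lemma L2_inner_expo_mult_eq_ft:
  assumes S: "S \<in> sets lebesgue"
  shows "L2_inner S u (\<lambda>t. expo y t * cnj (\<phi> t)) = ft (\<lambda>t. (indicator S t * \<phi> t) * u t) y"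
proof -
  have "L2_inner S u (\<lambda>t. expo y t * cnj (\<phi> t)) = L2_inner S (\<lambda>t. \<phi> t * u t) (expo y)"
    by (simp add: L2_inner_def mult_ac)
  then show ?thesis unfolding L2_inner_expo_eq_ft[OF S] by (simp add: mult.assoc)
qed

text \<open>A basis orthonormal for the Gram form in L^2(S) has \<open>card I\<close> elements of
  energy 1. Each energy is split by 1 = |f|^2 + (1 - |f|^2) and computed in frequency. For the first
  weight, the sum over the basis at \<open>y\<close> is the squared norm of the projection of e_y f
  to the span of the exponentials in \<open>I\<close>; it is at most the squared norm of f, and
  smaller by \<epsilon> when \<open>y\<close> lies in \<open>U\<close>.\<close>

lemma riesz_count:
  fixes S \<Lambda> :: "'a::euclidean_space set" and \<epsilon> \<eta> :: real
  assumes S: "S \<in> lmeasurable" and \<Lambda>: "uniform_discrete \<Lambda>" and A: "A > 0"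
    and lower: "\<And>F c. finite F \<Longrightarrow> F \<subseteq> \<Lambda> \<Longrightarrow> A * (\<Sum>l\<in>F. (cmod (c l))\<^sup>2) \<le> (L2_nrm S (trig F c))\<^sup>2"
    and f: "f \<in> borel_measurable lebesgue" "\<And>t. cmod (f t) \<le> 1"
    and \<epsilon>: "\<epsilon> > 0" and U: "U \<in> sets borel"
    and far: "\<And>y F c. y \<in> U \<Longrightarrow> finite F \<Longrightarrow> F \<subseteq> \<Lambda> \<Longrightarrow> \<epsilon> \<le> (L2_nrm S (\<lambda>t. expo y t * f t - trig F c t))\<^sup>2"
    and \<eta>: "\<eta> > 0"
  shows "\<exists>R>0. \<forall>x r. card (\<Lambda> \<inter> ball x r) * (1 - \<eta>)
     \<le> measure lebesgue S * measure lborel (ball x (r + R)) - \<epsilon> * measure lborel (U \<inter> ball x (r + R))"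
proof -
  have Sl: "S \<in> sets lebesgue" using S by (rule fmeasurableD)
  define e where "e = \<eta> * A / 2"
  have e: "e > 0" using \<eta> A by (simp add: e_def)
  \<comment> \<open>Conjugation makes the transform at \<open>y\<close> of \<open>f0\<close> times
    an exponential sum the inner product of that sum with e_y f.\<close>
  define f0 where "f0 t = cnj (f t)" for t
  \<comment> \<open>The complementary weight: the squared moduli of \<open>f0\<close> and
    \<open>f1\<close> add up to 1.\<close>
  define f1 where "f1 t = complex_of_real (sqrt (1 - (cmod (f t))\<^sup>2))" for t
  have f1sq: "(cmod (f1 t))\<^sup>2 = 1 - (cmod (f t))\<^sup>2" for t
    using f(2)[of t] by (simp add: f1_def abs_square_le_1 power_le_one)
  have [measurable]: "f \<in> borel_measurable lebesgue" by fact
  have m0: "f0 \<in> borel_measurable lebesgue" and m1: "f1 \<in> borel_measurable lebesgue"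
    unfolding f0_def[abs_def] f1_def[abs_def] by measurable
  have b0: "cmod (f0 t) \<le> 1" for t using f(2) by (simp add: f0_def)
  have b1: "cmod (f1 t) \<le> 1" for t
    by (rule power2_le_imp_le) (simp_all add: f1sq)
  have L2b: "\<phi> \<in> L2 S" if "\<phi> \<in> borel_measurable lebesgue" "\<And>t. cmod (\<phi> t) \<le> 1" for \<phi>
    by (rule L2_bounded[OF S borel_measurable_lebesgue_on[OF that(1)] that(2)])
  define \<Phi> where "\<Phi> \<phi> t = indicator S t * \<phi> t" for \<phi> :: "'a \<Rightarrow> complex" and t
  have \<Phi>i: "integrable lebesgue (\<Phi> \<phi>)" and \<Phi>b: "cmod (\<Phi> \<phi> t) \<le> 1"
    if \<phi>: "\<phi> \<in> borel_measurable lebesgue" "\<And>t. cmod (\<phi> t) \<le> 1" for \<phi> t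
  proof -
    have [measurable]: "\<phi> \<in> borel_measurable lebesgue" "S \<in> sets lebesgue" by fact+
    have i: "integrable lebesgue (indicator S :: 'a \<Rightarrow> complex)" by (rule ft_indicator_mult_trig(2)[OF S])
    show "integrable lebesgue (\<Phi> \<phi>)"
      unfolding \<Phi>_def[abs_def]
      by (rule Bochner_Integration.integrable_bound[OF i]) (use \<phi>(2) in \<open>auto simp: norm_mult indicator_def\<close>)
    show "cmod (\<Phi> \<phi> t) \<le> 1" using \<phi>(2)[of t] by (simp add: \<Phi>_def norm_mult indicator_def)
  qed
  define tail where "tail \<phi> R = (LINT y|lborel. (cmod (ft (\<Phi> \<phi>) y))\<^sup>2 * indicator (- ball 0 R) y)" for \<phi> R
  have tails: "\<exists>R>0. \<forall>R'\<ge>R. tail \<phi> R' \<le> e"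
    if \<phi>: "\<phi> \<in> borel_measurable lebesgue" "\<And>t. cmod (\<phi> t) \<le> 1" for \<phi>
  proof -
    have i: "integrable lborel (\<lambda>y. (cmod (ft (\<Phi> \<phi>) y))\<^sup>2)" by (rule plancherel(2)[OF \<Phi>i[OF \<phi>] \<Phi>b[OF \<phi>]])
    obtain R where R: "R > 0" "tail \<phi> R < e"
      unfolding tail_def by (rule tail_integral_small[OF i _ e]) auto
    have fm: "ft (\<Phi> \<phi>) \<in> borel_measurable borel" by (rule borel_measurable_ft[OF \<Phi>i[OF \<phi>]])
    have iR: "integrable lborel (\<lambda>y. (cmod (ft (\<Phi> \<phi>) y))\<^sup>2 * indicator (- ball 0 R') y)" for R'
      by (rule Bochner_Integration.integrable_bound[OF i]) (use fm in \<open>auto simp: indicator_def\<close>)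
    have "tail \<phi> R' \<le> tail \<phi> R" if "R' \<ge> R" for R'
      unfolding tail_def by (rule integral_mono[OF iR iR]) (use that in \<open>auto simp: indicator_def\<close>)
    then show ?thesis using R by (meson less_imp_le order_trans)
  qed
  obtain R0 where R0: "R0 > 0" "\<forall>R'\<ge>R0. tail f0 R' \<le> e" using tails[OF m0 b0] by blast
  obtain R1 where R1: "R1 > 0" "\<forall>R'\<ge>R1. tail f1 R' \<le> e" using tails[OF m1 b1] by blast
  define R where "R = max R0 R1"
  have R: "R > 0" "tail f0 R \<le> e" "tail f1 R \<le> e" using R0 R1 by (auto simp: R_def)
  define n0 where "n0 = (L2_nrm S f)\<^sup>2"
  define n1 where "n1 = (L2_nrm S f1)\<^sup>2"
  have fL: "f \<in> L2 S" and f1L: "f1 \<in> L2 S" using L2b f m1 b1 by auto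
  have n01: "n0 + n1 = measure lebesgue S"
  proof -
    have "n0 + n1 = (LINT t|lebesgue_on S. (cmod (f t))\<^sup>2 + (cmod (f1 t))\<^sup>2)"
      unfolding n0_def n1_def L2_nrm_square
      by (rule Bochner_Integration.integral_add[symmetric]) (intro L2_integrable fL f1L)+
    also have "\<dots> = (L2_nrm S (expo 0))\<^sup>2" unfolding L2_nrm_square by (simp add: f1sq)
    finally show ?thesis by (simp only: L2_nrm_expo_square[OF S])
  qed
  have main: "card (\<Lambda> \<inter> ball x r) * (1 - \<eta>)
     \<le> measure lebesgue S * measure lborel (ball x (r + R)) - \<epsilon> * measure lborel (U \<inter> ball x (r + R))" for x r
  proof -
    define I where "I = \<Lambda> \<inter> ball x r"
    define B where "B = ball x (r + R)"
    have I: "finite I" "I \<subseteq> \<Lambda>" "I \<subseteq> ball x r"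
      unfolding I_def using \<Lambda> by (auto intro: uniform_discrete_imp_finite_Int)
    define M where "M = (\<lambda>z w. LINT t|lebesgue_on S. expo z t * cnj (expo w t))"
    have "hform I M c c = of_real ((L2_nrm S (trig I c))\<^sup>2)" for c
      unfolding M_def L2_nrm_square by (rule hform_gram(1)) (rule L2_measurable[OF expo_L2[OF S]], rule L2_integrable[OF expo_L2[OF S]])
    then have H: "Re (hform I M c c) = (L2_nrm S (trig I c))\<^sup>2" for c by simp
    have herm: "M w z = cnj (M z w)" for z w
      unfolding M_def by (rule gram_cnj)
    have coercive: "A * (\<Sum>z\<in>I. (cmod (c z))\<^sup>2) \<le> Re (hform I M c c)" for c
      unfolding H by (rule lower[OF I(1,2)])
    obtain g where g: "orthonormal_for I M g"
    proof (rule orthonormal_for_exists[OF I(1) herm])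
      fix c :: "'a \<Rightarrow> complex" assume "\<exists>i\<in>I. c i \<noteq> 0"
      then have "0 < (\<Sum>z\<in>I. (cmod (c z))\<^sup>2)" using I(1) by (auto intro: sum_pos2)
      then show "0 < Re (hform I M c c)" using coercive[of c] A by (meson less_le_trans mult_pos_pos)
    qed
    have farb: "(\<Sum>j\<in>I. (cmod (\<Sum>z\<in>I. g j z * b z))\<^sup>2) \<le> (\<Sum>z\<in>I. (cmod (b z))\<^sup>2) / A" for b
      by (rule orthonormal_bessel_coercive[OF g I(1) A herm coercive])
    have loc: "(\<Sum>j\<in>I. LINT t|lebesgue. (cmod (\<Phi> \<phi> t * trig I (g j) t))\<^sup>2) \<le> (LINT y|lborel. indicator B y * K y) + card I * e / A"
      if \<phi>: "\<phi> \<in> borel_measurable lebesgue" "\<And>t. cmod (\<phi> t) \<le> 1" and te: "tail \<phi> R \<le> e"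
        and Ki: "integrable lborel (\<lambda>y. indicator B y * K y)" and K0: "\<And>y. K y \<ge> 0"
        and K: "\<And>c y. (cmod (L2_inner S (trig I c) (\<lambda>t. expo y t * cnj (\<phi> t))))\<^sup>2 \<le> K y * (L2_nrm S (trig I c))\<^sup>2" for \<phi> K
    proof -
      have eq: "ft (\<lambda>t. \<Phi> \<phi> t * trig I c t) y = L2_inner S (trig I c) (\<lambda>t. expo y t * cnj (\<phi> t))" for c y
        unfolding \<Phi>_def by (rule L2_inner_expo_mult_eq_ft[OF Sl, symmetric])
      have "(\<Sum>j\<in>I. LINT t|lebesgue. (cmod (\<Phi> \<phi> t * trig I (g j) t))\<^sup>2)
        \<le> (LINT y|lborel. indicator B y * K y) + card I * tail \<phi> R / A"
        unfolding tail_def B_def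
      proof (rule localized_energy[OF \<Phi>i[OF \<phi>] \<Phi>b[OF \<phi>] I(1,3) Ki[unfolded B_def] _ A farb])
        fix y
        show "(\<Sum>j\<in>I. (cmod (ft (\<lambda>t. \<Phi> \<phi> t * trig I (g j) t) y))\<^sup>2) \<le> K y"
          unfolding ft_mult_sum_expo[OF \<Phi>i[OF \<phi>]]
        proof (rule orthonormal_bessel[OF g I(1) K0 herm])
          fix c
          show "(cmod (\<Sum>z\<in>I. c z * ft (\<Phi> \<phi>) (y - z)))\<^sup>2 \<le> K y * Re (hform I M c c)"
            unfolding H ft_mult_sum_expo[OF \<Phi>i[OF \<phi>], symmetric] eq by (rule K)
        qed
      qed
      also have "\<dots> \<le> (LINT y|lborel. indicator B y * K y) + card I * e / A"
        using te A by (intro add_left_mono divide_right_mono mult_left_mono) auto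
      finally show ?thesis .
    qed
    have cs: "(cmod (L2_inner S (trig I c) (\<lambda>t. expo y t * \<psi> t)))\<^sup>2 \<le> (L2_nrm S \<psi>)\<^sup>2 * (L2_nrm S (trig I c))\<^sup>2"
      if "\<psi> \<in> L2 S" for \<psi> c y
    proof -
      have "(cmod (L2_inner S (trig I c) (\<lambda>t. expo y t * \<psi> t)))\<^sup>2 \<le> (L2_nrm S (trig I c) * L2_nrm S (\<lambda>t. expo y t * \<psi> t))\<^sup>2"
        by (intro power_mono L2_Cauchy_Schwarz trig_L2[OF S] L2_expo_mult that) simp
      then show ?thesis unfolding L2_expo_mult(2)[OF that] by (simp add: power_mult_distrib mult.commute)
    qed
    define K0 where "K0 y = n0 - \<epsilon> * indicator U y" for y
    \<comment> \<open>The empty sum shows that \<epsilon> cannot exceed the squared norm of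
      \<open>f\<close> when \<open>U\<close> has a point, so \<open>K0\<close> is
      nonnegative.\<close>
    have far0: "\<epsilon> \<le> n0" if "y \<in> U" for y
      using far[OF that, of "{}"] L2_expo_mult(2)[OF fL, of y] by (simp add: n0_def)
    have K0bd: "(cmod (L2_inner S (trig I c) (\<lambda>t. expo y t * f t)))\<^sup>2 \<le> K0 y * (L2_nrm S (trig I c))\<^sup>2" for c y
    proof (cases "y \<in> U")
      case False
      then show ?thesis using cs[OF fL, of c y] by (simp add: K0_def n0_def)
    next
      case True
      define h where "h t = expo y t * f t" for t
      define G where "G = trig I c"
      define n where "n = (L2_nrm S G)\<^sup>2"
      have hL: "h \<in> L2 S" and hn: "(L2_nrm S h)\<^sup>2 = n0"
        unfolding h_def[abs_def] n0_def using L2_expo_mult[OF fL, of y] by auto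
      have GL: "G \<in> L2 S" unfolding G_def by (rule trig_L2[OF S])
      define p where "p = L2_inner S h G"
      have "(cmod p)\<^sup>2 \<le> (n0 - \<epsilon>) * n"
      proof (cases "n = 0")
        case True
        then have "L2_nrm S G = 0" by (simp add: n_def)
        then have "cmod p \<le> 0" using L2_Cauchy_Schwarz[OF hL GL] by (simp add: p_def)
        then show ?thesis using True by simp
      next
        case False
        then have n: "n > 0" unfolding n_def by (simp add: zero_less_power2)
        \<comment> \<open>\<open>p / n\<close> is the coefficient of the orthogonal projection of
          \<open>h\<close> onto \<open>G\<close>; the remaining squared distance is
          \<open>n0\<close> minus |p|^2 / n, and it is at least \<epsilon>.\<close>
        have tG: "(\<lambda>t. (p / n) * G t) = trig I (\<lambda>z. p / n * c z)"
          by (simp add: G_def sum_distrib_left mult.assoc)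
        have "\<epsilon> \<le> (L2_nrm S (\<lambda>t. h t - (p / n) * G t))\<^sup>2"
          unfolding h_def using far[OF \<open>y \<in> U\<close> I(1,2), of "\<lambda>z. p / n * c z"] unfolding tG[symmetric, THEN fun_cong] .
        also have "\<dots> = n0 - 2 * Re (L2_inner S h (\<lambda>t. (p / n) * G t)) + (L2_nrm S (\<lambda>t. (p / n) * G t))\<^sup>2"
          unfolding L2_nrm_diff_square[OF hL L2_scale[OF GL]] hn ..
        also have "L2_inner S h (\<lambda>t. (p / n) * G t) = cnj (p / n) * p"
          unfolding p_def L2_inner_def by (subst Bochner_Integration.integral_mult_right_zero[symmetric]) (simp add: mult_ac)
        also have "cnj (p / n) * p = of_real ((cmod p)\<^sup>2 / n)"
          unfolding of_real_divide complex_norm_square by (simp add: mult.commute)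
        also have "(L2_nrm S (\<lambda>t. (p / n) * G t))\<^sup>2 = (cmod p)\<^sup>2 / n"
          using n by (simp add: L2_nrm_square norm_mult power_mult_distrib norm_divide power_divide n_def[unfolded L2_nrm_square, symmetric] power2_eq_square[of n])
        finally have "(cmod p)\<^sup>2 / n \<le> n0 - \<epsilon>" by simp
        then show ?thesis using n by (simp add: pos_divide_le_eq)
      qed
      moreover have "cmod (L2_inner S (trig I c) (\<lambda>t. expo y t * f t)) = cmod p"
        unfolding p_def G_def h_def[abs_def] by (subst L2_inner_commute) simp
      ultimately show ?thesis using True by (simp add: K0_def n_def G_def)
    qed
    have K0p: "K0 y \<ge> 0" for y using far0[of y] by (auto simp: K0_def n0_def indicator_def)
    have iB: "integrable lborel (\<lambda>y. indicator B y * k)" for k :: real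
      unfolding B_def by (intro integrable_mult_left integrable_indicator_ball)
    have iUB: "integrable lborel (\<lambda>y. indicator (U \<inter> B) y :: real)"
      using U unfolding B_def by (intro Bochner_Integration.integrable_bound[OF integrable_indicator_ball(1)[of x "r + R"]]) (auto simp: indicator_def)
    have eqK: "(\<lambda>y. indicator B y * K0 y) = (\<lambda>y. indicator B y * n0 - \<epsilon> * indicator (U \<inter> B) y)"
      by (auto simp: K0_def indicator_def)
    have iK: "integrable lborel (\<lambda>y. indicator B y * K0 y)"
      unfolding eqK by (intro Bochner_Integration.integrable_diff iB integrable_mult_right iUB)
    have K0int: "(LINT y|lborel. indicator B y * K0 y) = n0 * measure lborel B - \<epsilon> * measure lborel (U \<inter> B)"
      unfolding eqK using iB[of n0] iUB by (simp add: mult.commute)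
    define T where "T = card I * e / A"
    have p0: "(\<Sum>j\<in>I. LINT t|lebesgue. (cmod (\<Phi> f0 t * trig I (g j) t))\<^sup>2) \<le> (n0 * measure lborel B - \<epsilon> * measure lborel (U \<inter> B)) + T"
      unfolding K0int[symmetric] T_def
      by (rule loc[OF m0 b0 R(2) iK K0p]) (use K0bd in \<open>simp add: f0_def\<close>)
    have p1: "(\<Sum>j\<in>I. LINT t|lebesgue. (cmod (\<Phi> f1 t * trig I (g j) t))\<^sup>2) \<le> n1 * measure lborel B + T"
    proof -
      have "(\<Sum>j\<in>I. LINT t|lebesgue. (cmod (\<Phi> f1 t * trig I (g j) t))\<^sup>2) \<le> (LINT y|lborel. indicator B y * n1) + T"
        unfolding T_def
        by (rule loc[OF m1 b1 R(3) iB]) (use cs[OF f1L] in \<open>simp_all add: n1_def f1_def\<close>)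
      then show ?thesis by (simp add: mult.commute)
    qed
    have "real (card I) = (\<Sum>j\<in>I. Re (hform I M (g j) (g j)))"
      using g by (simp add: orthonormal_for_def)
    also have "\<dots> = (\<Sum>j\<in>I. (LINT t|lebesgue. (cmod (\<Phi> f0 t * trig I (g j) t))\<^sup>2) + (LINT t|lebesgue. (cmod (\<Phi> f1 t * trig I (g j) t))\<^sup>2))"
    proof (rule sum.cong[OF refl])
      fix j
      have "Re (hform I M (g j) (g j)) = (LINT t|lebesgue. (cmod (indicator S t * trig I (g j) t))\<^sup>2)"
        unfolding H L2_nrm_square_indicator[OF Sl] ..
      also have "\<dots> = (LINT t|lebesgue. (cmod (\<Phi> f0 t * trig I (g j) t))\<^sup>2 + (cmod (\<Phi> f1 t * trig I (g j) t))\<^sup>2)"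
      proof (rule Bochner_Integration.integral_cong[OF refl])
        fix t
        show "(cmod (indicator S t * trig I (g j) t))\<^sup>2 = (cmod (\<Phi> f0 t * trig I (g j) t))\<^sup>2 + (cmod (\<Phi> f1 t * trig I (g j) t))\<^sup>2"
          unfolding \<Phi>_def norm_mult power_mult_distrib f1sq by (simp add: f0_def indicator_def algebra_simps)
      qed
      also have "\<dots> = (LINT t|lebesgue. (cmod (\<Phi> f0 t * trig I (g j) t))\<^sup>2) + (LINT t|lebesgue. (cmod (\<Phi> f1 t * trig I (g j) t))\<^sup>2)"
        by (rule Bochner_Integration.integral_add)
          (rule integrable_square_if_bounded[OF integrable_mult_trig[OF \<Phi>i[OF m0 b0] \<Phi>b[OF m0 b0]]],
           rule integrable_square_if_bounded[OF integrable_mult_trig[OF \<Phi>i[OF m1 b1] \<Phi>b[OF m1 b1]]])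
      finally show "Re (hform I M (g j) (g j)) = (LINT t|lebesgue. (cmod (\<Phi> f0 t * trig I (g j) t))\<^sup>2) + (LINT t|lebesgue. (cmod (\<Phi> f1 t * trig I (g j) t))\<^sup>2)" .
    qed
    also have "\<dots> \<le> ((n0 * measure lborel B - \<epsilon> * measure lborel (U \<inter> B)) + T) + (n1 * measure lborel B + T)"
      unfolding sum.distrib by (rule add_mono[OF p0 p1])
    finally have "real (card I) \<le> (n0 + n1) * measure lborel B - \<epsilon> * measure lborel (U \<inter> B) + 2 * T"
      by (simp add: distrib_right)
    also have "2 * T = card I * \<eta>" using A by (simp add: T_def e_def)
    finally show ?thesis unfolding n01 I_def[symmetric] B_def[symmetric] by (simp add: right_diff_distrib)
  qed
  show ?thesis using main R(1) by blast
qed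

section \<open>Volumes of balls and relatively dense sets\<close>

lemma measure_ball_pos:
  assumes "r > 0"
  shows "measure lborel (ball (x::'a::euclidean_space) r) > 0"
  using content_ball_pos[OF assms, of x] by simp

lemma measure_ball_eq:
  assumes "r \<ge> 0"
  shows "measure lborel (ball (x::'a::euclidean_space) r) = unit_ball_vol (real DIM('a)) * r ^ DIM('a)"
  using content_ball[OF assms, of x] by simp

text \<open>The counting lemmas change radii by constants; in the limit these changes do not affect
  densities.\<close>

lemma measure_ball_ratio_tendsto:
  "((\<lambda>r. measure lborel (ball (x::'a::euclidean_space) (r + a)) / measure lborel (ball (0::'a) r)) \<longlongrightarrow> 1) at_top"
proof -
  have u: "unit_ball_vol (real DIM('a)) \<noteq> 0" using measure_ball_pos[of 1 "0::'a"] measure_ball_eq[of 1 "0::'a"] by auto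
  have "((\<lambda>r::real. a / r) \<longlongrightarrow> 0) at_top"
    by (intro tendsto_divide_0[OF tendsto_const] filterlim_at_top_imp_at_infinity filterlim_ident)
  then have "((\<lambda>r::real. (1 + a / r) ^ DIM('a)) \<longlongrightarrow> (1 + 0) ^ DIM('a)) at_top"
    by (intro tendsto_intros)
  then have lim: "((\<lambda>r::real. (1 + a / r) ^ DIM('a)) \<longlongrightarrow> 1) at_top" by simp
  have "eventually (\<lambda>r. (1 + a / r) ^ DIM('a) = measure lborel (ball x (r + a)) / measure lborel (ball (0::'a) r)) at_top"
    using eventually_gt_at_top[of "max 0 (- a)"]
  proof eventually_elim
    case (elim r)
    then have "1 + a / r = (r + a) / r" by (simp add: field_simps)
    then show ?case using elim u by (simp add: measure_ball_eq power_divide)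
  qed
  with lim show ?thesis by (rule Lim_transform_eventually)
qed

lemma measure_ball_center: "measure lborel (ball (x::'a::euclidean_space) r) = measure lborel (ball (0::'a) r)"
  by (cases "r \<ge> 0") (simp_all add: measure_ball_eq ball_empty)

lemma fmeasurable_ball: "ball (x::'a::euclidean_space) r \<in> fmeasurable lborel"
  by (rule fmeasurableI) (use emeasure_lborel_ball_finite[of x r] in auto)

lemma relatively_dense_card:
  fixes B :: "'a::euclidean_space set"
  assumes B: "UNIV = (\<Union>l\<in>B. ball l \<rho>)" and fin: "finite (B \<inter> ball x r)"
  shows "measure lborel (ball x (r - \<rho>)) \<le> card (B \<inter> ball x r) * measure lborel (ball (0::'a) \<rho>)"
proof -
  have sub: "ball x (r - \<rho>) \<subseteq> (\<Union>l\<in>B \<inter> ball x r. ball l \<rho>)"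
  proof
    fix t assume t: "t \<in> ball x (r - \<rho>)"
    have "t \<in> (\<Union>l\<in>B. ball l \<rho>)" unfolding B[symmetric] by simp
    then obtain l where l: "l \<in> B" "t \<in> ball l \<rho>" by (rule UN_E)
    moreover have "dist x l < r" using dist_triangle2[of x l t] t l(2) by (simp add: dist_commute)
    ultimately show "t \<in> (\<Union>l\<in>B \<inter> ball x r. ball l \<rho>)" by auto
  qed
  have "measure lborel (ball x (r - \<rho>)) \<le> measure lborel (\<Union>l\<in>B \<inter> ball x r. ball l \<rho>)"
    by (rule measure_mono_fmeasurable[OF sub _ fmeasurable.finite_UN[OF fin fmeasurable_ball]]) simp
  also have "\<dots> \<le> (\<Sum>l\<in>B \<inter> ball x r. measure lborel (ball l \<rho>))"
    by (rule measure_UNION_le[OF fin]) simp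
  also have "\<dots> = card (B \<inter> ball x r) * measure lborel (ball (0::'a) \<rho>)"
    by (subst sum.cong[OF refl measure_ball_center]) simp
  finally show ?thesis .
qed

text \<open>As \<open>B\<close> need not be separated, the balls of radius \<delta> may overlap.
  Vitali's lemma selects centres whose balls of radius \<rho> are disjoint while those of radius
  \<open>5 * \<rho>\<close> still cover; the smaller balls about these centres are disjoint
  too.\<close>

lemma relatively_dense_volume:
  fixes B :: "'a::euclidean_space set"
  assumes B: "UNIV = (\<Union>l\<in>B. ball l \<rho>)" and \<delta>: "0 < \<delta>" "\<delta> \<le> \<rho>"
  shows "measure lborel (ball x (r - 2 * \<rho>)) * measure lborel (ball (0::'a) \<delta>)
    \<le> measure lborel ((\<Union>l\<in>B. ball l \<delta>) \<inter> ball x r) * measure lborel (ball (0::'a) (5 * \<rho>))"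
proof -
  \<comment> \<open>The closed ball is compact, so finitely many centres suffice; they stay in
    \<open>ball x (r - \<rho>)\<close>, hence their balls of radius \<delta> stay in
    \<open>ball x r\<close>.\<close>
  have "compact (cball x (r - 2 * \<rho>))" by simp
  moreover have "cball x (r - 2 * \<rho>) \<subseteq> (\<Union>l\<in>B \<inter> ball x (r - \<rho>). ball l \<rho>)"
  proof
    fix t assume t: "t \<in> cball x (r - 2 * \<rho>)"
    have "t \<in> (\<Union>l\<in>B. ball l \<rho>)" unfolding B[symmetric] by simp
    then obtain l where l: "l \<in> B" "t \<in> ball l \<rho>" by (rule UN_E)
    moreover have "dist x l < r - \<rho>" using dist_triangle2[of x l t] t l(2) by (simp add: dist_commute)
    ultimately show "t \<in> (\<Union>l\<in>B \<inter> ball x (r - \<rho>). ball l \<rho>)" by auto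
  qed
  ultimately obtain K where K: "K \<subseteq> B \<inter> ball x (r - \<rho>)" "finite K" "cball x (r - 2 * \<rho>) \<subseteq> (\<Union>l\<in>K. ball l \<rho>)"
    using compactE_image[of "cball x (r - 2 * \<rho>)" "B \<inter> ball x (r - \<rho>)" "\<lambda>l. ball l \<rho>"] by auto
  have "\<exists>C. C \<subseteq> K \<and> pairwise (\<lambda>i j. disjnt (ball i \<rho>) (ball j \<rho>)) C \<and> cball x (r - 2 * \<rho>) \<subseteq> (\<Union>i\<in>C. ball i (5 * \<rho>))"
    by (rule Vitali_covering_lemma_balls[OF K(3), of \<rho>]) (use \<delta> in auto)
  then obtain C where C: "C \<subseteq> K" "pairwise (\<lambda>i j. disjnt (ball i \<rho>) (ball j \<rho>)) C" "cball x (r - 2 * \<rho>) \<subseteq> (\<Union>i\<in>C. ball i (5 * \<rho>))"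
    by (elim exE conjE)
  have Cfin: "finite C" using C(1) K(2) by (rule finite_subset)
  have "measure lborel (ball x (r - 2 * \<rho>)) \<le> measure lborel (\<Union>i\<in>C. ball i (5 * \<rho>))"
  proof (rule measure_mono_fmeasurable[OF _ _ fmeasurable.finite_UN[OF Cfin fmeasurable_ball]])
    show "ball x (r - 2 * \<rho>) \<subseteq> (\<Union>i\<in>C. ball i (5 * \<rho>))"
      using ball_subset_cball C(3) by (rule order_trans)
  qed simp
  also have "\<dots> \<le> (\<Sum>i\<in>C. measure lborel (ball i (5 * \<rho>)))"
    by (rule measure_UNION_le[OF Cfin]) simp
  also have "\<dots> = card C * measure lborel (ball (0::'a) (5 * \<rho>))" by (subst sum.cong[OF refl measure_ball_center]) simp
  finally have 1: "measure lborel (ball x (r - 2 * \<rho>)) \<le> card C * measure lborel (ball (0::'a) (5 * \<rho>))" .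
  have dis: "disjoint_family_on (\<lambda>i. ball i \<delta>) C"
    unfolding disjoint_family_on_def
  proof (intro ballI impI)
    fix i j assume "i \<in> C" "j \<in> C" "i \<noteq> j"
    then have "ball i \<rho> \<inter> ball j \<rho> = {}" using C(2) by (simp add: pairwise_def disjnt_def)
    then show "ball i \<delta> \<inter> ball j \<delta> = {}" using subset_ball[OF \<delta>(2), of i] subset_ball[OF \<delta>(2), of j] by blast
  qed
  have "card C * measure lborel (ball (0::'a) \<delta>) = (\<Sum>i\<in>C. measure lborel (ball i \<delta>))"
    by (subst sum.cong[OF refl measure_ball_center]) simp
  also have "\<dots> = measure lborel (\<Union>i\<in>C. ball i \<delta>)"
    by (rule measure_finite_Union[symmetric, OF Cfin _ dis]) (use emeasure_lborel_ball_finite in \<open>auto simp: less_top[symmetric]\<close>)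
  also have "\<dots> \<le> measure lborel ((\<Union>l\<in>B. ball l \<delta>) \<inter> ball x r)"
  proof (rule measure_mono_fmeasurable)
    show "(\<Union>i\<in>C. ball i \<delta>) \<subseteq> (\<Union>l\<in>B. ball l \<delta>) \<inter> ball x r"
    proof
      fix t assume "t \<in> (\<Union>i\<in>C. ball i \<delta>)"
      then obtain i where i: "i \<in> C" "dist i t < \<delta>" by auto
      then have "i \<in> B" "dist x i < r - \<rho>" using C(1) K(1) by auto
      then show "t \<in> (\<Union>l\<in>B. ball l \<delta>) \<inter> ball x r"
        using i(2) \<delta>(2) dist_triangle[of x t i] by auto
    qed
    show "(\<Union>l\<in>B. ball l \<delta>) \<inter> ball x r \<in> fmeasurable lborel"
      by (rule fmeasurableI2[OF fmeasurable_ball[of x r]]) (auto intro: borel_open)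
  qed (use Cfin in auto)
  finally have 2: "card C * measure lborel (ball (0::'a) \<delta>) \<le> measure lborel ((\<Union>l\<in>B. ball l \<delta>) \<inter> ball x r)" .
  have "measure lborel (ball x (r - 2 * \<rho>)) * measure lborel (ball (0::'a) \<delta>)
    \<le> (card C * measure lborel (ball (0::'a) (5 * \<rho>))) * measure lborel (ball (0::'a) \<delta>)"
    by (rule mult_right_mono[OF 1]) simp
  also have "\<dots> = (card C * measure lborel (ball (0::'a) \<delta>)) * measure lborel (ball (0::'a) (5 * \<rho>))" by simp
  also have "\<dots> \<le> measure lborel ((\<Union>l\<in>B. ball l \<delta>) \<inter> ball x r) * measure lborel (ball (0::'a) (5 * \<rho>))"
    by (rule mult_right_mono[OF 2]) simp
  finally show ?thesis .
qed


section \<open>Beurling densities\<close>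

lemma count_div_ball:
  fixes \<Lambda> :: "'a::euclidean_space set"
  assumes "uniform_discrete \<Lambda>" "r > 0"
  shows "emeasure (count_space UNIV) (\<Lambda> \<inter> ball x r) / emeasure lebesgue (ball (0::'a) r)
    = ennreal (card (\<Lambda> \<inter> ball x r) / measure lborel (ball (0::'a) r))"
proof -
  have fin: "finite (\<Lambda> \<inter> ball x r)" using assms(1) bounded_ball by (rule uniform_discrete_imp_finite_Int)
  have "emeasure lebesgue (ball (0::'a) r) = ennreal (measure lborel (ball (0::'a) r))"
    using emeasure_lborel_ball_finite[of "0::'a" r] by (simp add: emeasure_eq_ennreal_measure less_top[symmetric])
  then show ?thesis
    using fin measure_ball_pos[OF assms(2), of "0::'a"]
    by (simp add: divide_ennreal ennreal_of_nat_eq_real_of_nat)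
qed

lemma lower_Beurling_density_ge:
  fixes \<Lambda> :: "'a::euclidean_space set"
  assumes \<Lambda>: "uniform_discrete \<Lambda>"
    and ev: "eventually (\<lambda>r. \<forall>x. m \<le> card (\<Lambda> \<inter> ball x r) / measure lborel (ball (0::'a) r)) at_top"
  shows "ennreal m \<le> lower_Beurling_density \<Lambda>"
  unfolding lower_Beurling_density_def
proof (rule Liminf_bounded)
  show "eventually (\<lambda>r. ennreal m \<le> (INF x. emeasure (count_space UNIV) (\<Lambda> \<inter> ball x r) / emeasure lebesgue (ball (0::'a) r))) at_top"
    using ev eventually_gt_at_top[of 0]
  proof eventually_elim
    case (elim r)
    then show ?case by (intro INF_greatest) (simp only: count_div_ball[OF \<Lambda> elim(2)] ennreal_leI)
  qed
qed

lemma upper_Beurling_density_le: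
  fixes \<Lambda> :: "'a::euclidean_space set"
  assumes \<Lambda>: "uniform_discrete \<Lambda>"
    and ev: "eventually (\<lambda>r. \<forall>x. card (\<Lambda> \<inter> ball x r) / measure lborel (ball (0::'a) r) \<le> m) at_top"
  shows "upper_Beurling_density \<Lambda> \<le> ennreal m"
  unfolding upper_Beurling_density_def
proof (rule Limsup_bounded)
  show "eventually (\<lambda>r. (SUP x. emeasure (count_space UNIV) (\<Lambda> \<inter> ball x r) / emeasure lebesgue (ball (0::'a) r)) \<le> ennreal m) at_top"
    using ev eventually_gt_at_top[of 0]
  proof eventually_elim
    case (elim r)
    then show ?case by (intro SUP_least) (simp only: count_div_ball[OF \<Lambda> elim(2)] ennreal_leI)
  qed
qed

lemma emeasure_lmeasurable: "S \<in> lmeasurable \<Longrightarrow> emeasure lebesgue S = ennreal (measure lebesgue S)"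
  by (rule emeasure_eq_measure2)

text \<open>S may be unbounded, but its parts in large cubes exhaust its measure.\<close>

lemma measure_cube_Diff_le:
  fixes S :: "'a::euclidean_space set"
  assumes S: "S \<in> lmeasurable" and "\<kappa> > 0"
  shows "\<exists>N>0. measure lebesgue (cube N - S) \<le> N ^ DIM('a) - measure lebesgue S + \<kappa>"
proof -
  have Sl: "S \<in> sets lebesgue" using S by (rule fmeasurableD)
  have cl: "cube N \<in> (lmeasurable :: 'a set set)" for N unfolding cube_def by (rule lmeasurable_cbox)
  have "(\<lambda>n. measure lebesgue (S \<inter> cube (real n))) \<longlonglongrightarrow> measure lebesgue (\<Union>n. S \<inter> cube (real n))"
  proof (rule Lim_measure_incseq)
    show "range (\<lambda>n. S \<inter> cube (real n)) \<subseteq> sets lebesgue" using Sl fmeasurableD[OF cl] by auto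
    show "incseq (\<lambda>n. S \<inter> cube (real n))" by (force simp: incseq_def mem_cube)
    have "emeasure lebesgue (\<Union>n. S \<inter> cube (real n)) \<le> emeasure lebesgue S"
      by (rule emeasure_mono[OF _ Sl]) auto
    then show "emeasure lebesgue (\<Union>n. S \<inter> cube (real n)) \<noteq> \<infinity>"
      using fmeasurableD2[OF S] by (auto simp: top_unique)
  qed
  also have "(\<Union>n. S \<inter> cube (real n)) = S"
  proof -
    have "\<exists>n::nat. t \<in> cube (real n)" for t :: 'a
    proof -
      obtain n :: nat where n: "2 * norm t \<le> n" using real_arch_simple by blast
      have "\<bar>t \<bullet> b\<bar> \<le> real n / 2" if "b \<in> Basis" for b using Basis_le_norm[OF that, of t] n by simp
      then show ?thesis by (auto simp: mem_cube)
    qed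
    then show ?thesis by auto
  qed
  finally have "eventually (\<lambda>n. measure lebesgue S - \<kappa> < measure lebesgue (S \<inter> cube (real n))) sequentially"
    by (rule order_tendstoD) (use \<open>\<kappa> > 0\<close> in simp)
  then obtain n0 where n0: "\<forall>n\<ge>n0. measure lebesgue S - \<kappa> < measure lebesgue (S \<inter> cube (real n))"
    by (auto simp: eventually_sequentially)
  \<comment> \<open>The successor keeps \<open>N\<close> positive.\<close>
  define N where "N = real (Suc n0)"
  have N: "N > 0" "measure lebesgue S - \<kappa> < measure lebesgue (S \<inter> cube N)"
    unfolding N_def by (simp, rule n0[rule_format]) simp
  have "measure lebesgue ((S \<inter> cube N) \<union> (cube N - S)) = measure lebesgue (S \<inter> cube N) + measure lebesgue (cube N - S)"
  proof (rule measure_Union)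
    show "emeasure lebesgue (S \<inter> cube N) \<noteq> \<infinity>" "emeasure lebesgue (cube N - S) \<noteq> \<infinity>"
      using fmeasurableD2[OF fmeasurable_Int_fmeasurable[OF S fmeasurableD[OF cl]]] fmeasurableD2[OF fmeasurable_Diff[OF cl Sl]] by auto
  qed (use Sl fmeasurableD[OF cl] in auto)
  moreover have "(S \<inter> cube N) \<union> (cube N - S) = cube N" by auto
  moreover have "measure lebesgue (cube N :: 'a set) = N ^ DIM('a)"
    using measure_cube(2)[OF N(1), where 'a = 'a] by (simp add: measure_completion)
  ultimately show ?thesis using N by (intro exI[of _ N]) auto
qed

section \<open>Frames of critical lower density\<close>

text \<open>A relatively dense bad set has at least about 1/v points per unit volume, and each takes
  \<epsilon> off the upper bound for the trace in \<open>frame_count\<close>. Then \<Lambda> must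
  have a lower density above |S|, by a margin that does not depend on the cube.\<close>

lemma frame_bad_not_relatively_dense:
  fixes S \<Lambda> :: "'a::euclidean_space set" and \<epsilon> :: real
  assumes S: "S \<in> lmeasurable"
    and \<sigma>: "\<sigma> > 0" "\<And>x y. x \<in> \<Lambda> \<Longrightarrow> y \<in> \<Lambda> \<Longrightarrow> x \<noteq> y \<Longrightarrow> \<sigma> \<le> dist x y"
    and \<Lambda>: "uniform_discrete \<Lambda>"
    and A: "A > 0"
    and sm: "\<And>f. f \<in> L2 S \<Longrightarrow> (\<lambda>l. (cmod (L2_inner S f (expo l)))\<^sup>2) summable_on \<Lambda>"
    and lower: "\<And>f. f \<in> L2 S \<Longrightarrow> A * (L2_nrm S f)\<^sup>2 \<le> (\<Sum>\<^sub>\<infinity>l\<in>\<Lambda>. (cmod (L2_inner S f (expo l)))\<^sup>2)"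
    and Bad: "Bad \<subseteq> \<Lambda>" "0 < \<epsilon>" "\<epsilon> \<le> 1"
      "\<And>f l. f \<in> L2 S \<Longrightarrow> l \<in> Bad \<Longrightarrow>
         (cmod (L2_inner S f (expo l)))\<^sup>2 \<le> (1 - \<epsilon>) * (\<Sum>\<^sub>\<infinity>l\<in>\<Lambda>. (cmod (L2_inner S f (expo l)))\<^sup>2)"
    and density: "lower_Beurling_density \<Lambda> = emeasure lebesgue S"
  shows "\<not> relatively_dense Bad"
proof
  assume "relatively_dense Bad"
  then obtain \<rho> where \<rho>: "\<rho> > 0" "UNIV = (\<Union>l\<in>Bad. ball l \<rho>)" unfolding relatively_dense_def by (elim exE conjE)
  define V where "V r = measure lborel (ball (0::'a) r)" for r
  have V0: "V r > 0" if "r > 0" for r using measure_ball_pos[OF that] by (simp add: V_def)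
  define v where "v = V \<rho>"
  have v: "v > 0" using V0[OF \<rho>(1)] by (simp add: v_def)
  \<comment> \<open>The gain is \<open>\<epsilon> / v = 4 * \<kappa>\<close>. One \<kappa> is lost
    to the part of S outside the cube and one to \<eta>, and the excess over |S| is still more than
    \<kappa>.\<close>
  define \<kappa> where "\<kappa> = \<epsilon> / (4 * v)"
  have \<kappa>: "\<kappa> > 0" using Bad(2) v by (simp add: \<kappa>_def)
  obtain N where N: "N > 0" "measure lebesgue (cube N - S) \<le> N ^ DIM('a) - measure lebesgue S + \<kappa>"
    using measure_cube_Diff_le[OF S \<kappa>] by blast
  define d where "d = real DIM('a)"
  define P where "P = N ^ DIM('a)"
  have P: "P > 0" using N by (simp add: P_def)
  \<comment> \<open>\<open>1 / 2\<close> keeps \<open>1 - \<eta>\<close> positive; the other bound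
    makes the loss \<open>\<eta> * P\<close> at most \<kappa>.\<close>
  define \<eta> where "\<eta> = min (1 / 2) (\<kappa> / P)"
  have \<eta>: "\<eta> > 0" "\<eta> < 1" using \<kappa> P by (auto simp: \<eta>_def)
  have "\<eta> * P \<le> \<kappa> / P * P" using P by (intro mult_right_mono) (auto simp: \<eta>_def)
  then have \<eta>P: "\<eta> * P \<le> \<kappa>" using P by simp
  define D where "D = measure lebesgue (cube N - S)"
  obtain R where R: "R > 0" and count: "\<forall>x r. card (scaled_lattice N \<inter> ball x r) * (1 - \<eta>)
     \<le> card (\<Lambda> \<inter> ball x (r + R)) - \<epsilon> * card (Bad \<inter> ball x (r + R)) + D * measure lborel (ball x (r + R))"
    using frame_count[OF S \<sigma> A sm lower Bad N(1) \<eta>(1)] unfolding D_def by blast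
  have lb: "(1 - \<eta>) * P * V (s + (- R - d / N)) + \<epsilon> / v * V (s + - \<rho>) - D * V s \<le> card (\<Lambda> \<inter> ball x s)" for x s
  proof -
    have "P * V (s + (- R - d / N)) \<le> card (scaled_lattice N \<inter> ball x (s - R))"
      using scaled_lattice_count[OF N(1), of x "s - R"] measure_ball_center[of x "s - R - d / N"]
      by (simp add: P_def V_def d_def algebra_simps)
    then have 1: "P * V (s + (- R - d / N)) * (1 - \<eta>) \<le> card (scaled_lattice N \<inter> ball x (s - R)) * (1 - \<eta>)"
      by (rule mult_right_mono) (use \<eta> in simp)
    have fin: "finite (Bad \<inter> ball x s)"
      by (rule finite_subset[of _ "\<Lambda> \<inter> ball x s"]) (use Bad(1) uniform_discrete_imp_finite_Int[OF \<Lambda> bounded_ball] in auto)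
    have "V (s - \<rho>) \<le> card (Bad \<inter> ball x s) * v"
      using relatively_dense_card[OF \<rho>(2) fin] measure_ball_center[of x "s - \<rho>"] by (simp add: V_def v_def)
    then have "V (s - \<rho>) / v \<le> card (Bad \<inter> ball x s)" using v by (simp add: pos_divide_le_eq)
    then have 2: "\<epsilon> * (V (s - \<rho>) / v) \<le> \<epsilon> * card (Bad \<inter> ball x s)"
      by (rule mult_left_mono) (use Bad in simp)
    have 3: "card (scaled_lattice N \<inter> ball x (s - R)) * (1 - \<eta>)
     \<le> card (\<Lambda> \<inter> ball x s) - \<epsilon> * card (Bad \<inter> ball x s) + D * V s"
      using count[rule_format, of x "s - R"] measure_ball_center[of x s] by (simp add: V_def)
    have e1: "(1 - \<eta>) * P * V (s + (- R - d / N)) = P * V (s + (- R - d / N)) * (1 - \<eta>)" by simp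
    have e2: "\<epsilon> / v * V (s + - \<rho>) = \<epsilon> * (V (s - \<rho>) / v)" by simp
    show ?thesis unfolding e1 e2 using 1 2 3 by linarith
  qed
  have ratio: "((\<lambda>s. V (s + a) / V s) \<longlongrightarrow> 1) at_top" for a
    unfolding V_def by (rule measure_ball_ratio_tendsto)
  have "((\<lambda>s. (1 - \<eta>) * P * (V (s + (- R - d / N)) / V s) + \<epsilon> / v * (V (s + - \<rho>) / V s) - D) \<longlongrightarrow>
     (1 - \<eta>) * P * 1 + \<epsilon> / v * 1 - D) at_top"
    by (intro tendsto_intros ratio)
  moreover have "measure lebesgue S + \<kappa> < (1 - \<eta>) * P * 1 + \<epsilon> / v * 1 - D"
  proof -
    have "\<epsilon> / v = 4 * \<kappa>" using v by (simp add: \<kappa>_def)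
    moreover have "(1 - \<eta>) * P = P - \<eta> * P" by (simp add: left_diff_distrib)
    ultimately show ?thesis using N(2) \<eta>P \<kappa> unfolding D_def[symmetric] P_def[symmetric] by simp
  qed
  ultimately have "eventually (\<lambda>s. measure lebesgue S + \<kappa> < (1 - \<eta>) * P * (V (s + (- R - d / N)) / V s) + \<epsilon> / v * (V (s + - \<rho>) / V s) - D) at_top"
    by (rule order_tendstoD)
  then have "eventually (\<lambda>s. \<forall>x. measure lebesgue S + \<kappa> \<le> card (\<Lambda> \<inter> ball x s) / measure lborel (ball (0::'a) s)) at_top"
    using eventually_gt_at_top[of 0]
  proof eventually_elim
    case (elim s)
    have Vs: "V s > 0" by (rule V0[OF elim(2)])
    show ?case
    proof
      fix x
      have "(1 - \<eta>) * P * (V (s + (- R - d / N)) / V s) + \<epsilon> / v * (V (s + - \<rho>) / V s) - D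
        = ((1 - \<eta>) * P * V (s + (- R - d / N)) + \<epsilon> / v * V (s + - \<rho>) - D * V s) / V s"
        using Vs by (simp add: add_divide_distrib diff_divide_distrib)
      also have "\<dots> \<le> card (\<Lambda> \<inter> ball x s) / V s"
        by (rule divide_right_mono[OF lb]) (use Vs in simp)
      finally show "measure lebesgue S + \<kappa> \<le> card (\<Lambda> \<inter> ball x s) / measure lborel (ball (0::'a) s)"
        using elim(1) by (simp add: V_def)
    qed
  qed
  then have "ennreal (measure lebesgue S + \<kappa>) \<le> lower_Beurling_density \<Lambda>"
    by (rule lower_Beurling_density_ge[OF \<Lambda>])
  then show False unfolding density emeasure_lmeasurable[OF S] using \<kappa> by (simp add: ennreal_le_iff)
qed

section \<open>Almost biorthogonal functions and the lower Riesz inequality\<close>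

lemma modulation_continuous:
  assumes f: "f \<in> L2 S" and "\<tau> > 0"
  shows "\<exists>\<delta>>0. \<forall>u. norm u < \<delta> \<longrightarrow> L2_nrm S (\<lambda>t. expo u t * f t - f t) < \<tau>"
proof (rule ccontr)
  assume "\<not> ?thesis"
  then have "\<exists>u. norm u < \<delta> \<and> \<tau> \<le> L2_nrm S (\<lambda>t. expo u t * f t - f t)" if "\<delta> > 0" for \<delta>
    using that by (meson not_less)
  then have "\<exists>u. norm u < 1 / real (Suc n) \<and> \<tau> \<le> L2_nrm S (\<lambda>t. expo u t * f t - f t)" for n
    by simp
  then have "\<exists>u. \<forall>n. norm (u n) < 1 / real (Suc n) \<and> \<tau> \<le> L2_nrm S (\<lambda>t. expo (u n) t * f t - f t)"
    by (intro choice allI)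
  then obtain u where u: "\<forall>n. norm (u n) < 1 / real (Suc n) \<and> \<tau> \<le> L2_nrm S (\<lambda>t. expo (u n) t * f t - f t)" ..
  have u0: "u \<longlonglongrightarrow> 0"
  proof (rule Lim_null_comparison)
    show "eventually (\<lambda>n. norm (u n) \<le> inverse (real (Suc n))) sequentially"
      using u by (intro always_eventually allI) (simp add: inverse_eq_divide less_imp_le)
    show "(\<lambda>n. inverse (real (Suc n))) \<longlonglongrightarrow> 0" by (rule LIMSEQ_inverse_real_of_nat)
  qed
  have L: "(\<lambda>t. expo (u n) t * f t - f t) \<in> L2 S" for n by (intro L2_diff L2_expo_mult f)
  \<comment> \<open>On an unbounded set the exponentials need not tend to 1 uniformly, so the
    convergence is obtained by domination.\<close>
  have "(\<lambda>n. LINT t|lebesgue_on S. (cmod (expo (u n) t * f t - f t))\<^sup>2) \<longlonglongrightarrow> (LINT t|lebesgue_on S. 0)"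
  proof (rule integral_dominated_convergence[where w = "\<lambda>t. 4 * (cmod (f t))\<^sup>2"])
    show "integrable (lebesgue_on S) (\<lambda>t. 4 * (cmod (f t))\<^sup>2)" using L2_integrable[OF f] by simp
    show "(\<lambda>t. (cmod (expo (u n) t * f t - f t))\<^sup>2) \<in> borel_measurable (lebesgue_on S)" for n
      by (rule borel_measurable_integrable[OF L2_integrable[OF L]])
    show "AE t in lebesgue_on S. (\<lambda>n. (cmod (expo (u n) t * f t - f t))\<^sup>2) \<longlonglongrightarrow> 0"
    proof (rule AE_I2)
      fix t
      have "(\<lambda>n. (cmod (expo (u n) t * f t - f t))\<^sup>2) \<longlonglongrightarrow> (cmod (expo 0 t * f t - f t))\<^sup>2"
        by (intro tendsto_intros tendsto_expo_left u0)
      then show "(\<lambda>n. (cmod (expo (u n) t * f t - f t))\<^sup>2) \<longlonglongrightarrow> 0" by simp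
    qed
    show "AE t in lebesgue_on S. norm ((cmod (expo (u n) t * f t - f t))\<^sup>2) \<le> 4 * (cmod (f t))\<^sup>2" for n
    proof (rule AE_I2)
      fix t
      have "cmod (expo (u n) t * f t - f t) \<le> cmod (expo (u n) t * f t) + cmod (f t)" by (rule norm_triangle_ineq4)
      then have "(cmod (expo (u n) t * f t - f t))\<^sup>2 \<le> (2 * cmod (f t))\<^sup>2"
        by (intro power_mono) (auto simp: norm_mult)
      then show "norm ((cmod (expo (u n) t * f t - f t))\<^sup>2) \<le> 4 * (cmod (f t))\<^sup>2" by (simp add: power_mult_distrib)
    qed
  qed simp
  then have lim: "(\<lambda>n. (L2_nrm S (\<lambda>t. expo (u n) t * f t - f t))\<^sup>2) \<longlonglongrightarrow> 0" unfolding L2_nrm_square by simp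
  have "\<tau>\<^sup>2 \<le> 0"
  proof (rule tendsto_lowerbound[OF lim])
    show "eventually (\<lambda>n. \<tau>\<^sup>2 \<le> (L2_nrm S (\<lambda>t. expo (u n) t * f t - f t))\<^sup>2) sequentially"
      using u \<open>\<tau> > 0\<close> by (intro always_eventually allI power_mono) auto
  qed simp
  then show False using \<open>\<tau> > 0\<close> by simp
qed

lemma L2_nrm_scale: "L2_nrm S (\<lambda>t. c * f t) = cmod c * L2_nrm S f"
  by (simp add: L2_nrm_def norm_mult power_mult_distrib real_sqrt_mult)

lemma L2_nrm_sum_le:
  assumes "\<And>i. i \<in> I \<Longrightarrow> f i \<in> L2 S"
  shows "L2_nrm S (\<lambda>t. \<Sum>i\<in>I. c i * f i t) \<le> (\<Sum>i\<in>I. cmod (c i) * L2_nrm S (f i))"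
  using assms
proof (induction I rule: infinite_finite_induct)
  case (insert i I)
  have s: "(\<lambda>t. \<Sum>i\<in>I. c i * f i t) \<in> L2 S" by (rule L2_sum) (use insert.prems in auto)
  have "L2_nrm S (\<lambda>t. \<Sum>i\<in>insert i I. c i * f i t) = L2_nrm S (\<lambda>t. c i * f i t - (- 1) * (\<Sum>i\<in>I. c i * f i t))"
    using insert.hyps by simp
  also have "\<dots> \<le> L2_nrm S (\<lambda>t. c i * f i t) + L2_nrm S (\<lambda>t. (- 1) * (\<Sum>i\<in>I. c i * f i t))"
    by (intro L2_nrm_triangle_diff L2_scale s) (use insert.prems in auto)
  also have "\<dots> = cmod (c i) * L2_nrm S (f i) + L2_nrm S (\<lambda>t. \<Sum>i\<in>I. c i * f i t)"
    unfolding L2_nrm_scale by simp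
  finally show ?case using insert by simp
qed (simp_all add: L2_nrm_def)

text \<open>Outside of the bad set some \<open>f\<close> has nearly all of its frame energy at
  \<open>l\<close>. After division by the coefficient at \<open>l\<close>, the other coefficients
  have total energy at most \<epsilon> / (1 - \<epsilon>), which is at most 2 \<epsilon> for
  \<epsilon> \<le> 1/2.\<close>

lemma normalized_dual:
  assumes S: "S \<in> lmeasurable" and f: "f \<in> L2 S" and l: "l \<in> \<Lambda>" and \<epsilon>: "0 < \<epsilon>" "\<epsilon> \<le> 1 / 2"
    and sm: "(\<lambda>m. (cmod (L2_inner S f (expo m)))\<^sup>2) summable_on \<Lambda>"
    and gt: "(1 - \<epsilon>) * (\<Sum>\<^sub>\<infinity>m\<in>\<Lambda>. (cmod (L2_inner S f (expo m)))\<^sup>2) < (cmod (L2_inner S f (expo l)))\<^sup>2"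
  shows "\<exists>h. h \<in> L2 S \<and> L2_inner S h (expo l) = 1 \<and>
    (\<forall>G. finite G \<and> G \<subseteq> \<Lambda> - {l} \<longrightarrow> (\<Sum>m\<in>G. (cmod (L2_inner S h (expo m)))\<^sup>2) \<le> 2 * \<epsilon>)"
proof -
  define T where "T = (\<Sum>\<^sub>\<infinity>m\<in>\<Lambda>. (cmod (L2_inner S f (expo m)))\<^sup>2)"
  have T: "T \<ge> 0" unfolding T_def by (rule infsum_nonneg) simp
  define p where "p = L2_inner S f (expo l)"
  have gt': "(1 - \<epsilon>) * T < (cmod p)\<^sup>2" using gt by (simp add: T_def p_def)
  have "0 \<le> (1 - \<epsilon>) * T" using T \<epsilon> by simp
  then have p: "(cmod p)\<^sup>2 > 0" using gt' by linarith
  define h where "h t = (1 / p) * f t" for t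
  have inner: "L2_inner S h (expo m) = L2_inner S f (expo m) / p" for m
    unfolding h_def L2_inner_def by (subst Bochner_Integration.integral_mult_right_zero[symmetric]
      Bochner_Integration.integral_divide_zero[symmetric])+ (simp add: mult_ac)
  show ?thesis
  proof (intro exI conjI allI impI)
    show "h \<in> L2 S" unfolding h_def[abs_def] by (rule L2_scale[OF f])
    show "L2_inner S h (expo l) = 1" unfolding inner using p by (simp add: p_def)
    fix G assume G: "finite G \<and> G \<subseteq> \<Lambda> - {l}"
    define s where "s = (\<Sum>m\<in>G. (cmod (L2_inner S f (expo m)))\<^sup>2)"
    have "s + (cmod p)\<^sup>2 = (\<Sum>m\<in>insert l G. (cmod (L2_inner S f (expo m)))\<^sup>2)"
      using G by (subst sum.insert) (auto simp: s_def p_def)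
    also have "\<dots> \<le> T" unfolding T_def by (rule finite_sum_le_infsum[OF sm]) (use G l in auto)
    finally have "(1 - \<epsilon>) * (s + (cmod p)\<^sup>2) \<le> (1 - \<epsilon>) * T" by (rule mult_left_mono) (use \<epsilon> in simp)
    then have "(1 - \<epsilon>) * s \<le> \<epsilon> * (cmod p)\<^sup>2" using gt' by (simp add: algebra_simps)
    moreover have "1 / 2 * s \<le> (1 - \<epsilon>) * s"
      by (rule mult_right_mono) (use \<epsilon> in \<open>auto simp: s_def sum_nonneg\<close>)
    ultimately have "s \<le> 2 * \<epsilon> * (cmod p)\<^sup>2" by simp
    then have "s / (cmod p)\<^sup>2 \<le> 2 * \<epsilon>" using p by (simp add: pos_divide_le_eq)
    then show "(\<Sum>m\<in>G. (cmod (L2_inner S h (expo m)))\<^sup>2) \<le> 2 * \<epsilon>"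
      unfolding inner by (simp add: s_def norm_divide power_divide sum_divide_distrib)
  qed
qed

text \<open>Almost biorthogonal functions \<open>h l\<close> are combined with the coefficients themselves; testing
  against the resulting function bounds the exponential sum from below.\<close>

lemma lower_bound_if_almost_biorthogonal:
  fixes \<epsilon> :: real
  assumes S: "S \<in> lmeasurable" and A: "A > 0"
    and lower: "\<And>f. f \<in> L2 S \<Longrightarrow> A * (L2_nrm S f)\<^sup>2 \<le> (\<Sum>\<^sub>\<infinity>l\<in>\<Lambda>. (cmod (L2_inner S f (expo l)))\<^sup>2)"
    and sm: "\<And>f. f \<in> L2 S \<Longrightarrow> (\<lambda>l. (cmod (L2_inner S f (expo l)))\<^sup>2) summable_on \<Lambda>"
    and F: "finite F" "F \<subseteq> \<Lambda>" and \<epsilon>: "\<epsilon> \<ge> 0" "card F * \<epsilon> \<le> 1 / 9"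
    and h: "\<And>l. l \<in> F \<Longrightarrow> h l \<in> L2 S" "\<And>l. l \<in> F \<Longrightarrow> L2_inner S (h l) (expo l) = 1"
      "\<And>l G. l \<in> F \<Longrightarrow> finite G \<Longrightarrow> G \<subseteq> \<Lambda> - {l} \<Longrightarrow> (\<Sum>m\<in>G. (cmod (L2_inner S (h l) (expo m)))\<^sup>2) \<le> \<epsilon>"
  shows "A / 5 * (\<Sum>l\<in>F. (cmod (c l))\<^sup>2) \<le> (L2_nrm S (trig F c))\<^sup>2"
proof -
  define K where "K = (\<Sum>l\<in>F. (cmod (c l))\<^sup>2)"
  have K: "K \<ge> 0" by (simp add: K_def sum_nonneg)
  define f where "f t = (\<Sum>l\<in>F. c l * h l t)" for t
  have fL: "f \<in> L2 S" unfolding f_def[abs_def] by (rule L2_sum) (rule h(1))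
  define b where "b m = (if m \<in> F then c m else 0)" for m
  define w where "w l m = (if m = l then 0 else L2_inner S (h l) (expo m))" for l m
  define e where "e m = (\<Sum>l\<in>F. c l * w l m)" for m
  have fhat: "L2_inner S f (expo m) = b m + e m" for m
  proof -
    have "L2_inner S f (expo m) = (\<Sum>l\<in>F. c l * L2_inner S (h l) (expo m))"
      unfolding f_def[abs_def] by (rule L2_inner_sum_left[OF h(1) expo_L2[OF S]])
    also have "\<dots> = (\<Sum>l\<in>F. (if l = m then c l else 0) + c l * w l m)"
      by (intro sum.cong refl) (auto simp: w_def h(2))
    also have "\<dots> = b m + e m" using F(1) by (simp add: sum.distrib b_def e_def)
    finally show ?thesis .
  qed
  have err: "(\<Sum>m\<in>G. (cmod (e m))\<^sup>2) \<le> K / 9" if G: "finite G" "G \<subseteq> \<Lambda>" for G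
  proof -
    have "(\<Sum>m\<in>G. (cmod (e m))\<^sup>2) \<le> (\<Sum>m\<in>G. K * (\<Sum>l\<in>F. (cmod (w l m))\<^sup>2))"
      unfolding e_def K_def by (intro sum_mono complex_Cauchy_Schwarz_sum)
    also have "\<dots> = K * (\<Sum>l\<in>F. \<Sum>m\<in>G. (cmod (w l m))\<^sup>2)"
      by (subst sum.swap) (simp add: sum_distrib_left)
    also have "\<dots> \<le> K * (\<Sum>l\<in>F. \<epsilon>)"
    proof (intro mult_left_mono sum_mono K)
      fix l assume l: "l \<in> F"
      have "(\<Sum>m\<in>G. (cmod (w l m))\<^sup>2) = (\<Sum>m\<in>G - {l}. (cmod (w l m))\<^sup>2)"
        using G(1) by (intro sum.mono_neutral_right) (auto simp: w_def)
      also have "\<dots> = (\<Sum>m\<in>G - {l}. (cmod (L2_inner S (h l) (expo m)))\<^sup>2)"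
        by (intro sum.cong refl) (auto simp: w_def)
      also have "\<dots> \<le> \<epsilon>" by (rule h(3)[OF l]) (use G in auto)
      finally show "(\<Sum>m\<in>G. (cmod (w l m))\<^sup>2) \<le> \<epsilon>" .
    qed
    also have "\<dots> \<le> K * (1 / 9)" using \<epsilon>(2) K by (intro mult_left_mono) auto
    finally show ?thesis by simp
  qed
  have "A * (L2_nrm S f)\<^sup>2 \<le> (\<Sum>\<^sub>\<infinity>l\<in>\<Lambda>. (cmod (L2_inner S f (expo l)))\<^sup>2)" by (rule lower[OF fL])
  \<comment> \<open>The factor is 2 (1 + 1/9): twice the energy of the coefficients plus twice that
    of the error.\<close>
  also have "\<dots> \<le> 20 / 9 * K"
  proof (rule infsum_le_finite_sums[OF sm[OF fL]])
    fix G assume G: "finite G" "G \<subseteq> \<Lambda>"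
    have "(cmod (u + v))\<^sup>2 \<le> 2 * (cmod u)\<^sup>2 + 2 * (cmod v)\<^sup>2" for u v
    proof -
      have "(cmod (u + v))\<^sup>2 \<le> (cmod u + cmod v)\<^sup>2" by (intro power_mono norm_triangle_ineq) simp
      also have "\<dots> \<le> 2 * (cmod u)\<^sup>2 + 2 * (cmod v)\<^sup>2"
        using sum_squares_bound[of "cmod u" "cmod v"] by (simp add: power2_sum)
      finally show ?thesis .
    qed
    then have "(\<Sum>m\<in>G. (cmod (L2_inner S f (expo m)))\<^sup>2) \<le> (\<Sum>m\<in>G. 2 * (cmod (b m))\<^sup>2 + 2 * (cmod (e m))\<^sup>2)"
      unfolding fhat by (intro sum_mono)
    also have "\<dots> = 2 * (\<Sum>m\<in>G. (cmod (b m))\<^sup>2) + 2 * (\<Sum>m\<in>G. (cmod (e m))\<^sup>2)"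
      by (simp add: sum.distrib sum_distrib_left)
    also have "(\<Sum>m\<in>G. (cmod (b m))\<^sup>2) = (\<Sum>m\<in>G \<inter> F. (cmod (c m))\<^sup>2)"
      using G(1) by (subst sum.inter_restrict) (auto simp: b_def intro!: sum.cong)
    also have "\<dots> \<le> K" unfolding K_def using F(1) by (intro sum_mono2) auto
    finally show "(\<Sum>m\<in>G. (cmod (L2_inner S f (expo m)))\<^sup>2) \<le> 20 / 9 * K" using err[OF G] by simp
  qed
  finally have nf: "A * (L2_nrm S f)\<^sup>2 \<le> 20 / 9 * K" .
  define g where "g = trig F c"
  define x where "x = (\<Sum>m\<in>F. cnj (c m) * e m)"
  have gL: "g \<in> L2 S" unfolding g_def by (rule trig_L2[OF S])
  have "L2_inner S f g = (\<Sum>m\<in>F. cnj (c m) * L2_inner S f (expo m))"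
    unfolding g_def by (rule L2_inner_sum_right[OF expo_L2[OF S] fL])
  also have "\<dots> = (\<Sum>m\<in>F. of_real ((cmod (c m))\<^sup>2) + cnj (c m) * e m)"
    unfolding fhat complex_norm_square by (intro sum.cong refl) (simp add: b_def algebra_simps)
  also have "\<dots> = of_real K + x" by (simp add: sum.distrib K_def x_def)
  finally have fg: "L2_inner S f g = of_real K + x" .
  have "(cmod x)\<^sup>2 \<le> (\<Sum>m\<in>F. (cmod (cnj (c m)))\<^sup>2) * (\<Sum>m\<in>F. (cmod (e m))\<^sup>2)"
    unfolding x_def by (rule complex_Cauchy_Schwarz_sum)
  also have "\<dots> \<le> K * (K / 9)"
    unfolding complex_mod_cnj K_def[symmetric] by (rule mult_left_mono[OF err[OF F] K])
  also have "\<dots> = (K / 3)\<^sup>2" by (simp add: power2_eq_square)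
  finally have "cmod x \<le> K / 3" by (rule power2_le_imp_le) (use K in simp)
  moreover have "K \<le> cmod (of_real K + x) + cmod x"
    using norm_triangle_ineq4[of "of_real K + x" x] K by simp
  \<comment> \<open>This is K - K/3. Squaring it and dividing by the bound for the norm of
    \<open>f\<close> gives the constant A (4/9) / (20/9) = A / 5.\<close>
  ultimately have "2 / 3 * K \<le> L2_nrm S f * L2_nrm S g"
    using L2_Cauchy_Schwarz[OF fL gL] unfolding fg by simp
  then have "(2 / 3 * K)\<^sup>2 \<le> (L2_nrm S f * L2_nrm S g)\<^sup>2" by (rule power_mono) (use K in simp)
  then have "A * (4 / 9 * K\<^sup>2) \<le> A * ((L2_nrm S f)\<^sup>2 * (L2_nrm S g)\<^sup>2)"
    using A by (intro mult_left_mono) (simp_all add: power_mult_distrib power_divide)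
  also have "\<dots> = (A * (L2_nrm S f)\<^sup>2) * (L2_nrm S g)\<^sup>2" by simp
  also have "\<dots> \<le> (20 / 9 * K) * (L2_nrm S g)\<^sup>2" by (rule mult_right_mono[OF nf]) simp
  finally have fin: "K * (A / 5 * K) \<le> K * (L2_nrm S g)\<^sup>2" by (simp add: power2_eq_square mult_ac)
  show ?thesis
  proof (cases "K = 0")
    case True
    then show ?thesis unfolding K_def[symmetric] by simp
  next
    case False
    then have "K > 0" using K by simp
    with fin show ?thesis unfolding K_def[symmetric] g_def by (simp only: mult_le_cancel_left_pos)
  qed
qed


lemma not_relatively_dense_far_points:
  assumes "\<not> relatively_dense B"
  obtains y :: "nat \<Rightarrow> 'a::euclidean_space" where "\<And>n l. l \<in> B \<Longrightarrow> real n < dist l (y n)"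
proof -
  have "\<exists>y. \<forall>l\<in>B. real n < dist l y" for n
  proof -
    have "\<not> (UNIV = (\<Union>l\<in>B. ball l (real n + 1)))"
      using assms unfolding relatively_dense_def by (metis add_nonneg_pos of_nat_0_le_iff zero_less_one)
    then obtain y where y: "y \<notin> (\<Union>l\<in>B. ball l (real n + 1))" by blast
    have "real n < dist l y" if "l \<in> B" for l
    proof -
      have "y \<notin> ball l (real n + 1)" using y that by blast
      then show ?thesis by simp
    qed
    then show ?thesis by blast
  qed
  then have "\<exists>y. \<forall>n. \<forall>l\<in>B. real n < dist l (y n)" by (intro choice allI)
  then obtain y where y: "\<forall>n. \<forall>l\<in>B. real n < dist l (y n)" ..
  show ?thesis by (rule that[of y]) (use y in simp)
qed

lemma finite_sum_exceeds:
  fixes f :: "'a \<Rightarrow> real"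
  assumes "f summable_on \<Lambda>" "m < (\<Sum>\<^sub>\<infinity>l\<in>\<Lambda>. f l)"
  shows "\<exists>F. finite F \<and> F \<subseteq> \<Lambda> \<and> m \<le> (\<Sum>l\<in>F. f l)"
proof -
  have "eventually (\<lambda>F. m < (\<Sum>l\<in>F. f l)) (finite_subsets_at_top \<Lambda>)"
    using infsum_tendsto[OF assms(1)] assms(2) by (rule order_tendstoD)
  then obtain X where "finite X" "X \<subseteq> \<Lambda>" "\<forall>Y. finite Y \<and> X \<subseteq> Y \<and> Y \<subseteq> \<Lambda> \<longrightarrow> m < (\<Sum>l\<in>Y. f l)"
    unfolding eventually_finite_subsets_at_top by (elim exE conjE)
  then show ?thesis by (intro exI[of _ X]) (simp add: less_imp_le)
qed

text \<open>The hypothesis is written with \<open>expo 0\<close>, the constant 1, because it is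
  supplied by \<open>modulation_continuous\<close> for that function.\<close>

lemma trig_perturbation:
  assumes S: "S \<in> lmeasurable"
    and \<tau>: "\<And>l. l \<in> F \<Longrightarrow> L2_nrm S (\<lambda>t. expo (p l - l) t * expo 0 t - expo 0 t) \<le> \<tau>"
  shows "L2_nrm S (\<lambda>t. (\<Sum>l\<in>F. c l * expo (p l) t) - trig F c t) \<le> (\<Sum>l\<in>F. cmod (c l)) * \<tau>"
proof -
  have "L2_nrm S (\<lambda>t. (\<Sum>l\<in>F. c l * expo (p l) t) - trig F c t)
    = L2_nrm S (\<lambda>t. \<Sum>l\<in>F. c l * (expo (p l) t - expo l t))"
    by (simp add: sum_subtractf right_diff_distrib)
  also have "\<dots> \<le> (\<Sum>l\<in>F. cmod (c l) * L2_nrm S (\<lambda>t. expo (p l) t - expo l t))"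
    by (rule L2_nrm_sum_le) (intro L2_diff expo_L2 S)
  also have "\<dots> \<le> (\<Sum>l\<in>F. cmod (c l) * \<tau>)"
  proof (intro sum_mono mult_left_mono)
    fix l assume l: "l \<in> F"
    have "(\<lambda>t. expo (p l) t - expo l t) = (\<lambda>t. expo l t * (expo (p l - l) t * expo 0 t - expo 0 t))"
      by (simp add: right_diff_distrib expo_add_left[symmetric] mult.assoc[symmetric])
    then have "L2_nrm S (\<lambda>t. expo (p l) t - expo l t) = L2_nrm S (\<lambda>t. expo (p l - l) t * expo 0 t - expo 0 t)"
      using L2_expo_mult(2)[of "\<lambda>t. expo (p l - l) t * expo 0 t - expo 0 t" S l]
      by (simp only: L2_diff L2_expo_mult(1) expo_L2[OF S])
    then show "L2_nrm S (\<lambda>t. expo (p l) t - expo l t) \<le> \<tau>" using \<tau>[OF l] by simp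
  qed simp
  finally show ?thesis by (simp add: sum_distrib_right)
qed

text \<open>The copy of \<open>F\<close> inside \<Lambda> is only approximate, so the inequality is
  proved for square roots up to an arbitrary error \<open>e\<close>. All parameters may depend on
  \<open>F\<close>, \<open>c\<close> and \<open>e\<close>, because the constant \<open>A / 5\<close>
  does not.\<close>

lemma frame_critical_lower_bound:
  fixes S \<Lambda> :: "'a::euclidean_space set"
  assumes S: "S \<in> lmeasurable" and rep: "almost_repetitive \<Lambda>"
    and \<sigma>: "\<sigma> > 0" "\<And>x y. x \<in> \<Lambda> \<Longrightarrow> y \<in> \<Lambda> \<Longrightarrow> x \<noteq> y \<Longrightarrow> \<sigma> \<le> dist x y"
    and \<Lambda>: "uniform_discrete \<Lambda>"
    and A: "A > 0"
    and sm: "\<And>f. f \<in> L2 S \<Longrightarrow> (\<lambda>l. (cmod (L2_inner S f (expo l)))\<^sup>2) summable_on \<Lambda>"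
    and lower: "\<And>f. f \<in> L2 S \<Longrightarrow> A * (L2_nrm S f)\<^sup>2 \<le> (\<Sum>\<^sub>\<infinity>l\<in>\<Lambda>. (cmod (L2_inner S f (expo l)))\<^sup>2)"
    and density: "lower_Beurling_density \<Lambda> = emeasure lebesgue S"
    and F: "finite F" "F \<subseteq> \<Lambda>"
  shows "A / 5 * (\<Sum>l\<in>F. (cmod (c l))\<^sup>2) \<le> (L2_nrm S (trig F c))\<^sup>2"
proof -
  define K where "K = (\<Sum>l\<in>F. (cmod (c l))\<^sup>2)"
  have K: "K \<ge> 0" by (simp add: K_def sum_nonneg)
  have "sqrt (A / 5 * K) \<le> L2_nrm S (trig F c)"
  proof (rule field_le_epsilon)
    fix e :: real assume "e > 0"
    define C where "C = (\<Sum>l\<in>F. cmod (c l))"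
    have C: "C \<ge> 0" by (simp add: C_def sum_nonneg)
    \<comment> \<open>Makes the total perturbation \<open>C * \<tau>\<close> at most
      \<open>e\<close>; adding 1 avoids a zero denominator.\<close>
    define \<tau> where "\<tau> = e / (C + 1)"
    have \<tau>: "\<tau> > 0" "C * \<tau> \<le> e" using C \<open>e > 0\<close> by (auto simp: \<tau>_def field_simps)
    obtain \<delta> where \<delta>: "\<delta> > 0" "\<forall>u. norm u < \<delta> \<longrightarrow> L2_nrm S (\<lambda>t. expo u t * expo 0 t - expo 0 t) < \<tau>"
      using modulation_continuous[OF expo_L2[OF S, of 0] \<tau>(1)] by blast
    \<comment> \<open>\<delta> controls the perturbation, 1 keeps the copies inside the ball free of
      bad frequencies, and \<open>\<sigma> / 2\<close> makes the copies of different points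
      different.\<close>
    define \<theta> where "\<theta> = min (min \<delta> 1) (\<sigma> / 2)"
    have \<theta>: "\<theta> > 0" "\<theta> \<le> \<delta>" "\<theta> \<le> 1" "2 * \<theta> \<le> \<sigma>" using \<delta> \<sigma>(1) by (auto simp: \<theta>_def)
    \<comment> \<open>\<open>2 * \<epsilon>\<close> is the energy left over by
      \<open>normalized_dual\<close>, and \<open>card F\<close> times it has to be at most
      1/9.\<close>
    define \<epsilon> where "\<epsilon> = 1 / (18 * (real (card F) + 1))"
    have \<epsilon>: "0 < \<epsilon>" "\<epsilon> \<le> 1 / 2" "real (card F) * (2 * \<epsilon>) \<le> 1 / 9" by (auto simp: \<epsilon>_def field_simps)
    define Bad where "Bad = {l \<in> \<Lambda>. \<forall>f\<in>L2 S. (cmod (L2_inner S f (expo l)))\<^sup>2 \<le> (1 - \<epsilon>) * (\<Sum>\<^sub>\<infinity>l\<in>\<Lambda>. (cmod (L2_inner S f (expo l)))\<^sup>2)}"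
    have "\<not> relatively_dense Bad"
      by (rule frame_bad_not_relatively_dense[OF S \<sigma> \<Lambda> A sm lower _ \<epsilon>(1) _ _ density])
        (use \<epsilon> in \<open>auto simp: Bad_def\<close>)
    then obtain y where y: "\<And>n l. l \<in> Bad \<Longrightarrow> real n < dist l (y n)"
      using not_relatively_dense_far_points by blast
    obtain Rm where Rm: "\<forall>l\<in>F. norm l \<le> Rm" using finite_imp_bounded[OF F(1)] unfolding bounded_iff by blast
    obtain n x where nx: "norm (x - y n) + (Rm + 1) \<le> real n"
      and near: "\<And>l. l \<in> \<Lambda> \<Longrightarrow> norm l \<le> Rm + 1 \<Longrightarrow> \<exists>m\<in>\<Lambda>. dist (m - x) l < \<theta>"
      using almost_repetitive_recurrence[OF rep \<theta>(1), of y "Rm + 1"] by metis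
    have "\<forall>l\<in>F. \<exists>m. m \<in> \<Lambda> \<and> dist (m - x) l < \<theta>"
    proof
      fix l assume "l \<in> F"
      then have "l \<in> \<Lambda>" "norm l \<le> Rm + 1" using F(2) Rm by (auto intro: order_trans)
      from near[OF this] show "\<exists>m. m \<in> \<Lambda> \<and> dist (m - x) l < \<theta>" by blast
    qed
    then have "\<exists>m. \<forall>l\<in>F. m l \<in> \<Lambda> \<and> dist (m l - x) l < \<theta>" by (rule bchoice)
    then obtain m where m: "\<forall>l\<in>F. m l \<in> \<Lambda> \<and> dist (m l - x) l < \<theta>" ..
    have inj: "inj_on m F"
    proof (rule inj_onI, rule ccontr)
      fix l l' assume l: "l \<in> F" "l' \<in> F" "m l = m l'" "l \<noteq> l'"
      have "dist l l' \<le> dist (m l - x) l + dist (m l - x) l'" by (rule dist_triangle3)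
      moreover have "dist (m l - x) l < \<theta>" "dist (m l - x) l' < \<theta>"
        using bspec[OF m l(1)] bspec[OF m l(2)] l(3) by simp_all
      ultimately have "dist l l' < 2 * \<theta>" by linarith
      then show False using \<sigma>(2)[of l l'] l F(2) \<theta>(4) by auto
    qed
    have good: "m l \<in> \<Lambda> - Bad" if l: "l \<in> F" for l
    proof -
      have "dist (m l) (y n) \<le> dist (m l - x) l + norm l + norm (x - y n)"
      proof -
        have "m l - y n = (m l - x - l) + l + (x - y n)" by simp
        then show ?thesis
          unfolding dist_norm by (metis norm_triangle_ineq norm_triangle_mono order_refl)
      qed
      also have "\<dots> \<le> \<theta> + Rm + norm (x - y n)" using m Rm l by (intro add_mono) (auto intro: less_imp_le)
      also have "\<dots> \<le> real n" using nx \<theta>(3) by simp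
      finally have "m l \<notin> Bad" using y[of "m l" n] by fastforce
      then show ?thesis using m l by blast
    qed
    have "\<forall>k\<in>m ` F. \<exists>h. h \<in> L2 S \<and> L2_inner S h (expo k) = 1 \<and>
      (\<forall>G. finite G \<and> G \<subseteq> \<Lambda> - {k} \<longrightarrow> (\<Sum>j\<in>G. (cmod (L2_inner S h (expo j)))\<^sup>2) \<le> 2 * \<epsilon>)"
    proof
      fix k assume "k \<in> m ` F"
      then have k: "k \<in> \<Lambda>" "k \<notin> Bad" using good by auto
      then obtain f where f: "f \<in> L2 S"
        "(1 - \<epsilon>) * (\<Sum>\<^sub>\<infinity>l\<in>\<Lambda>. (cmod (L2_inner S f (expo l)))\<^sup>2) < (cmod (L2_inner S f (expo k)))\<^sup>2"
        unfolding Bad_def by (auto simp: not_le)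
      show "\<exists>h. h \<in> L2 S \<and> L2_inner S h (expo k) = 1 \<and>
        (\<forall>G. finite G \<and> G \<subseteq> \<Lambda> - {k} \<longrightarrow> (\<Sum>j\<in>G. (cmod (L2_inner S h (expo j)))\<^sup>2) \<le> 2 * \<epsilon>)"
        by (rule normalized_dual[OF S f(1) k(1) \<epsilon>(1,2) sm[OF f(1)] f(2)])
    qed
    then have "\<exists>h. \<forall>k\<in>m ` F. h k \<in> L2 S \<and> L2_inner S (h k) (expo k) = 1 \<and>
      (\<forall>G. finite G \<and> G \<subseteq> \<Lambda> - {k} \<longrightarrow> (\<Sum>j\<in>G. (cmod (L2_inner S (h k) (expo j)))\<^sup>2) \<le> 2 * \<epsilon>)"
      by (rule bchoice)
    then obtain h where h: "\<forall>k\<in>m ` F. h k \<in> L2 S \<and> L2_inner S (h k) (expo k) = 1 \<and>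
      (\<forall>G. finite G \<and> G \<subseteq> \<Lambda> - {k} \<longrightarrow> (\<Sum>j\<in>G. (cmod (L2_inner S (h k) (expo j)))\<^sup>2) \<le> 2 * \<epsilon>)" ..
    define c' where "c' k = c (inv_into F m k)" for k
    have c': "c' (m l) = c l" if "l \<in> F" for l using that inj by (simp add: c'_def inv_into_f_f)
    have "A / 5 * (\<Sum>k\<in>m ` F. (cmod (c' k))\<^sup>2) \<le> (L2_nrm S (trig (m ` F) c'))\<^sup>2"
    proof (rule lower_bound_if_almost_biorthogonal[OF S A lower sm, where \<epsilon> = "2 * \<epsilon>" and h = h])
      show "real (card (m ` F)) * (2 * \<epsilon>) \<le> 1 / 9" using \<epsilon>(3) by (simp add: card_image[OF inj])
      show "m ` F \<subseteq> \<Lambda>" using good by auto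
    qed (use F(1) \<epsilon> h in auto)
    also have "(\<Sum>k\<in>m ` F. (cmod (c' k))\<^sup>2) = K"
      unfolding K_def by (subst sum.reindex[OF inj]) (simp add: c')
    \<comment> \<open>Once the common factor \<open>expo x\<close>, of modulus 1, is taken out, the
      copied sum has frequencies close to those of \<open>F\<close>.\<close>
    also have "trig (m ` F) c' = (\<lambda>t. expo x t * (\<Sum>l\<in>F. c l * expo (m l - x) t))"
    proof
      fix t
      have "trig (m ` F) c' t = (\<Sum>l\<in>F. c l * expo (m l) t)"
        by (subst sum.reindex[OF inj]) (simp add: c')
      also have "\<dots> = (\<Sum>l\<in>F. expo x t * (c l * expo (m l - x) t))"
      proof (rule sum.cong[OF refl])
        fix l
        have "expo (m l) t = expo x t * expo (m l - x) t" using expo_add_left[of x "m l - x" t] by simp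
        then show "c l * expo (m l) t = expo x t * (c l * expo (m l - x) t)" by (simp add: mult_ac)
      qed
      finally show "trig (m ` F) c' t = expo x t * (\<Sum>l\<in>F. c l * expo (m l - x) t)" by (simp only: sum_distrib_left)
    qed
    finally have low: "A / 5 * K \<le> (L2_nrm S (\<lambda>t. expo x t * (\<Sum>l\<in>F. c l * expo (m l - x) t)))\<^sup>2" .
    have PL: "(\<lambda>t. \<Sum>l\<in>F. c l * expo (m l - x) t) \<in> L2 S" by (rule L2_sum) (rule expo_L2[OF S])
    have "sqrt (A / 5 * K) \<le> L2_nrm S (\<lambda>t. \<Sum>l\<in>F. c l * expo (m l - x) t)"
      using low unfolding L2_expo_mult(2)[OF PL] by (rule real_le_lsqrt[OF L2_nrm_nonneg])
    also have "\<dots> \<le> L2_nrm S (trig F c) + C * \<tau>"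
    proof -
      have "L2_nrm S (\<lambda>t. (\<Sum>l\<in>F. c l * expo (m l - x) t) - trig F c t) \<le> C * \<tau>"
        unfolding C_def
      proof (rule trig_perturbation[OF S])
        fix l assume "l \<in> F"
        then have "norm (m l - x - l) < \<delta>" using m \<theta>(2) by (fastforce simp: dist_norm)
        then show "L2_nrm S (\<lambda>t. expo (m l - x - l) t * expo 0 t - expo 0 t) \<le> \<tau>"
          using \<delta>(2) by (meson less_imp_le)
      qed
      then show ?thesis using abs_L2_nrm_diff_le[OF PL trig_L2[OF S, where F = F and c = c]] by linarith
    qed
    finally show "sqrt (A / 5 * K) \<le> L2_nrm S (trig F c) + e" using \<tau>(2) by linarith
  qed
  then have "A / 5 * K \<le> (L2_nrm S (trig F c))\<^sup>2" by (rule sqrt_le_D)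
  then show ?thesis by (simp only: K_def)
qed

lemma frame_critical_imp_Riesz_basis:
  fixes S \<Lambda> :: "'a::euclidean_space set"
  assumes S: "S \<in> lmeasurable" and rep: "almost_repetitive \<Lambda>" and frame: "exp_frame S \<Lambda>"
    and density: "lower_Beurling_density \<Lambda> = emeasure lebesgue S"
  shows "exp_Riesz_basis S \<Lambda>"
proof -
  have ud: "uniform_discrete \<Lambda>" using rep by (simp add: almost_repetitive_def separated_iff_uniform_discrete)
  then obtain \<sigma> where \<sigma>: "\<sigma> > 0" and sep: "\<forall>x\<in>\<Lambda>. \<forall>y\<in>\<Lambda>. dist x y < \<sigma> \<longrightarrow> x = y"
    unfolding uniform_discrete_def by (elim exE conjE)
  have sep': "\<sigma> \<le> dist x y" if "x \<in> \<Lambda>" "y \<in> \<Lambda>" "x \<noteq> y" for x y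
    using sep that by (meson not_less)
  obtain A B where AB: "0 < A" "A \<le> B" and fr: "\<forall>f\<in>L2 S.
          (\<lambda>l. (cmod (L2_inner S f (expo l)))\<^sup>2) summable_on \<Lambda> \<and>
          A * (L2_nrm S f)\<^sup>2 \<le> (\<Sum>\<^sub>\<infinity>l\<in>\<Lambda>. (cmod (L2_inner S f (expo l)))\<^sup>2) \<and>
          (\<Sum>\<^sub>\<infinity>l\<in>\<Lambda>. (cmod (L2_inner S f (expo l)))\<^sup>2) \<le> B * (L2_nrm S f)\<^sup>2"
    using frame unfolding exp_frame_def by (elim exE conjE)
  have sm: "(\<lambda>l. (cmod (L2_inner S f (expo l)))\<^sup>2) summable_on \<Lambda>"
    and lower: "A * (L2_nrm S f)\<^sup>2 \<le> (\<Sum>\<^sub>\<infinity>l\<in>\<Lambda>. (cmod (L2_inner S f (expo l)))\<^sup>2)"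
    and upper: "(\<Sum>\<^sub>\<infinity>l\<in>\<Lambda>. (cmod (L2_inner S f (expo l)))\<^sup>2) \<le> B * (L2_nrm S f)\<^sup>2" if "f \<in> L2 S" for f
    using fr that by auto
  have syn: "synthesis_bound S \<Lambda> B"
  proof (rule synthesis_bound_if_bessel[OF S])
    fix f F assume f: "f \<in> L2 S" and F: "finite F" "F \<subseteq> \<Lambda>"
    have "(\<Sum>l\<in>F. (cmod (L2_inner S f (expo l)))\<^sup>2) \<le> (\<Sum>\<^sub>\<infinity>l\<in>\<Lambda>. (cmod (L2_inner S f (expo l)))\<^sup>2)"
      by (rule finite_sum_le_infsum[OF sm[OF f] F]) simp
    then show "(\<Sum>l\<in>F. (cmod (L2_inner S f (expo l)))\<^sup>2) \<le> B * (L2_nrm S f)\<^sup>2" using upper[OF f] by linarith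
  qed (use AB in simp)
  have "exp_complete S \<Lambda>"
  proof (rule exp_complete_if_lower_bound[OF S _ _ syn])
    \<comment> \<open>Half of the frame bound, since a finite partial sum exceeds a number below the
      full sum but need not reach the full sum.\<close>
    show "0 < A / 2" "A / 2 \<le> B" using AB by auto
    fix f assume f: "f \<in> L2 S"
    show "\<exists>F. finite F \<and> F \<subseteq> \<Lambda> \<and> A / 2 * (L2_nrm S f)\<^sup>2 \<le> (\<Sum>l\<in>F. (cmod (L2_inner S f (expo l)))\<^sup>2)"
    proof (cases "L2_nrm S f = 0")
      case True
      then show ?thesis by (intro exI[of _ "{}"]) simp
    next
      case False
      then have "0 < A * (L2_nrm S f)\<^sup>2" using AB(1) by simp
      then have "A / 2 * (L2_nrm S f)\<^sup>2 < (\<Sum>\<^sub>\<infinity>l\<in>\<Lambda>. (cmod (L2_inner S f (expo l)))\<^sup>2)"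
        using lower[OF f] by linarith
      then show ?thesis by (rule finite_sum_exceeds[OF sm[OF f]])
    qed
  qed
  moreover have "exp_Riesz_sequence S \<Lambda>"
  proof (rule exp_Riesz_sequence_if_finite_bounds[OF S _ _ syn])
    show "0 < A / 5" "A / 5 \<le> B" using AB by auto
    show "A / 5 * (\<Sum>l\<in>F. (cmod (c l))\<^sup>2) \<le> (L2_nrm S (trig F c))\<^sup>2" if "finite F" "F \<subseteq> \<Lambda>" for F c
      by (rule frame_critical_lower_bound[OF S rep \<sigma> sep' ud AB(1) sm lower density that])
  qed
  ultimately show ?thesis by (simp add: exp_Riesz_basis_def)
qed


section \<open>Riesz sequences of critical upper density\<close>

text \<open>The distance of e_y f from the span varies continuously with \<open>y\<close>, so it
  stays above \<epsilon> / 2 on balls of a fixed radius about \<open>Bad\<close>. If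
  \<open>Bad\<close> were relatively dense, these balls would fill a fixed proportion of every large
  ball, and \<open>riesz_count\<close> would give an upper density strictly below |S|.\<close>

lemma riesz_bad_not_relatively_dense:
  fixes S \<Lambda> :: "'a::euclidean_space set" and \<epsilon> :: real
  assumes S: "S \<in> lmeasurable" and \<Lambda>: "uniform_discrete \<Lambda>" and A: "A > 0"
    and lower: "\<And>F c. finite F \<Longrightarrow> F \<subseteq> \<Lambda> \<Longrightarrow> A * (\<Sum>l\<in>F. (cmod (c l))\<^sup>2) \<le> (L2_nrm S (trig F c))\<^sup>2"
    and f: "f \<in> borel_measurable lebesgue" "\<And>t. cmod (f t) \<le> 1"
    and \<epsilon>: "\<epsilon> > 0"
    and far: "\<And>y F c. y \<in> Bad \<Longrightarrow> finite F \<Longrightarrow> F \<subseteq> \<Lambda> \<Longrightarrow> \<epsilon> \<le> L2_nrm S (\<lambda>t. expo y t * f t - trig F c t)"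
    and density: "upper_Beurling_density \<Lambda> = emeasure lebesgue S"
  shows "\<not> relatively_dense Bad"
proof
  assume "relatively_dense Bad"
  then obtain \<rho> where \<rho>: "\<rho> > 0" "UNIV = (\<Union>l\<in>Bad. ball l \<rho>)" unfolding relatively_dense_def by (elim exE conjE)
  have fL: "f \<in> L2 S" by (rule L2_bounded[OF S borel_measurable_lebesgue_on[OF f(1)] f(2)])
  obtain \<delta>0 where \<delta>0: "\<delta>0 > 0" "\<forall>u. norm u < \<delta>0 \<longrightarrow> L2_nrm S (\<lambda>t. expo u t * f t - f t) < \<epsilon> / 2"
    using modulation_continuous[OF fL, of "\<epsilon> / 2"] \<epsilon> by auto
  define \<delta> where "\<delta> = min \<delta>0 \<rho>"
  have \<delta>: "0 < \<delta>" "\<delta> \<le> \<rho>" "\<delta> \<le> \<delta>0" using \<delta>0 \<rho> by (auto simp: \<delta>_def)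
  define U where "U = (\<Union>l\<in>Bad. ball l \<delta>)"
  have U: "U \<in> sets borel" unfolding U_def by (intro borel_open open_UN ballI open_ball)
  define e where "e = (\<epsilon> / 2)\<^sup>2"
  have e: "e > 0" using \<epsilon> by (simp add: e_def)
  have farU: "e \<le> (L2_nrm S (\<lambda>t. expo y t * f t - trig F c t))\<^sup>2" if y: "y \<in> U" and F: "finite F" "F \<subseteq> \<Lambda>" for y F c
  proof -
    obtain z where z: "z \<in> Bad" "dist z y < \<delta>" using y unfolding U_def by auto
    have ey: "(\<lambda>t. expo u t * f t) \<in> L2 S" for u by (rule L2_expo_mult(1)[OF fL])
    have "L2_nrm S (\<lambda>t. expo z t * f t - trig F c t)
      \<le> L2_nrm S (\<lambda>t. expo z t * f t - expo y t * f t) + L2_nrm S (\<lambda>t. expo y t * f t - trig F c t)"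
      by (rule L2_nrm_triangle[OF ey ey trig_L2[OF S]])
    moreover have "L2_nrm S (\<lambda>t. expo z t * f t - expo y t * f t) < \<epsilon> / 2"
    proof -
      have "(\<lambda>t. expo z t * f t - expo y t * f t) = (\<lambda>t. expo y t * (expo (z - y) t * f t - f t))"
        by (simp add: right_diff_distrib mult.assoc[symmetric] expo_add_left[symmetric])
      moreover have "(\<lambda>t. expo (z - y) t * f t - f t) \<in> L2 S" by (intro L2_diff ey fL)
      ultimately have "L2_nrm S (\<lambda>t. expo z t * f t - expo y t * f t) = L2_nrm S (\<lambda>t. expo (z - y) t * f t - f t)"
        by (simp only: L2_expo_mult(2))
      moreover have "norm (z - y) < \<delta>0" using z(2) \<delta>(3) by (simp add: dist_norm)
      ultimately show ?thesis using \<delta>0(2) by simp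
    qed
    ultimately have "\<epsilon> / 2 \<le> L2_nrm S (\<lambda>t. expo y t * f t - trig F c t)" using far[OF z(1) F, of c] by linarith
    then show ?thesis unfolding e_def by (rule power_mono) (use \<epsilon> in simp)
  qed
  define V where "V r = measure lborel (ball (0::'a) r)" for r
  have V0: "V r > 0" if "r > 0" for r using measure_ball_pos[OF that] by (simp add: V_def)
  define q where "q = V \<delta> / V (5 * \<rho>)"
  have q: "q > 0" using V0 \<delta>(1) \<rho>(1) by (simp add: q_def)
  define \<kappa> where "\<kappa> = e * q"
  have \<kappa>: "\<kappa> > 0" using e q by (simp add: \<kappa>_def)
  define m where "m = measure lebesgue S"
  have m: "m \<ge> 0" by (simp add: m_def)
  \<comment> \<open>Chosen so that passing from
    \<open>k * (1 - \<eta>) \<le> m - \<kappa> / 2\<close> to a bound for \<open>k\<close> costs at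
    most \<kappa> / 4.\<close>
  define \<eta> where "\<eta> = \<kappa> / (4 * (m + \<kappa>))"
  have \<eta>: "\<eta> > 0" "\<eta> < 1" "\<eta> * (m + \<kappa>) = \<kappa> / 4" using \<kappa> m by (auto simp: \<eta>_def field_simps)
  obtain R where R: "R > 0" and count: "\<forall>x r. card (\<Lambda> \<inter> ball x r) * (1 - \<eta>)
     \<le> measure lebesgue S * measure lborel (ball x (r + R)) - e * measure lborel (U \<inter> ball x (r + R))"
    using riesz_count[OF S \<Lambda> A lower f e U farU \<eta>(1)] by blast
  have ub: "card (\<Lambda> \<inter> ball x r) * (1 - \<eta>) \<le> m * V (r + R) - \<kappa> * V (r + (R - 2 * \<rho>))" for x r
  proof -
    have "V (r + R - 2 * \<rho>) * V \<delta> \<le> measure lborel (U \<inter> ball x (r + R)) * V (5 * \<rho>)"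
      using relatively_dense_volume[OF \<rho>(2) \<delta>(1,2), of x "r + R"] measure_ball_center[of x "r + R - 2 * \<rho>"]
      by (simp add: V_def U_def)
    then have "V (r + R - 2 * \<rho>) * V \<delta> / V (5 * \<rho>) \<le> measure lborel (U \<inter> ball x (r + R))"
      using V0[of "5 * \<rho>"] \<rho>(1) by (simp add: pos_divide_le_eq)
    then have "e * (V (r + R - 2 * \<rho>) * V \<delta> / V (5 * \<rho>)) \<le> e * measure lborel (U \<inter> ball x (r + R))"
      by (rule mult_left_mono) (use e in simp)
    moreover have "e * (V (r + R - 2 * \<rho>) * V \<delta> / V (5 * \<rho>)) = \<kappa> * V (r + (R - 2 * \<rho>))"
      by (simp add: \<kappa>_def q_def algebra_simps)
    moreover have "measure lborel (ball x (r + R)) = V (r + R)" unfolding V_def by (rule measure_ball_center)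
    ultimately show ?thesis using count[rule_format, of x r] by (simp add: m_def)
  qed
  have ratio: "((\<lambda>s. V (s + a) / V s) \<longlongrightarrow> 1) at_top" for a
    unfolding V_def by (rule measure_ball_ratio_tendsto)
  have "((\<lambda>s. m * (V (s + R) / V s) - \<kappa> * (V (s + (R - 2 * \<rho>)) / V s)) \<longlongrightarrow> m * 1 - \<kappa> * 1) at_top"
    by (intro tendsto_intros ratio)
  moreover have "m * 1 - \<kappa> * 1 < m - \<kappa> / 2" using \<kappa> by simp
  ultimately have "eventually (\<lambda>s. m * (V (s + R) / V s) - \<kappa> * (V (s + (R - 2 * \<rho>)) / V s) < m - \<kappa> / 2) at_top"
    by (rule order_tendstoD)
  then have ev: "eventually (\<lambda>s. \<forall>x. card (\<Lambda> \<inter> ball x s) / measure lborel (ball (0::'a) s) \<le> m - \<kappa> / 4) at_top"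
    using eventually_gt_at_top[of 0]
  proof eventually_elim
    case (elim s)
    have Vs: "V s > 0" by (rule V0[OF elim(2)])
    show ?case
    proof
      fix x
      define k where "k = card (\<Lambda> \<inter> ball x s) / V s"
      have "k * (1 - \<eta>) = card (\<Lambda> \<inter> ball x s) * (1 - \<eta>) / V s" by (simp add: k_def)
      also have "\<dots> \<le> (m * V (s + R) - \<kappa> * V (s + (R - 2 * \<rho>))) / V s"
        by (rule divide_right_mono[OF ub]) (use Vs in simp)
      also have "\<dots> = m * (V (s + R) / V s) - \<kappa> * (V (s + (R - 2 * \<rho>)) / V s)"
        by (simp add: diff_divide_distrib)
      finally have "k * (1 - \<eta>) \<le> m - \<kappa> / 2" using elim(1) by linarith
      also have "\<dots> \<le> (m - \<kappa> / 4) * (1 - \<eta>)"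
      proof -
        have "\<eta> * (m - \<kappa> / 4) \<le> \<eta> * (m + \<kappa>)" using \<eta>(1) \<kappa> by (intro mult_left_mono) auto
        then have "\<eta> * (m - \<kappa> / 4) \<le> \<kappa> / 4" unfolding \<eta>(3) .
        moreover have "x * (1 - \<eta>) = x - \<eta> * x" for x by (simp add: algebra_simps)
        ultimately show ?thesis by simp
      qed
      finally have "k \<le> m - \<kappa> / 4" using \<eta>(2) by (simp add: mult_le_cancel_right)
      then show "card (\<Lambda> \<inter> ball x s) / measure lborel (ball (0::'a) s) \<le> m - \<kappa> / 4" by (simp add: k_def V_def)
    qed
  qed
  \<comment> \<open>Negative reals become 0 under \<open>ennreal\<close>, so the sign has to be
    settled before the comparison of densities is a contradiction.\<close>
  have "m - \<kappa> / 4 \<ge> 0"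
  proof -
    obtain s where "\<forall>x. card (\<Lambda> \<inter> ball x s) / measure lborel (ball (0::'a) s) \<le> m - \<kappa> / 4"
      using eventually_happens[OF ev] by auto
    from spec[OF this, of 0] show ?thesis by (rule order_trans[rotated]) simp
  qed
  moreover have "ennreal m \<le> ennreal (m - \<kappa> / 4)"
    using upper_Beurling_density_le[OF \<Lambda> ev] unfolding density emeasure_lmeasurable[OF S] m_def .
  ultimately show False using \<kappa> by (simp add: ennreal_le_iff)
qed

text \<open>At a good \<open>x\<close> the function e_x f is close to a finite sum \<open>g\<close>
  over \<Lambda>. Pairing the two, Cauchy-Schwarz and the lower Riesz bound show that the
  coefficients of e_x f carry energy at least a multiple of \<open>A * n\<^sup>2\<close>. They are
  values of the transform of \<open>f\<close> at points l - x. Those near the origin are close to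
  points of \<Lambda>, and the rest is negligible by the tail estimate, for which \<open>f\<close>
  is bounded and of bounded support.\<close>

lemma riesz_critical_lower_bound_bounded:
  fixes S \<Lambda> :: "'a::euclidean_space set"
  assumes S: "S \<in> lmeasurable" and rep: "almost_repetitive \<Lambda>" and A: "A > 0"
    and lower: "\<And>F c. finite F \<Longrightarrow> F \<subseteq> \<Lambda> \<Longrightarrow> A * (\<Sum>l\<in>F. (cmod (c l))\<^sup>2) \<le> (L2_nrm S (trig F c))\<^sup>2"
    and density: "upper_Beurling_density \<Lambda> = emeasure lebesgue S"
    and f: "f \<in> borel_measurable lebesgue" "\<And>t. cmod (f t) \<le> 1" "\<And>t. t \<notin> S \<inter> ball 0 \<rho> \<Longrightarrow> f t = 0"
  shows "\<exists>F. finite F \<and> F \<subseteq> \<Lambda> \<and> A / 4 * (L2_nrm S f)\<^sup>2 \<le> (\<Sum>l\<in>F. (cmod (L2_inner S f (expo l)))\<^sup>2)"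
proof (cases "L2_nrm S f = 0")
  case True
  then show ?thesis by (intro exI[of _ "{}"]) simp
next
  case False
  define n where "n = L2_nrm S f"
  have n: "n > 0" using False L2_nrm_nonneg[of S f] by (simp add: n_def)
  have Sl: "S \<in> sets lebesgue" using S by (rule fmeasurableD)
  have fL: "f \<in> L2 S" by (rule L2_bounded[OF S borel_measurable_lebesgue_on[OF f(1)] f(2)])
  have ud: "uniform_discrete \<Lambda>" using rep by (simp add: almost_repetitive_def separated_iff_uniform_discrete)
  then obtain \<sigma> where \<sigma>: "\<sigma> > 0" and sep: "\<forall>x\<in>\<Lambda>. \<forall>y\<in>\<Lambda>. dist x y < \<sigma> \<longrightarrow> x = y"
    unfolding uniform_discrete_def by (elim exE conjE)
  have "(\<lambda>t. indicator S t * f t) = f" using f(3) by (auto simp: indicator_def fun_eq_iff)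
  then have inner: "L2_inner S f (expo y) = ft f y" for y
    unfolding L2_inner_expo_eq_ft[OF Sl] by simp
  have fi: "integrable lebesgue f"
  proof (rule Bochner_Integration.integrable_bound)
    show "integrable lebesgue (indicator S :: 'a \<Rightarrow> complex)" by (rule ft_indicator_mult_trig(2)[OF S])
    show "AE t in lebesgue. norm (f t) \<le> norm (indicator S t :: complex)"
      using f(2,3) by (intro AE_I2) (auto simp: indicator_def)
  qed (rule f(1))
  \<comment> \<open>The energy found at \<open>x\<close> is at least 9/16 of A n^2; the tail and the
    perturbation cost \<open>e\<close> each, and 9/16 - 2/16 exceeds 1/4.\<close>
  define e where "e = A * n\<^sup>2 / 16"
  have e: "e > 0" using A n by (simp add: e_def)
  have f0: "f t = 0" if "t \<notin> ball 0 \<rho>" for t using f(3) that by auto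
  obtain R where R: "R > 0" and tail: "\<forall>F. finite F \<longrightarrow> F \<inter> ball 0 R = {} \<longrightarrow>
     (\<forall>x\<in>F. \<forall>y\<in>F. x \<noteq> y \<longrightarrow> \<sigma> \<le> dist x y) \<longrightarrow> (\<Sum>\<xi>\<in>F. (cmod (ft f \<xi>))\<^sup>2) \<le> e"
    using ft_tail_separated[OF f(1,2) f0 \<sigma> e] by blast
  \<comment> \<open>The radius exceeds \<open>R\<close> by 1 to contain the points of \<Lambda> that
    approximate the differences l - x.\<close>
  define F where "F = \<Lambda> \<inter> ball 0 (R + 1)"
  have F: "finite F" "F \<subseteq> \<Lambda>" unfolding F_def using uniform_discrete_imp_finite_Int[OF ud bounded_ball] by auto
  define \<tau> where "\<tau> = e / (real (card F) + 1)"
  have \<tau>: "\<tau> > 0" "card F * \<tau> \<le> e" using e by (auto simp: \<tau>_def field_simps)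
  have "uniformly_continuous_on (cball 0 (R + 1)) (\<lambda>y. (cmod (ft f y))\<^sup>2)"
    by (intro compact_uniformly_continuous continuous_intros continuous_on_ft fi compact_cball)
  then obtain \<delta> where \<delta>: "\<delta> > 0" "\<forall>u\<in>cball 0 (R + 1). \<forall>v\<in>cball 0 (R + 1). dist v u < \<delta> \<longrightarrow>
      dist ((cmod (ft f v))\<^sup>2) ((cmod (ft f u))\<^sup>2) < \<tau>"
    unfolding uniformly_continuous_on_def using \<tau>(1) by blast
  \<comment> \<open>\<delta> serves uniform continuity, 1 the radius \<open>R + 1\<close>, and
    \<open>\<sigma> / 2\<close> makes different points of \<Lambda> have different
    neighbours.\<close>
  define \<theta> where "\<theta> = min (min \<delta> 1) (\<sigma> / 2)"
  have \<theta>: "\<theta> > 0" "\<theta> \<le> \<delta>" "\<theta> \<le> 1" "2 * \<theta> \<le> \<sigma>" using \<delta> \<sigma> by (auto simp: \<theta>_def)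
  define Bad where "Bad = {y. \<forall>F c. finite F \<longrightarrow> F \<subseteq> \<Lambda> \<longrightarrow> n / 8 \<le> L2_nrm S (\<lambda>t. expo y t * f t - trig F c t)}"
  have "n / 8 > 0" using n by simp
  then have "\<not> relatively_dense Bad"
    by (intro riesz_bad_not_relatively_dense[OF S ud A lower f(1,2) _ _ density, where \<epsilon> = "n / 8"]) (auto simp: Bad_def)
  then obtain y where y: "\<And>k l. l \<in> Bad \<Longrightarrow> real k < dist l (y k)"
    using not_relatively_dense_far_points by blast
  obtain k x where kx: "norm (x - y k) + R \<le> real k"
    and near: "\<And>m. m \<in> \<Lambda> \<Longrightarrow> norm (m - x) \<le> R \<Longrightarrow> \<exists>l\<in>\<Lambda>. dist (m - x) l < \<theta>"
    using almost_repetitive_recurrence[OF rep \<theta>(1), of y R] by metis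
  have "x \<notin> Bad"
  proof
    assume "x \<in> Bad"
    from y[OF this, of k] show False using kx R by (simp add: dist_norm)
  qed
  then obtain F1 c where F1: "finite F1" "F1 \<subseteq> \<Lambda>" and close: "L2_nrm S (\<lambda>t. expo x t * f t - trig F1 c t) < n / 8"
    unfolding Bad_def by (auto simp: not_le)
  define h where "h t = expo x t * f t" for t
  define g where "g = trig F1 c"
  define s where "s = (\<Sum>l\<in>F1. (cmod (ft f (l - x)))\<^sup>2)"
  have s0: "s \<ge> 0" by (simp add: s_def sum_nonneg)
  have hL: "h \<in> L2 S" and hn: "L2_nrm S h = n"
    unfolding h_def[abs_def] n_def using L2_expo_mult[OF fL, of x] by auto
  have gL: "g \<in> L2 S" unfolding g_def by (rule trig_L2[OF S])
  have close': "L2_nrm S (\<lambda>t. h t - g t) < n / 8" using close by (simp add: h_def g_def)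
  have gn: "7 / 8 * n \<le> L2_nrm S g"
    using abs_L2_nrm_diff_le[OF hL gL] close' hn by linarith
  have inner_h: "L2_inner S h (expo l) = ft f (l - x)" for l
  proof -
    have "(\<lambda>t. indicator S t * h t) = (\<lambda>t. f t * expo x t)"
      using f(3) by (auto simp: h_def indicator_def fun_eq_iff)
    then show ?thesis unfolding L2_inner_expo_eq_ft[OF Sl] by (simp add: ft_expo_mult)
  qed
  have "A * (9 / 16 * n\<^sup>2) \<le> s"
  proof -
    have "(cmod (L2_inner S h g))\<^sup>2 = (cmod (\<Sum>l\<in>F1. cnj (c l) * ft f (l - x)))\<^sup>2"
      unfolding g_def by (subst L2_inner_sum_right[OF expo_L2[OF S] hL]) (simp add: inner_h)
    also have "\<dots> \<le> (\<Sum>l\<in>F1. (cmod (c l))\<^sup>2) * s"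
      unfolding s_def using complex_Cauchy_Schwarz_sum[of "\<lambda>l. cnj (c l)" _ F1] by simp
    finally have "A * (cmod (L2_inner S h g))\<^sup>2 \<le> A * (\<Sum>l\<in>F1. (cmod (c l))\<^sup>2) * s"
      using A by simp
    also have "\<dots> \<le> (L2_nrm S g)\<^sup>2 * s"
      unfolding g_def by (rule mult_right_mono[OF lower[OF F1] s0])
    finally have up: "A * (cmod (L2_inner S h g))\<^sup>2 \<le> (L2_nrm S g)\<^sup>2 * s" .
    \<comment> \<open><g, g> is at least 7/8 n times the norm of \<open>g\<close>; replacing one
      \<open>g\<close> by \<open>h\<close> costs at most n/8 times that norm.\<close>
    have gg: "L2_nrm S g * (3 / 4 * n) \<le> cmod (L2_inner S h g)"
    proof -
      have d: "(\<lambda>t. h t - g t) \<in> L2 S" by (rule L2_diff[OF hL gL])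
      have "cmod (L2_inner S (\<lambda>t. h t - g t) g) \<le> L2_nrm S (\<lambda>t. h t - g t) * L2_nrm S g"
        by (rule L2_Cauchy_Schwarz[OF d gL])
      also have "\<dots> \<le> n / 8 * L2_nrm S g" using close' by (intro mult_right_mono L2_nrm_nonneg) simp
      finally have 1: "cmod (L2_inner S h g - L2_inner S g g) \<le> n / 8 * L2_nrm S g"
        unfolding L2_inner_diff_left[OF hL gL gL] .
      have gsq: "cmod (L2_inner S g g) = (L2_nrm S g)\<^sup>2"
        unfolding L2_inner_self norm_of_real by simp
      have "cmod (L2_inner S g g) \<le> cmod (L2_inner S h g) + cmod (L2_inner S h g - L2_inner S g g)"
        using norm_triangle_ineq4[of "L2_inner S h g" "L2_inner S h g - L2_inner S g g"] by simp
      then have "(L2_nrm S g)\<^sup>2 \<le> cmod (L2_inner S h g) + n / 8 * L2_nrm S g"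
        using 1 gsq by linarith
      moreover have "L2_nrm S g * (7 / 8 * n) \<le> (L2_nrm S g)\<^sup>2"
        unfolding power2_eq_square by (rule mult_left_mono[OF gn L2_nrm_nonneg])
      ultimately show ?thesis by (simp add: algebra_simps)
    qed
    have gpos: "(L2_nrm S g)\<^sup>2 > 0" using gn n by simp
    have "(L2_nrm S g * (3 / 4 * n))\<^sup>2 \<le> (cmod (L2_inner S h g))\<^sup>2"
      by (rule power_mono[OF gg]) (use n in \<open>simp add: L2_nrm_nonneg\<close>)
    then have "A * (L2_nrm S g * (3 / 4 * n))\<^sup>2 \<le> (L2_nrm S g)\<^sup>2 * s"
      using up A by (meson mult_left_mono less_imp_le order_trans)
    then have "(L2_nrm S g)\<^sup>2 * (A * (9 / 16 * n\<^sup>2)) \<le> (L2_nrm S g)\<^sup>2 * s"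
      by (simp add: power_mult_distrib power_divide mult_ac)
    then show ?thesis using gpos by (simp only: mult_le_cancel_left_pos)
  qed
  \<comment> \<open>Points with |l - x| \<ge> R are covered by the tail bound; only the others have
    to be matched with points of \<Lambda>.\<close>
  define G1 where "G1 = {l \<in> F1. norm (l - x) < R}"
  have G1: "finite G1" "G1 \<subseteq> F1" using F1 by (auto simp: G1_def)
  have split: "s = (\<Sum>l\<in>G1. (cmod (ft f (l - x)))\<^sup>2) + (\<Sum>l\<in>F1 - G1. (cmod (ft f (l - x)))\<^sup>2)"
    unfolding s_def using sum.subset_diff[OF G1(2) F1(1)] by (simp add: add.commute)
  have far: "(\<Sum>l\<in>F1 - G1. (cmod (ft f (l - x)))\<^sup>2) \<le> e"
  proof -
    have "(\<Sum>l\<in>F1 - G1. (cmod (ft f (l - x)))\<^sup>2) = (\<Sum>\<xi>\<in>(\<lambda>l. l - x) ` (F1 - G1). (cmod (ft f \<xi>))\<^sup>2)"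
      by (rule sum.reindex_cong[of "\<lambda>l. l - x", symmetric]) (auto simp: inj_on_def)
    also have "\<dots> \<le> e"
    proof (rule tail[rule_format])
      fix u v assume uv: "u \<in> (\<lambda>l. l - x) ` (F1 - G1)" "v \<in> (\<lambda>l. l - x) ` (F1 - G1)" "u \<noteq> v"
      then obtain l l' where l: "l \<in> F1" "l' \<in> F1" "u = l - x" "v = l' - x" by auto
      then have "l \<in> \<Lambda>" "l' \<in> \<Lambda>" "l \<noteq> l'" using F1(2) uv(3) by auto
      then have "\<not> dist l l' < \<sigma>" using sep by blast
      then show "\<sigma> \<le> dist u v" unfolding l(3,4) by (simp add: dist_norm)
    qed (use F1 in \<open>auto simp: G1_def\<close>)
    finally show ?thesis .
  qed
  have "\<forall>m\<in>G1. \<exists>l. l \<in> \<Lambda> \<and> dist (m - x) l < \<theta>"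
  proof
    fix m assume "m \<in> G1"
    then have "m \<in> \<Lambda>" "norm (m - x) \<le> R" using F1(2) by (auto simp: G1_def)
    from near[OF this] show "\<exists>l. l \<in> \<Lambda> \<and> dist (m - x) l < \<theta>" by blast
  qed
  then have "\<exists>p. \<forall>m\<in>G1. p m \<in> \<Lambda> \<and> dist (m - x) (p m) < \<theta>" by (rule bchoice)
  then obtain p where p: "\<forall>m\<in>G1. p m \<in> \<Lambda> \<and> dist (m - x) (p m) < \<theta>" ..
  have inj: "inj_on p G1"
  proof (rule inj_onI)
    fix m m' assume m: "m \<in> G1" "m' \<in> G1" "p m = p m'"
    have "dist (m - x) (p m) < \<theta>" "dist (m' - x) (p m) < \<theta>"
      using bspec[OF p m(1)] bspec[OF p m(2)] m(3) by simp_all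
    then have "dist (m - x) (m' - x) < \<sigma>"
      using dist_triangle2[of "m - x" "m' - x" "p m"] \<theta>(4) by linarith
    then have "dist m m' < \<sigma>" by (simp add: dist_norm)
    moreover have "m \<in> \<Lambda>" "m' \<in> \<Lambda>" using m(1,2) G1(2) F1(2) by auto
    ultimately show "m = m'" using sep by blast
  qed
  have pF: "p m \<in> F" and pin: "p m \<in> cball 0 (R + 1)" and min: "m - x \<in> cball 0 (R + 1)" if m: "m \<in> G1" for m
  proof -
    have "norm (m - x) < R" using m by (simp add: G1_def)
    moreover have "dist (m - x) (p m) < \<theta>" "p m \<in> \<Lambda>" using p m by auto
    moreover have "norm (p m) \<le> norm (m - x) + dist (m - x) (p m)"
      using norm_triangle_ineq4[of "m - x" "m - x - p m"] by (simp add: dist_norm)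
    ultimately show "p m \<in> F" "p m \<in> cball 0 (R + 1)" "m - x \<in> cball 0 (R + 1)"
      using \<theta>(3) by (auto simp: F_def)
  qed
  have "(\<Sum>m\<in>G1. (cmod (ft f (m - x)))\<^sup>2) \<le> (\<Sum>m\<in>G1. (cmod (ft f (p m)))\<^sup>2 + \<tau>)"
  proof (rule sum_mono)
    fix m assume m: "m \<in> G1"
    have "dist (m - x) (p m) < \<delta>" using bspec[OF p m] \<theta>(2) by linarith
    then have "dist ((cmod (ft f (m - x)))\<^sup>2) ((cmod (ft f (p m)))\<^sup>2) < \<tau>"
      using \<delta>(2) pin[OF m] min[OF m] by blast
    then show "(cmod (ft f (m - x)))\<^sup>2 \<le> (cmod (ft f (p m)))\<^sup>2 + \<tau>" by (simp add: dist_real_def abs_less_iff)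
  qed
  also have "\<dots> = (\<Sum>l\<in>p ` G1. (cmod (ft f l))\<^sup>2) + card G1 * \<tau>"
    by (simp add: sum.distrib sum.reindex[OF inj])
  also have "\<dots> \<le> (\<Sum>l\<in>F. (cmod (ft f l))\<^sup>2) + e"
  proof (rule add_mono)
    show "(\<Sum>l\<in>p ` G1. (cmod (ft f l))\<^sup>2) \<le> (\<Sum>l\<in>F. (cmod (ft f l))\<^sup>2)"
      using F(1) pF by (intro sum_mono2) auto
    have "card G1 \<le> card F" using F(1) pF by (intro card_inj_on_le[OF inj]) auto
    then have "card G1 * \<tau> \<le> card F * \<tau>" using \<tau>(1) by simp
    then show "card G1 * \<tau> \<le> e" using \<tau>(2) by linarith
  qed
  finally have "s \<le> (\<Sum>l\<in>F. (cmod (ft f l))\<^sup>2) + 2 * e" using split far by linarith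
  then have "A / 4 * n\<^sup>2 \<le> (\<Sum>l\<in>F. (cmod (ft f l))\<^sup>2)"
    using \<open>A * (9 / 16 * n\<^sup>2) \<le> s\<close> e by (simp add: e_def)
  then show ?thesis using F by (intro exI[of _ F]) (simp add: inner n_def)
qed

lemma riesz_critical_imp_Riesz_basis:
  fixes S \<Lambda> :: "'a::euclidean_space set"
  assumes S: "S \<in> lmeasurable" and rep: "almost_repetitive \<Lambda>" and riesz: "exp_Riesz_sequence S \<Lambda>"
    and density: "upper_Beurling_density \<Lambda> = emeasure lebesgue S"
  shows "exp_Riesz_basis S \<Lambda>"
proof -
  have Sl: "S \<in> sets lebesgue" using S by (rule fmeasurableD)
  obtain A B where AB: "0 < A" "A \<le> B" and syn: "synthesis_bound S \<Lambda> B"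
    and lower: "\<And>F c. finite F \<Longrightarrow> F \<subseteq> \<Lambda> \<Longrightarrow> A * (\<Sum>l\<in>F. (cmod (c l))\<^sup>2) \<le> (L2_nrm S (trig F c))\<^sup>2"
    using exp_Riesz_sequence_imp_finite_bounds[OF S riesz] by blast
  have "exp_complete S \<Lambda>"
  proof (rule exp_complete_if_lower_bound[OF S _ _ syn])
    \<comment> \<open>An approximant \<open>h\<close> keeps half of the norm of \<open>f\<close>,
      which turns \<open>A / 4\<close> into \<open>A / 16\<close>; the inequality |u - v|^2 \<le> 2
      |u|^2 + 2 |v|^2 and the approximation error then leave \<open>A / 64\<close>.\<close>
    show "0 < A / 64" "A / 64 \<le> B" using AB by auto
    fix f assume f: "f \<in> L2 S"
    define n where "n = L2_nrm S f"
    show "\<exists>F. finite F \<and> F \<subseteq> \<Lambda> \<and> A / 64 * (L2_nrm S f)\<^sup>2 \<le> (\<Sum>l\<in>F. (cmod (L2_inner S f (expo l)))\<^sup>2)"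
    proof (cases "n = 0")
      case True
      then show ?thesis by (intro exI[of _ "{}"]) (simp add: n_def)
    next
      case False
      then have n: "n > 0" using L2_nrm_nonneg[of S f] by (simp add: n_def)
      define r where "r = A / (64 * B)"
      have r: "r > 0" "B * r = A / 64" using AB by (auto simp: r_def)
      \<comment> \<open>The first bound keeps half of the norm of \<open>f\<close>, the second makes
        the Bessel bound of the error at most \<open>A / 64 * n\<^sup>2\<close>.\<close>
      define d where "d = min (n / 2) (sqrt r * n)"
      have d: "d > 0" "d \<le> n / 2" using n r by (auto simp: d_def)
      have "d\<^sup>2 \<le> (sqrt r * n)\<^sup>2" by (rule power_mono) (use d in \<open>auto simp: d_def\<close>)
      then have "B * d\<^sup>2 \<le> B * (r * n\<^sup>2)" using AB r by (intro mult_left_mono) (auto simp: power_mult_distrib)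
      also have "\<dots> = A / 64 * n\<^sup>2" using r(2) by (simp add: mult.assoc[symmetric])
      finally have Bd: "B * d\<^sup>2 \<le> A / 64 * n\<^sup>2" .
      obtain h C \<rho> where hm: "h \<in> borel_measurable lebesgue" and hC: "\<And>t. cmod (h t) \<le> C"
        and h0: "\<And>t. t \<notin> S \<inter> ball 0 \<rho> \<Longrightarrow> h t = 0" and hL: "h \<in> L2 S" and hd: "L2_nrm S (\<lambda>t. f t - h t) < d"
        using L2_dense_bounded[OF Sl f d(1)] by metis
      \<comment> \<open>At least 1, so that division by it is possible and scales \<open>h\<close>
        to modulus at most 1.\<close>
      define C' where "C' = max C 1"
      have C': "C' > 0" "cmod (h t) \<le> C'" for t using hC[of t] by (auto simp: C'_def)
      have [measurable]: "h \<in> borel_measurable lebesgue" by (rule hm)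
      define k where "k t = complex_of_real (1 / C') * h t" for t
      have km: "k \<in> borel_measurable lebesgue" unfolding k_def[abs_def] by measurable
      have kb: "cmod (k t) \<le> 1" for t using C' by (simp add: k_def norm_mult norm_divide)
      have k0: "k t = 0" if "t \<notin> S \<inter> ball 0 \<rho>" for t using h0[OF that] by (simp add: k_def)
      obtain F where F: "finite F" "F \<subseteq> \<Lambda>"
        and Fk: "A / 4 * (L2_nrm S k)\<^sup>2 \<le> (\<Sum>l\<in>F. (cmod (L2_inner S k (expo l)))\<^sup>2)"
        using riesz_critical_lower_bound_bounded[OF S rep AB(1) lower density km kb k0] by blast
      have kn: "(L2_nrm S k)\<^sup>2 = (L2_nrm S h)\<^sup>2 / C'\<^sup>2"
        unfolding k_def[abs_def] L2_nrm_scale using C'(1) by (simp add: power_mult_distrib power_divide norm_divide)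
      have ki: "(cmod (L2_inner S k (expo l)))\<^sup>2 = (cmod (L2_inner S h (expo l)))\<^sup>2 / C'\<^sup>2" for l
      proof -
        have "L2_inner S k (expo l) = of_real (1 / C') * L2_inner S h (expo l)"
          unfolding k_def L2_inner_def by (subst Bochner_Integration.integral_mult_right_zero[symmetric]) (simp add: mult.assoc)
        then show ?thesis using C'(1) by (simp add: norm_mult norm_divide power_divide)
      qed
      have "(A / 4 * (L2_nrm S h)\<^sup>2) / C'\<^sup>2 \<le> (\<Sum>l\<in>F. (cmod (L2_inner S h (expo l)))\<^sup>2) / C'\<^sup>2"
        using Fk unfolding kn ki by (simp only: sum_divide_distrib times_divide_eq_right)
      moreover have "0 < C'\<^sup>2" using C'(1) by simp
      ultimately have Fh: "A / 4 * (L2_nrm S h)\<^sup>2 \<le> (\<Sum>l\<in>F. (cmod (L2_inner S h (expo l)))\<^sup>2)"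
        unfolding divide_le_cancel by blast
      define w where "w t = f t - h t" for t
      have wL: "w \<in> L2 S" unfolding w_def[abs_def] by (rule L2_diff[OF f hL])
      have wn: "L2_nrm S w < d" using hd by (simp add: w_def[abs_def])
      have hn: "n / 2 \<le> L2_nrm S h"
        using abs_L2_nrm_diff_le[OF f hL] hd d(2) unfolding n_def by linarith
      have "(cmod (L2_inner S h (expo l)))\<^sup>2 \<le> 2 * (cmod (L2_inner S f (expo l)))\<^sup>2 + 2 * (cmod (L2_inner S w (expo l)))\<^sup>2" for l
      proof -
        have "L2_inner S w (expo l) = L2_inner S f (expo l) - L2_inner S h (expo l)"
          unfolding w_def[abs_def] by (rule L2_inner_diff_left[OF f hL expo_L2[OF S]])
        then have "L2_inner S h (expo l) = L2_inner S f (expo l) - L2_inner S w (expo l)" by simp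
        then have "cmod (L2_inner S h (expo l)) \<le> cmod (L2_inner S f (expo l)) + cmod (L2_inner S w (expo l))"
          using norm_triangle_ineq4 by metis
        then have "(cmod (L2_inner S h (expo l)))\<^sup>2 \<le> (cmod (L2_inner S f (expo l)) + cmod (L2_inner S w (expo l)))\<^sup>2"
          by (rule power_mono) simp
        then show ?thesis
          using sum_squares_bound[of "cmod (L2_inner S f (expo l))" "cmod (L2_inner S w (expo l))"] by (simp add: power2_sum)
      qed
      then have "(\<Sum>l\<in>F. (cmod (L2_inner S h (expo l)))\<^sup>2)
        \<le> (\<Sum>l\<in>F. 2 * (cmod (L2_inner S f (expo l)))\<^sup>2 + 2 * (cmod (L2_inner S w (expo l)))\<^sup>2)"
        by (intro sum_mono)
      also have "\<dots> = 2 * (\<Sum>l\<in>F. (cmod (L2_inner S f (expo l)))\<^sup>2) + 2 * (\<Sum>l\<in>F. (cmod (L2_inner S w (expo l)))\<^sup>2)"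
        by (simp add: sum.distrib sum_distrib_left)
      also have "(\<Sum>l\<in>F. (cmod (L2_inner S w (expo l)))\<^sup>2) \<le> B * (L2_nrm S w)\<^sup>2"
        by (rule bessel_if_synthesis_bound[OF S _ syn wL F]) (use AB in simp)
      also have "\<dots> \<le> B * d\<^sup>2"
        using wn AB L2_nrm_nonneg[of S w] by (intro mult_left_mono power_mono) auto
      also note Bd
      finally have up: "(\<Sum>l\<in>F. (cmod (L2_inner S h (expo l)))\<^sup>2) \<le> 2 * (\<Sum>l\<in>F. (cmod (L2_inner S f (expo l)))\<^sup>2) + 2 * (A / 64 * n\<^sup>2)"
        by simp
      have "(n / 2)\<^sup>2 \<le> (L2_nrm S h)\<^sup>2" by (rule power_mono[OF hn]) (use n in simp)
      then have "A / 4 * (n / 2)\<^sup>2 \<le> A / 4 * (L2_nrm S h)\<^sup>2" by (rule mult_left_mono) (use AB in simp)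
      then have "A / 16 * n\<^sup>2 \<le> A / 4 * (L2_nrm S h)\<^sup>2" by (simp add: power_divide)
      then have "A / 64 * n\<^sup>2 \<le> (\<Sum>l\<in>F. (cmod (L2_inner S f (expo l)))\<^sup>2)" using up Fh by simp
      then show ?thesis using F by (intro exI[of _ F]) (simp add: n_def)
    qed
  qed
  then show ?thesis using riesz by (simp add: exp_Riesz_basis_def)
qed

theorem theorem1p3:
  fixes S \<Lambda> :: "(real ^ 'd) set"
  assumes "S \<in> lmeasurable"
    and "almost_repetitive \<Lambda>"
  shows "(exp_frame S \<Lambda> \<and> lower_Beurling_density \<Lambda> = emeasure lebesgue S
            \<longrightarrow> exp_Riesz_basis S \<Lambda>) \<and>
         (exp_Riesz_sequence S \<Lambda> \<and> upper_Beurling_density \<Lambda> = emeasure lebesgue S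
            \<longrightarrow> exp_Riesz_basis S \<Lambda>)"
  using frame_critical_imp_Riesz_basis[OF assms] riesz_critical_imp_Riesz_basis[OF assms] by blast

end
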